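(* For every integer $r\geq 2$, the matroid $M_r$ (defined in the context) has rank $r$ and has $r$ pairwise disjoint bases, and its $2$-fold deleted join $(M_r)^{*2}_\Delta$ is $(2r-1)$-dimensional and $(2r-3)$-connected, but not $(2r-2)$-connected. In particular, there is a family of matroids $M_r$ $(r\geq 2)$, each of rank $r$ with $r$ disjoint bases, whose $2$-fold deleted joins are $(2r-1)$-dimensional and $(2r-3)$-connected but not $(2r-2)$-connected.
   Context: Simplicial complexes are finite abstract simplicial complexes (containing the empty face), identified with their geometric realizations when topological notions (connectivity) are used; a space is $n$-connected if it is nonempty and $\pi_i=0$ for all $0\le i\le n$. A matroid on a finite ground set $E$ is regarded as the simplicial complex of its independent sets; a basis is a maximal independent set and the rank is the common cardinality of the bases. For a simplicial complex $\Sigma$ with vertex set $V$, the $k$-fold deleted join $\Sigma^{*k}_\Delta$ is the simplicial complex on vertex set $V\times\{1,\dots,k\}$ whose faces are the sets $(\sigma_1\times\{1\})\cup\dots\cup(\sigma_k\times\{k\})$ with $\sigma_i\in\Sigma$ and $\sigma_i\cap\sigma_j=\emptyset$ for $i\neq j$. The matroid $M_r$ ($r\ge 2$): let $E$ consist of pairwise distinct elements $v_i^j$ ($i=1,\dots,r-1$, $j=1,\dots,r$) and $w_1,\dots,w_r$; set blocks $E_i=\{v_i^1,\dots,v_i^r\}$ for $i=1,\dots,r-1$ and $E_r=\{w_1,\dots,w_r\}$. Then $M_r$ is the simplicial complex on $E$ whose faces are the subsets $I\subseteq E$ with $|I|\le r$ and $|I\cap E_i|\le 1$ for $i=1,\dots,r-1$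 (equivalently, the $(r-1)$-skeleton of the direct sum $U_{1,r}(E_1)\oplus\dots\oplus U_{1,r}(E_{r-1})\oplus U_{r,r}(E_r)$ of uniform matroids). *)

theory Defs
  imports "HOL-Analysis.Analysis"
begin

definition simplicial_complex :: "'a set \<Rightarrow> 'a set set \<Rightarrow> bool" where
  "simplicial_complex V K \<longleftrightarrow>
     finite V \<and> K \<subseteq> Pow V \<and> {} \<in> K \<and> (\<forall>\<sigma>\<in>K. \<forall>\<tau>. \<tau> \<subseteq> \<sigma> \<longrightarrow> \<tau> \<in> K)"

text \<open>Integer valued, so that the complex whose only face is empty has dimension \<open>-1\<close>.\<close>

definition complex_dim :: "'a set set \<Rightarrow> int" where
  "complex_dim K = Max ((\<lambda>\<sigma>. int (card \<sigma>) - 1) ` K)"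

definition deleted_join :: "nat \<Rightarrow> 'a set set \<Rightarrow> ('a \<times> nat) set set" where
  "deleted_join k K =
     {\<Union>i\<in>{1..k}. \<sigma> i \<times> {i} | \<sigma>. (\<forall>i\<in>{1..k}. \<sigma> i \<in> K) \<and> disjoint_family_on \<sigma> {1..k}}"

lemma simplicial_complex_deleted_join:
  assumes "simplicial_complex V K"
  shows "simplicial_complex (V \<times> {1..k}) (deleted_join k K)"
proof -
  have K: "finite V" "K \<subseteq> Pow V" "{} \<in> K" "\<And>\<sigma> \<tau>. \<sigma> \<in> K \<Longrightarrow> \<tau> \<subseteq> \<sigma> \<Longrightarrow> \<tau> \<in> K"
    using assms unfolding simplicial_complex_def by auto
  have "deleted_join k K \<subseteq> Pow (V \<times> {1..k})"
    using K(2) unfolding deleted_join_def by fastforce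
  moreover have "{} \<in> deleted_join k K"
    unfolding deleted_join_def disjoint_family_on_def
    using K(3) by (auto intro!: exI[of _ "\<lambda>_. {}"])
  moreover have "\<tau> \<in> deleted_join k K" if \<rho>: "\<rho> \<in> deleted_join k K" and \<tau>: "\<tau> \<subseteq> \<rho>" for \<rho> \<tau>
  proof -
    obtain \<sigma> where \<sigma>: "\<rho> = (\<Union>i\<in>{1..k}. \<sigma> i \<times> {i})" "\<forall>i\<in>{1..k}. \<sigma> i \<in> K"
      "disjoint_family_on \<sigma> {1..k}"
      using \<rho> unfolding deleted_join_def by auto
    define \<sigma>' where "\<sigma>' = (\<lambda>i. {v. (v, i) \<in> \<tau>})"
    have sub: "\<sigma>' i \<subseteq> \<sigma> i" for i
      using \<tau> \<sigma>(1) unfolding \<sigma>'_def by auto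
    have "\<tau> = (\<Union>i\<in>{1..k}. \<sigma>' i \<times> {i})"
      using \<tau> \<sigma>(1) unfolding \<sigma>'_def by auto
    moreover have "\<forall>i\<in>{1..k}. \<sigma>' i \<in> K"
      using \<sigma>(2) sub K(4) by blast
    moreover have "disjoint_family_on \<sigma>' {1..k}"
      using \<sigma>(3) sub unfolding disjoint_family_on_def by blast
    ultimately show ?thesis
      unfolding deleted_join_def by blast
  qed
  ultimately show ?thesis
    using K(1) unfolding simplicial_complex_def by blast
qed

text \<open>
  Points are given by barycentric coordinates. The empty face contributes no point, since an
  empty sum is not \<open>1\<close>. For finite complexes the topology of pointwise convergence used here
  is the usual topology of the realization.
\<close>

definition geometric_realization :: "'a set set \<Rightarrow> ('a \<Rightarrow> real) topology" where
  "geometric_realization K =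
     subtopology (powertop_real UNIV)
       {x. (\<forall>v. 0 \<le> x v) \<and> {v. x v \<noteq> 0} \<in> K \<and> (\<Sum>v | x v \<noteq> 0. x v) = 1}"

definition nsphere_base :: "nat \<Rightarrow> real" where
  "nsphere_base = (\<lambda>i. if i = 0 then 1 else 0)"

lemma nsphere_base_in_nsphere: "nsphere_base \<in> topspace (nsphere n)"
  by (simp add: nsphere nsphere_base_def if_distrib[of "\<lambda>x. x ^ 2"] cong: if_cong)

definition based_maps :: "nat \<Rightarrow> 'a topology \<Rightarrow> 'a \<Rightarrow> ((nat \<Rightarrow> real) \<Rightarrow> 'a) set" where
  "based_maps n X x = {f. continuous_map (nsphere n) X f \<and> f nsphere_base = x}"

text \<open>
  The underlying set of \<open>\<pi>\<^sub>n(X, x)\<close>: based maps from the \<open>n\<close>-sphere modulo based homotopy.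
  For \<open>n = 0\<close> it is the set of path components. The group structure is not needed, as
  \<open>\<pi>\<^sub>n(X, x) = 0\<close> says that this set has exactly one element.
\<close>

definition homotopy_group_set ::
    "nat \<Rightarrow> 'a topology \<Rightarrow> 'a \<Rightarrow> ((nat \<Rightarrow> real) \<Rightarrow> 'a) set set" where
  "homotopy_group_set n X x =
     based_maps n X x //
       {(f, g). f \<in> based_maps n X x \<and> g \<in> based_maps n X x \<and>
                homotopic_with (\<lambda>h. h nsphere_base = x) (nsphere n) X f g}"

definition n_connected :: "int \<Rightarrow> 'a topology \<Rightarrow> bool" where
  "n_connected n X \<longleftrightarrow>
     topspace X \<noteq> {} \<and>
     (\<forall>i::nat. int i \<le> n \<longrightarrow> (\<forall>x\<in>topspace X. is_singleton (homotopy_group_set i X x)))"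

definition matroid :: "'a set \<Rightarrow> 'a set set \<Rightarrow> bool" where
  "matroid E M \<longleftrightarrow>
     simplicial_complex E M \<and>
     (\<forall>I\<in>M. \<forall>J\<in>M. card I < card J \<longrightarrow> (\<exists>e\<in>J - I. insert e I \<in> M))"

definition matroid_basis :: "'a set set \<Rightarrow> 'a set \<Rightarrow> bool" where
  "matroid_basis M B \<longleftrightarrow> B \<in> M \<and> (\<forall>I\<in>M. B \<subseteq> I \<longrightarrow> I = B)"

definition matroid_rank :: "'a set set \<Rightarrow> nat" where
  "matroid_rank M = (THE n. \<forall>B. matroid_basis M B \<longrightarrow> card B = n)"

text \<open>\<open>Vel i j\<close> stands for \<open>v\<^sub>i\<^sup>j\<close>, and \<open>Wel j\<close> for \<open>w\<^sub>j\<close>.\<close>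

datatype elt = Vel nat nat | Wel nat

definition block :: "nat \<Rightarrow> nat \<Rightarrow> elt set" where
  "block r i = (if i = r then Wel ` {1..r} else Vel i ` {1..r})"

definition ground :: "nat \<Rightarrow> elt set" where
  "ground r = (\<Union>i\<in>{1..r}. block r i)"

definition matroid_M :: "nat \<Rightarrow> elt set set" where
  "matroid_M r = {I. I \<subseteq> ground r \<and> card I \<le> r \<and> (\<forall>i\<in>{1..r - 1}. card (I \<inter> block r i) \<le> 1)}"

end

theory Submission
  imports Defs "HOL-Homology.Homology"
begin

text \<open>
  The deleted join \<open>X\<close> of \<open>M\<^sub>r\<close> is assembled, in the sense of discrete Morse theory, from elementary
  expansions and from faces with at least \<open>2r - 1\<close> vertices attached along their boundary. Since a
  map from a sphere can be pushed into the skeleton of the same dimension by simplicial approximation,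
  and an expansion is a homotopy equivalence, \<open>X\<close> is \<open>(2r - 3)\<close>-connected. The assembly
  proceeds by induction on the number of blocks: after deleting all but one vertex of a block in one
  copy (the links are complexes of the same kind), the remaining vertex is a cone point except over
  the bases of that copy, and the fibres over these bases are matroids.

  The obstruction to more connectivity is that \<open>X\<close> is not pure: a face \<open>F\<close> with all
  \<open>w\<^sub>j\<close> in one copy and one \<open>v\<^sub>i\<close> for each \<open>i\<close> in the other is maximal, but has only
  \<open>2r - 1\<close> vertices. The complex \<open>X - {F}\<close> is still \<open>(2r - 3)\<close>-connected, so \<open>F\<close> together
  with a null homotopy of its boundary gives a \<open>(2r - 2)\<close>-sphere in \<open>X\<close>. It is essential,
  because collapsing \<open>X - {F}\<close> maps it to a sphere with degree one.
\<close>

section \<open>Realizations and spheres\<close>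

text \<open>The number 2r - 1 is r + (r - 1): over a first part s with r elements, the second copy
  still has a transversal of all r - 1 blocks, because s meets a block at most once and a block has
  at least two elements. For s = W nothing else is left there; this is the lost dimension. In the
  induction, removing F only affects a fibre over W: it loses one facet of a join of discrete sets
  with at least two points each, and what remains is as connected as before. Links and deletions act
  on one copy at a time. The induction therefore runs over deleted joins of two different matroids,
  with rank bounds \<open>p\<close> and \<open>Suc (card I)\<close> for a set \<open>I\<close> of
  blocks, and proves \<open>built (p + card I)\<close>. No degree is computed: a map to R^(2r-1)
  without the origin is compared with the inclusion of the sphere by explicit homotopies, and the
  only fact quoted about spheres is that they are not contractible. Free null homotopies keep base
  points out of all geometric steps.\<close>

lemma continuous_on_Max_image:
  fixes f :: "'i \<Rightarrow> 'a::topological_space \<Rightarrow> real"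
  assumes "finite A" "A \<noteq> {}" "\<And>i. i \<in> A \<Longrightarrow> continuous_on S (f i)"
  shows "continuous_on S (\<lambda>x. Max ((\<lambda>i. f i x) ` A))"
  using assms
proof (induction A rule: finite_ne_induct)
  case (insert a A)
  have "continuous_on S (\<lambda>x. max (f a x) (Max ((\<lambda>i. f i x) ` A)))"
    using insert by (intro continuous_on_max) auto
  moreover have "(\<lambda>x. max (f a x) (Max ((\<lambda>i. f i x) ` A))) = (\<lambda>x. Max ((\<lambda>i. f i x) ` insert a A))"
    using insert by (auto simp: fun_eq_iff)
  ultimately show ?case by (simp only:)
qed simp

lemma continuous_on_Min_image:
  fixes f :: "'i \<Rightarrow> 'a::topological_space \<Rightarrow> real"
  assumes "finite A" "A \<noteq> {}" "\<And>i. i \<in> A \<Longrightarrow> continuous_on S (f i)"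
  shows "continuous_on S (\<lambda>x. Min ((\<lambda>i. f i x) ` A))"
  using assms
proof (induction A rule: finite_ne_induct)
  case (insert a A)
  have "continuous_on S (\<lambda>x. min (f a x) (Min ((\<lambda>i. f i x) ` A)))"
    using insert by (intro continuous_on_min) auto
  moreover have "(\<lambda>x. min (f a x) (Min ((\<lambda>i. f i x) ` A))) = (\<lambda>x. Min ((\<lambda>i. f i x) ` insert a A))"
    using insert by (auto simp: fun_eq_iff)
  ultimately show ?case by (simp only:)
qed simp

text \<open>The metric on functions weights the truncated coordinate distances by powers of 1/2, and
  these weights add up to 2.\<close>

lemma dist_fun_le:
  fixes x y :: "nat \<Rightarrow> real"
  assumes "\<And>j. \<bar>x j - y j\<bar> \<le> d"
  shows "dist x y \<le> 2 * d"
proof -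
  have "dist x y \<le> 2 * d + (1/2)^N" for N
  proof -
    have "Max {dist (x (from_nat n)) (y (from_nat n))|n. n \<le> N} \<le> d"
      by (subst Max_le_iff) (auto simp: dist_real_def assms)
    then show ?thesis using dist_fun_le_dist_first_terms[of x y N] by linarith
  qed
  moreover have "(\<lambda>N. 2 * d + (1/2)^N :: real) \<longlonglongrightarrow> 2 * d + 0"
    by (intro tendsto_intros LIMSEQ_realpow_zero) auto
  ultimately show ?thesis by (intro LIMSEQ_le_const[of _ "2*d+0" , simplified]) auto
qed

text \<open>The carrier of \<open>geometric_realization\<close> as a plain set, so that continuity
  and homotopies can be treated with \<open>continuous_on\<close>.\<close>

definition realization :: "'a set set \<Rightarrow> ('a \<Rightarrow> real) set" where
  "realization K = {x. (\<forall>v. 0 \<le> x v) \<and> {v. x v \<noteq> 0} \<in> K \<and> (\<Sum>v | x v \<noteq> 0. x v) = 1}"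

lemma geometric_realization_eq: "geometric_realization K = top_of_set (realization K)"
  by (simp add: geometric_realization_def realization_def euclidean_product_topology)

definition unit_sphere :: "nat \<Rightarrow> (nat \<Rightarrow> real) set" where
  "unit_sphere n = {x. (\<Sum>i\<le>n. (x i)\<^sup>2) = 1 \<and> (\<forall>i>n. x i = 0)}"

lemma nsphere_unit_sphere: "nsphere n = top_of_set (unit_sphere n)"
  by (simp add: nsphere unit_sphere_def euclidean_product_topology)

definition down_closed :: "'a set set \<Rightarrow> bool" where
  "down_closed K \<longleftrightarrow> (\<forall>\<sigma>\<in>K. \<forall>\<tau>. \<tau> \<subseteq> \<sigma> \<longrightarrow> \<tau> \<in> K)"

lemma down_closedD: "down_closed K \<Longrightarrow> \<sigma> \<in> K \<Longrightarrow> \<tau> \<subseteq> \<sigma> \<Longrightarrow> \<tau> \<in> K"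
  by (auto simp: down_closed_def)

lemma realizationI:
  assumes "down_closed K" "\<sigma> \<in> K" "finite \<sigma>" "\<And>v. 0 \<le> x v" "\<And>v. v \<notin> \<sigma> \<Longrightarrow> x v = 0"
    and "sum x \<sigma> = 1"
  shows "x \<in> realization K"
proof -
  have sub: "{v. x v \<noteq> 0} \<subseteq> \<sigma>" using assms by auto
  have "sum x {v. x v \<noteq> 0} = sum x \<sigma>"
    using sub assms by (intro sum.mono_neutral_left) auto
  then show ?thesis using sub assms by (auto simp: realization_def down_closed_def)
qed

lemma realization_nonneg: "x \<in> realization K \<Longrightarrow> 0 \<le> x v"
  by (simp add: realization_def)

lemma realization_support: "x \<in> realization K \<Longrightarrow> {v. x v \<noteq> 0} \<in> K"
  by (simp add: realization_def)

lemma realization_sum: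
  assumes "x \<in> realization K" "finite \<sigma>" "\<And>v. v \<notin> \<sigma> \<Longrightarrow> x v = 0"
  shows "sum x \<sigma> = 1"
proof -
  have "sum x {v. x v \<noteq> 0} = sum x \<sigma>"
    using assms by (intro sum.mono_neutral_left) auto
  then show ?thesis using assms by (simp add: realization_def)
qed

lemma realization_mono: "K \<subseteq> L \<Longrightarrow> realization K \<subseteq> realization L"
  by (auto simp: realization_def)

lemma homotopic_canonI:
  fixes h :: "real \<Rightarrow> 'a::topological_space \<Rightarrow> 'b::topological_space"
  assumes "continuous_on ({0..1} \<times> S) (\<lambda>(t, x). h t x)"
    and "\<And>t x. 0 \<le> t \<Longrightarrow> t \<le> 1 \<Longrightarrow> x \<in> S \<Longrightarrow> h t x \<in> T"
    and "\<And>x. x \<in> S \<Longrightarrow> h 0 x = f x" "\<And>x. x \<in> S \<Longrightarrow> h 1 x = g x"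
  shows "homotopic_with_canon (\<lambda>_. True) S T f g"
proof -
  have "homotopic_with_canon (\<lambda>_. True) S T (h 0) (h 1)"
    unfolding homotopic_with_def using assms(1,2)
    by - (rule exI[of _ "\<lambda>(t, x). h t x"], auto simp: image_subset_iff simp flip: subtopology_Times)
  then show ?thesis
    by (rule homotopic_with_eq) (use assms(3,4) in auto)
qed

lemma continuous_on_line:
  fixes f g :: "'b::topological_space \<Rightarrow> 'a \<Rightarrow> real"
  assumes "continuous_on S f" "continuous_on S g"
  shows "continuous_on ({0..1} \<times> S) (\<lambda>(t::real, x). (\<lambda>v. (1 - t) * f x v + t * g x v))"
proof -
  have c: "continuous_on ({0..1} \<times> S) (\<lambda>p. h (snd p) v)" if "continuous_on S h" for h :: "'b \<Rightarrow> 'a \<Rightarrow> real" and v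
    using continuous_on_product_then_coordinatewise[OF that, of v]
    by (rule continuous_on_compose2) (auto intro: continuous_intros)
  show ?thesis unfolding case_prod_unfold
    by (intro continuous_on_coordinatewise_then_product continuous_intros c assms)
qed

section \<open>Simplicial approximation\<close>

text \<open>The open star of the vertex \<open>z\<close> in the Freudenthal triangulation of
  R^(i+1). The walls of this triangulation are the hyperplanes on which a coordinate or a difference
  of two coordinates is an integer, hence the two kinds of conditions.\<close>

definition grid_near :: "nat \<Rightarrow> (nat \<Rightarrow> real) \<Rightarrow> (nat \<Rightarrow> int) \<Rightarrow> bool" where
  "grid_near i x z \<longleftrightarrow> (\<forall>j\<le>i. \<bar>x j - z j\<bar> < 1) \<and> (\<forall>j\<le>i. \<forall>k\<le>i. (x j - z j) - (x k - z k) < 1)"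

definition grid_points :: "nat \<Rightarrow> nat \<Rightarrow> (nat \<Rightarrow> int) set" where
  "grid_points i N = {z. (\<forall>j. (j \<in> {..i} \<longrightarrow> z j \<in> {-int N..int N}) \<and> (j \<notin> {..i} \<longrightarrow> z j = 0))}"

lemma finite_grid_points: "finite (grid_points i N)"
  unfolding grid_points_def by (rule finite_set_of_finite_funs) auto

text \<open>The grid points near \<open>x\<close> are the vertices of the simplex of the Freudenthal triangulation
  that contains \<open>x\<close>: they differ in which nonintegral coordinates are rounded up, and these
  sets of coordinates form a chain.\<close>

lemma card_grid_near:
  assumes "l \<le> i" "x l \<in> \<int>" "G \<subseteq> grid_points i N" "\<And>z. z \<in> G \<Longrightarrow> grid_near i x z"
  shows "card G \<le> Suc i"
proof -
  define up where "up z = {j\<in>{..i}. x j - of_int (z j) < 0}" for z :: "nat \<Rightarrow> int"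
  have fin: "finite (up z)" for z by (simp add: up_def)
  \<comment> \<open>An integral coordinate is never rounded up. So at most \<open>i\<close> of the
    \<open>Suc i\<close> coordinates can be, and a chain has at most \<open>Suc i\<close> members; a
    general point of R^(i+1) would allow one more.\<close>
  have up_sub: "up z \<subseteq> {..i} - {l}" if "z \<in> G" for z
  proof -
    obtain n where n: "x l = of_int n" using assms(2) Ints_cases by blast
    have "\<bar>x l - z l\<bar> < 1" using assms(1,4) that by (auto simp: grid_near_def)
    then have "z l = n" using n by linarith
    then show ?thesis using n by (auto simp: up_def)
  qed
  have z_eq: "z j = \<lfloor>x j\<rfloor> + (if j \<in> up z then 1 else 0)" if "z \<in> G" "j \<le> i" for z j
  proof -
    have "\<bar>x j - z j\<bar> < 1" using assms(4) that by (auto simp: grid_near_def)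
    then show ?thesis using that by (auto simp: up_def) linarith+
  qed
  have chain: "up z \<subseteq> up z' \<or> up z' \<subseteq> up z" if "z \<in> G" "z' \<in> G" for z z'
  proof (rule ccontr)
    assume "\<not> ?thesis"
    then obtain j k where jk: "j \<in> up z" "j \<notin> up z'" "k \<in> up z'" "k \<notin> up z" by auto
    then have le: "j \<le> i" "k \<le> i" by (auto simp: up_def)
    have "(x k - z k) - (x j - z j) < 1" "(x j - z' j) - (x k - z' k) < 1"
      using assms(4) that le by (auto simp: grid_near_def)
    moreover have "z j = \<lfloor>x j\<rfloor> + 1" "z' j = \<lfloor>x j\<rfloor>" "z k = \<lfloor>x k\<rfloor>" "z' k = \<lfloor>x k\<rfloor> + 1"
      using z_eq[of z j] z_eq[of z' j] z_eq[of z k] z_eq[of z' k] that le jk by auto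
    ultimately show False by simp
  qed
  have "inj_on (\<lambda>z. card (up z)) G"
  proof (rule inj_onI)
    fix z z' assume z: "z \<in> G" "z' \<in> G" and "card (up z) = card (up z')"
    then have up: "up z = up z'" using chain[OF z] card_subset_eq[OF fin] by metis
    show "z = z'"
    proof
      fix j show "z j = z' j"
        using z_eq[of z j] z_eq[of z' j] z up subsetD[OF assms(3) z(1)] subsetD[OF assms(3) z(2)]
        by (cases "j \<le> i") (auto simp: grid_points_def)
    qed
  qed
  moreover have "(\<lambda>z. card (up z)) ` G \<subseteq> {..i}"
  proof clarify
    fix z assume "z \<in> G"
    then have "card (up z) \<le> card ({..i} - {l})" using up_sub by (intro card_mono) auto
    then show "card (up z) \<le> i" using assms(1) by simp
  qed
  ultimately show ?thesis
    using card_inj_on_le[of "\<lambda>z. card (up z)" G "{..i}"] by simp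
qed

text \<open>A continuous function that is nonzero exactly on the star of \<open>z\<close>; divided
  by their sum, these functions form a partition of unity. The factors with \<open>j = k\<close>
  equal 1.\<close>

definition grid_bump :: "nat \<Rightarrow> (nat \<Rightarrow> int) \<Rightarrow> (nat \<Rightarrow> real) \<Rightarrow> real" where
  "grid_bump i z x =
     (\<Prod>j\<le>i. max 0 (1 - \<bar>x j - z j\<bar>)) * (\<Prod>j\<le>i. \<Prod>k\<le>i. max 0 (1 - ((x j - z j) - (x k - z k))))"

lemma grid_bump_nonneg: "0 \<le> grid_bump i z x"
  unfolding grid_bump_def by (intro mult_nonneg_nonneg prod_nonneg ballI) auto

lemma grid_bump_eq_0_iff: "grid_bump i z x = 0 \<longleftrightarrow> \<not> grid_near i x z"
proof -
  have m: "max 0 (1 - a) = 0 \<longleftrightarrow> \<not> a < 1" for a :: real by auto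
  show ?thesis by (auto simp: grid_bump_def grid_near_def m)
qed

lemma continuous_on_grid_bump:
  assumes "continuous_on S x"
  shows "continuous_on S (\<lambda>s. grid_bump i z (x s))"
  unfolding grid_bump_def
  by (intro continuous_intros continuous_on_prod continuous_on_product_then_coordinatewise[OF assms])

text \<open>Rounding every coordinate down gives a vertex of the simplex around \<open>x\<close>, so
  the stars cover the cube and the bumps never vanish simultaneously.\<close>

lemma floor_grid_near:
  assumes "\<And>j. j \<le> i \<Longrightarrow> \<bar>x j\<bar> \<le> real N"
  shows "(\<lambda>j. if j \<le> i then \<lfloor>x j\<rfloor> else 0) \<in> grid_points i N"
    and "grid_near i x (\<lambda>j. if j \<le> i then \<lfloor>x j\<rfloor> else 0)"
proof -
  show "(\<lambda>j. if j \<le> i then \<lfloor>x j\<rfloor> else 0) \<in> grid_points i N"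
    using assms by (fastforce simp: grid_points_def abs_le_iff le_floor_iff floor_le_iff)
  have "0 \<le> x j - \<lfloor>x j\<rfloor> \<and> x j - \<lfloor>x j\<rfloor> < 1" for j by linarith
  then show "grid_near i x (\<lambda>j. if j \<le> i then \<lfloor>x j\<rfloor> else 0)"
    unfolding grid_near_def by (smt (verit, best))
qed

text \<open>Division by it carries the sphere to the boundary of a cube, where every point has a
  coordinate 1 or -1. Scaled by an integer, this becomes the integral coordinate required in
  \<open>card_grid_near\<close>.\<close>

definition sup_norm :: "nat \<Rightarrow> (nat \<Rightarrow> real) \<Rightarrow> real" where
  "sup_norm i x = Max ((\<lambda>j. \<bar>x j\<bar>) ` {..i})"

lemma abs_le_sup_norm: "j \<le> i \<Longrightarrow> \<bar>x j\<bar> \<le> sup_norm i x"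
  by (simp add: sup_norm_def)

lemma sup_norm_attained: obtains j where "j \<le> i" "\<bar>x j\<bar> = sup_norm i x"
proof -
  have "sup_norm i x \<in> (\<lambda>j. \<bar>x j\<bar>) ` {..i}"
    unfolding sup_norm_def by (rule Max_in) auto
  then show ?thesis using that by auto
qed

lemma sup_norm_pos: "x \<in> unit_sphere i \<Longrightarrow> 0 < sup_norm i x"
proof (rule ccontr)
  assume x: "x \<in> unit_sphere i" and "\<not> 0 < sup_norm i x"
  then have "x j = 0" if "j \<le> i" for j using abs_le_sup_norm[OF that, of x] by auto
  then have "(\<Sum>j\<le>i. (x j)\<^sup>2) = 0" by simp
  then show False using x by (simp add: unit_sphere_def)
qed

lemma continuous_on_coord:
  fixes f :: "'b::topological_space \<Rightarrow> 'a \<Rightarrow> real"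
  shows "continuous_on S f \<Longrightarrow> continuous_on S (\<lambda>x. f x v)"
  by (rule continuous_on_product_then_coordinatewise)

lemma compact_unit_sphere: "compact (unit_sphere i)"
proof -
  have "compactin (product_topology (\<lambda>_::nat. euclideanreal) UNIV) (PiE UNIV (\<lambda>_. {-1..1}))"
    by (simp add: compactin_PiE)
  then have comp: "compact (PiE UNIV (\<lambda>_::nat. {-1..1::real}))"
    by (simp add: euclidean_product_topology)
  have "unit_sphere i \<subseteq> PiE UNIV (\<lambda>_. {-1..1})"
  proof
    fix x assume x: "x \<in> unit_sphere i"
    have "x j \<in> {-1..1}" for j
    proof (cases "j \<le> i")
      case True
      then have "(x j)\<^sup>2 \<le> (\<Sum>k\<le>i. (x k)\<^sup>2)" by (intro member_le_sum) auto
      then have "\<bar>x j\<bar> \<le> 1" using x by (simp add: unit_sphere_def abs_square_le_1)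
      then show ?thesis by (simp add: abs_le_iff minus_le_iff)
    qed (use x in \<open>auto simp: unit_sphere_def\<close>)
    then show "x \<in> PiE UNIV (\<lambda>_. {-1..1})" by auto
  qed
  moreover have "closed (unit_sphere i)"
    unfolding unit_sphere_def Collect_conj_eq
    by (intro closed_Int closed_Collect_all closed_Collect_imp closed_Collect_eq continuous_intros
        continuous_on_coord) auto
  ultimately show ?thesis using compact_Int_closed[OF comp] by (metis inf.absorb2)
qed

text \<open>On a fine enough grid, each star is mapped by \<open>f\<close> into the open star of one
  vertex of \<open>K\<close>. Sending grid points to such vertices and interpolating gives
  \<open>g\<close>. The support of \<open>g s\<close> lies in that of \<open>f s\<close>, so the
  segment between them stays in a face, and it has at most \<open>Suc i\<close> elements because at
  most that many grid points are near a point.\<close>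

theorem simplicial_approximation:
  fixes f :: "(nat \<Rightarrow> real) \<Rightarrow> 'a \<Rightarrow> real"
  assumes down: "down_closed K" and fin: "finite (\<Union>K)"
    and contf: "continuous_on (unit_sphere i) f" and f: "f ` unit_sphere i \<subseteq> realization K"
  obtains g where "homotopic_with_canon (\<lambda>_. True) (unit_sphere i) (realization K) f g"
    "g ` unit_sphere i \<subseteq> realization {\<sigma> \<in> K. card \<sigma> \<le> Suc i}"
proof -
  define S where "S = unit_sphere i"
  define u where "u s = (\<lambda>j. s j / sup_norm i s)" for s
  define h where "h x = (\<lambda>j. x j / sqrt (\<Sum>k\<le>i. (x k)\<^sup>2))" for x :: "nat \<Rightarrow> real"
  have contu: "continuous_on S u"
    unfolding u_def sup_norm_def using sup_norm_pos[of _ i]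
    by (intro continuous_intros continuous_on_coordinatewise_then_product continuous_on_Max_image
        continuous_on_coord) (force simp: S_def sup_norm_def)+
  have u_le: "\<bar>u s j\<bar> \<le> 1" if "s \<in> S" for s j
  proof (cases "j \<le> i")
    case True
    then show ?thesis using abs_le_sup_norm[OF True, of s] sup_norm_pos[of s i] that by (simp add: u_def S_def)
  next
    case False
    then show ?thesis using that by (auto simp: u_def S_def unit_sphere_def)
  qed
  have hu: "h (u s) = s" if "s \<in> S" for s
  proof -
    have "(\<Sum>k\<le>i. (u s k)\<^sup>2) = (1 / sup_norm i s)\<^sup>2"
      using that by (simp add: u_def S_def unit_sphere_def power_divide flip: sum_divide_distrib)
    then show ?thesis using sup_norm_pos[of s i] that
      by (auto simp: h_def u_def S_def real_sqrt_divide)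
  qed
  define C where "C = u ` S"
  have comp: "compact C"
    unfolding C_def using contu compact_unit_sphere by (auto simp: S_def intro: compact_continuous_image)
  have conth: "continuous_on C h"
  proof -
    have "(\<Sum>k\<le>i. (x k)\<^sup>2) \<noteq> 0" if "x \<in> C" for x
    proof
      assume 0: "(\<Sum>k\<le>i. (x k)\<^sup>2) = 0"
      obtain s where s: "s \<in> S" "x = u s" using \<open>x \<in> C\<close> by (auto simp: C_def)
      have "s = (\<lambda>_. 0)" using hu[OF s(1)] 0 by (simp add: s(2) h_def)
      then show False using s(1) by (simp add: S_def unit_sphere_def)
    qed
    then show ?thesis
      unfolding h_def
      by (intro continuous_intros continuous_on_coordinatewise_then_product continuous_on_coord) auto
  qed
  have hC: "h ` C \<subseteq> S" using hu by (auto simp: C_def)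
  define F where "F = f \<circ> h"
  have contF: "continuous_on C F"
    unfolding F_def using conth contf hC
    by (metis S_def continuous_on_compose continuous_on_subset)
  have F: "F x \<in> realization K" if "x \<in> C" for x
    using hC f that by (auto simp: F_def S_def)
  have Fpos: "\<exists>v\<in>\<Union>K. F x v > 0" if "x \<in> C" for x
  proof (rule ccontr)
    assume "\<not> ?thesis"
    then have "F x v = 0" if "v \<in> \<Union>K" for v
      using realization_nonneg[OF F[OF \<open>x \<in> C\<close>], of v] that by force
    then have "sum (F x) (\<Union>K) = 0" by simp
    moreover have "sum (F x) (\<Union>K) = 1"
      using realization_support[OF F[OF that]] by (intro realization_sum[OF F[OF that]] fin) blast
    ultimately show False by simp
  qed
  have "\<exists>G. open G \<and> G \<inter> C = {x \<in> C. F x v > 0}" for v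
  proof -
    have "continuous_on C (\<lambda>x. F x v)" by (rule continuous_on_coord[OF contF])
    then have "\<exists>A. open A \<and> A \<inter> C = (\<lambda>x. F x v) -` {0<..} \<inter> C"
      using open_greaterThan unfolding continuous_on_open_invariant by blast
    then show ?thesis by (auto simp: vimage_def Int_def conj_commute)
  qed
  then have "\<forall>v. \<exists>G. open G \<and> G \<inter> C = {x \<in> C. F x v > 0}" by blast
  from choice[OF this] obtain G where "\<forall>v. open (G v) \<and> G v \<inter> C = {x \<in> C. F x v > 0}" ..
  then have G: "\<And>v. open (G v)" "\<And>v. G v \<inter> C = {x \<in> C. F x v > 0}" by (simp_all only: simp_thms)
  have "C \<subseteq> \<Union>(G ` \<Union>K)"
  proof
    fix x assume x: "x \<in> C"
    obtain v where "v \<in> \<Union>K" "F x v > 0" using Fpos[OF x] by (rule bexE)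
    moreover have "x \<in> G v \<inter> C" unfolding G(2) using x \<open>F x v > 0\<close> by simp
    ultimately show "x \<in> \<Union>(G ` \<Union>K)" by blast
  qed
  then obtain e where e: "e > 0" "\<And>x. x \<in> C \<Longrightarrow> \<exists>B\<in>G ` \<Union>K. ball x e \<subseteq> B"
    by (rule Heine_Borel_lemma[OF comp]) (use G(1) in auto)
  \<comment> \<open>Two points in one star differ by at most 2/N in each coordinate, hence by at
    most 4/N in the metric, and this must be below the Lebesgue number \<open>e\<close>.\<close>
  obtain N :: nat where N: "4 / e < real N" using reals_Archimedean2 by blast
  then have Npos: "0 < real N" using e(1) by (smt (verit) divide_pos_pos)
  define sc where "sc x = (\<lambda>j. real N * x j)" for x :: "nat \<Rightarrow> real"
  have close: "dist x y < e" if "x \<in> C" "y \<in> C" "grid_near i (sc x) z" "grid_near i (sc y) z" for x y z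
  proof -
    have "\<bar>x j - y j\<bar> \<le> 2 / real N" for j
    proof (cases "j \<le> i")
      case True
      then have "\<bar>real N * x j - z j\<bar> < 1" "\<bar>real N * y j - z j\<bar> < 1"
        using that(3,4) by (auto simp: grid_near_def sc_def)
      then have "\<bar>real N * x j - real N * y j\<bar> \<le> 2" by linarith
      then have "real N * \<bar>x j - y j\<bar> \<le> 2" using Npos by (simp add: abs_mult flip: right_diff_distrib)
      then show ?thesis using Npos by (simp add: field_simps)
    next
      case False
      then have "x j = 0" "y j = 0" using that(1,2) by (auto simp: C_def u_def S_def unit_sphere_def)
      then show ?thesis by simp
    qed
    then have "dist x y \<le> 2 * (2 / real N)" by (rule dist_fun_le)
    also have "\<dots> < e" using N Npos e(1) by (simp add: field_simps)
    finally show ?thesis .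
  qed
  \<comment> \<open>All points of \<open>C\<close> near \<open>z\<close> lie in the
    \<open>e\<close>-ball around one of them, so one vertex serves them all. A grid point with no
    point of \<open>C\<close> near it gets an arbitrary vertex.\<close>
  have "\<exists>v. \<forall>x\<in>C. grid_near i (sc x) z \<longrightarrow> F x v > 0" for z
  proof (cases "\<exists>x\<in>C. grid_near i (sc x) z")
    case True
    then obtain x where x: "x \<in> C" "grid_near i (sc x) z" by blast
    then obtain v where v: "ball x e \<subseteq> G v" using e(2) by blast
    have "F y v > 0" if "y \<in> C" "grid_near i (sc y) z" for y
      using close[OF x(1) that(1) x(2) that(2)] v G(2)[of v] that(1) by auto
    then show ?thesis by blast
  qed auto
  then have "\<forall>z. \<exists>v. \<forall>x\<in>C. grid_near i (sc x) z \<longrightarrow> F x v > 0" by blast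
  from choice[OF this] obtain \<phi> where "\<forall>z. \<forall>x\<in>C. grid_near i (sc x) z \<longrightarrow> F x (\<phi> z) > 0" ..
  then have \<phi>: "\<And>z x. x \<in> C \<Longrightarrow> grid_near i (sc x) z \<Longrightarrow> F x (\<phi> z) > 0" by blast
  define Z where "Z = grid_points i N"
  define b where "b s z = grid_bump i z (sc (u s))" for s z
  have contb: "continuous_on S (\<lambda>s. b s z)" for z
    unfolding b_def sc_def
    by (intro continuous_on_grid_bump continuous_on_coordinatewise_then_product continuous_intros
        continuous_on_coord[OF contu])
  have finZ: "finite Z" by (simp add: Z_def finite_grid_points)
  have b0: "0 \<le> b s z" for s z by (simp add: b_def grid_bump_nonneg)
  have bpos: "sum (b s) Z > 0" if s: "s \<in> S" for s
  proof -
    have "\<bar>sc (u s) j\<bar> \<le> real N" for j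
      using u_le[OF s, of j] Npos by (simp add: sc_def abs_mult mult_left_le)
    from floor_grid_near[of i "sc (u s)", OF this] obtain z where z: "z \<in> Z" "grid_near i (sc (u s)) z"
      unfolding Z_def by blast
    then have "b s z \<noteq> 0" by (simp add: b_def grid_bump_eq_0_iff)
    then show ?thesis using b0 z finZ by (intro sum_pos2[of Z z]) (auto simp: less_le)
  qed
  \<comment> \<open>The weight of each grid point \<open>z\<close> goes to the vertex
    \<open>\<phi> z\<close>; a vertex collects the weights of all its preimages.\<close>
  define g where "g s = (\<lambda>v. (\<Sum>z | z \<in> Z \<and> \<phi> z = v. b s z) / sum (b s) Z)" for s
  have contg: "continuous_on S g"
    unfolding g_def using bpos
    by (intro continuous_on_coordinatewise_then_product continuous_intros continuous_on_sum contb)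
      (force simp: less_le)
  have gsupp: "v \<in> \<phi> ` {z\<in>Z. grid_near i (sc (u s)) z}" if "g s v \<noteq> 0" for s v
  proof -
    have "(\<Sum>z | z \<in> Z \<and> \<phi> z = v. b s z) \<noteq> 0" using that by (auto simp: g_def)
    then obtain z where "z \<in> Z" "\<phi> z = v" "b s z \<noteq> 0" using sum.neutral by (metis (mono_tags, lifting) mem_Collect_eq)
    then show ?thesis by (auto simp: b_def grid_bump_eq_0_iff)
  qed
  have Fu: "F (u s) = f s" if "s \<in> S" for s using hu that by (simp add: F_def)
  have gsub: "f s v \<noteq> 0" if "g s v \<noteq> 0" "s \<in> S" for s v
    using gsupp[OF that(1)] \<phi>[of "u s"] that(2) by (force simp: Fu[OF that(2)] C_def)
  have g0: "0 \<le> g s v" for s v unfolding g_def by (intro divide_nonneg_nonneg sum_nonneg b0)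
  have fs: "f s \<in> realization K" if "s \<in> S" for s using f that by (auto simp: S_def)
  have fsupp: "finite {v. f s v \<noteq> 0}" if "s \<in> S" for s
    using realization_support[OF fs[OF that]] fin by (metis Sup_upper finite_subset)
  have gsum: "sum (g s) T = 1" if s: "s \<in> S" and T: "finite T" "\<And>v. g s v \<noteq> 0 \<Longrightarrow> v \<in> T" for s T
  proof -
    have "sum (g s) T = sum (g s) (T \<union> \<phi> ` Z)"
      using T finZ by (intro sum.mono_neutral_left) auto
    also have "\<dots> = (\<Sum>v\<in>T \<union> \<phi> ` Z. \<Sum>z | z \<in> Z \<and> \<phi> z = v. b s z) / sum (b s) Z"
      by (simp add: g_def sum_divide_distrib)
    also have "(\<Sum>v\<in>T \<union> \<phi> ` Z. \<Sum>z | z \<in> Z \<and> \<phi> z = v. b s z) = sum (b s) Z"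
      using T finZ by (intro sum.group) auto
    finally show ?thesis using bpos[OF s] by simp
  qed
  show ?thesis
  proof
    show "homotopic_with_canon (\<lambda>_. True) (unit_sphere i) (realization K) f g"
    proof (rule homotopic_canonI[where h = "\<lambda>t s v. (1 - t) * f s v + t * g s v"])
      show "continuous_on ({0..1} \<times> unit_sphere i) (\<lambda>(t, s) v. (1 - t) * f s v + t * g s v)"
        using contf contg by (intro continuous_on_line) (auto simp: S_def)
      fix t :: real and s assume t: "0 \<le> t" "t \<le> 1" and "s \<in> unit_sphere i"
      then have s: "s \<in> S" by (simp add: S_def)
      show "(\<lambda>v. (1 - t) * f s v + t * g s v) \<in> realization K"
      proof (rule realizationI[OF down realization_support[OF fs[OF s]] fsupp[OF s]])
        show "0 \<le> (1 - t) * f s v + t * g s v" for v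
          using t g0 realization_nonneg[OF fs[OF s]] by simp
        show "(1 - t) * f s v + t * g s v = 0" if "v \<notin> {v. f s v \<noteq> 0}" for v
          using that gsub[OF _ s, of v] by auto
        have "sum (f s) {v. f s v \<noteq> 0} = 1" using fs[OF s] by (simp add: realization_def)
        moreover have "sum (g s) {v. f s v \<noteq> 0} = 1"
          by (rule gsum[OF s fsupp[OF s]]) (use gsub[OF _ s] in auto)
        ultimately show "(\<Sum>v | f s v \<noteq> 0. (1 - t) * f s v + t * g s v) = 1"
          by (simp add: sum.distrib flip: sum_distrib_left)
      qed
    qed auto
    show "g ` unit_sphere i \<subseteq> realization {\<sigma> \<in> K. card \<sigma> \<le> Suc i}"
    proof clarify
      fix s assume "s \<in> unit_sphere i"
      then have s: "s \<in> S" by (simp add: S_def)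
      define A where "A = {z\<in>Z. grid_near i (sc (u s)) z}"
      obtain l where l: "l \<le> i" "\<bar>s l\<bar> = sup_norm i s" by (rule sup_norm_attained)
      then have "\<bar>u s l\<bar> = 1" using sup_norm_pos[of s i] s by (simp add: u_def S_def)
      then have "sc (u s) l = real N \<or> sc (u s) l = - real N" by (auto simp: sc_def abs_if split: if_splits)
      then have int: "sc (u s) l \<in> \<int>" by auto
      have "card A \<le> Suc i"
        by (rule card_grid_near[where x = "sc (u s)", OF l(1) int]) (auto simp: A_def Z_def)
      then have "card (\<phi> ` A) \<le> Suc i" using card_image_le[of A \<phi>] finZ by (simp add: A_def)
      moreover have "{v. g s v \<noteq> 0} \<subseteq> \<phi> ` A" using gsupp[of s] by (auto simp: A_def)
      ultimately have c: "card {v. g s v \<noteq> 0} \<le> Suc i"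
        by (metis (no_types, lifting) A_def card_mono finZ finite_imageI finite_subset le_trans mem_Collect_eq subsetI)
      have fing: "finite {v. g s v \<noteq> 0}"
        by (rule finite_subset[OF _ fsupp[OF s]]) (use gsub[OF _ s] in auto)
      have "{v. g s v \<noteq> 0} \<in> K"
        by (rule down_closedD[OF down realization_support[OF fs[OF s]]]) (use gsub[OF _ s] in auto)
      then show "g s \<in> realization {\<sigma> \<in> K. card \<sigma> \<le> Suc i}"
        using c g0 gsum[OF s fing] by (simp add: realization_def)
    qed
  qed
qed

section \<open>Complexes built by expansions and attached faces\<close>

text \<open>A discrete Morse description: \<open>K\<close> arises by elementary expansions (inverse collapses, which
  also create the first vertex together with the empty face) and by attaching faces with at
  least \<open>m\<close> vertices along their whole boundary.\<close>

inductive built :: "nat \<Rightarrow> 'a set set \<Rightarrow> bool" for m where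
  empty: "built m {}"
| expand: "built m K \<Longrightarrow> finite F \<Longrightarrow> x \<notin> F \<Longrightarrow> F \<notin> K \<Longrightarrow> (\<And>y. y \<in> F \<Longrightarrow> insert x F - {y} \<in> K)
    \<Longrightarrow> built m (insert F (insert (insert x F) K))"
| cell: "built m K \<Longrightarrow> finite F \<Longrightarrow> m \<le> card F \<Longrightarrow> (\<And>y. y \<in> F \<Longrightarrow> F - {y} \<in> K)
    \<Longrightarrow> built m (insert F K)"

lemma built_down_closed: "built m K \<Longrightarrow> down_closed K"
proof (induction rule: built.induct)
  case (expand K F x)
  have F: "\<tau> \<in> insert F K" if "\<tau> \<subseteq> F" for \<tau>
  proof (cases "\<tau> = F")
    case False
    then obtain y where "y \<in> F" "\<tau> \<subseteq> insert x F - {y}" using \<open>\<tau> \<subseteq> F\<close> \<open>x \<notin> F\<close> by blast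
    then show ?thesis using expand down_closedD by blast
  qed simp
  have "\<tau> \<in> insert F (insert (insert x F) K)" if "\<tau> \<subseteq> insert x F" for \<tau>
  proof (cases "\<tau> = insert x F \<or> \<tau> \<subseteq> F")
    case False
    then obtain y where "y \<in> F" "\<tau> \<subseteq> insert x F - {y}" using \<open>\<tau> \<subseteq> insert x F\<close> by blast
    then show ?thesis using expand down_closedD by blast
  qed (use F in auto)
  then show ?case using F expand.IH unfolding down_closed_def by blast
next
  case (cell K F)
  have "\<tau> \<in> insert F K" if "\<tau> \<subseteq> F" for \<tau>
  proof (cases "\<tau> = F")
    case False
    then obtain y where "y \<in> F" "\<tau> \<subseteq> F - {y}" using \<open>\<tau> \<subseteq> F\<close> by blast
    then show ?thesis using cell down_closedD by blast
  qed simp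
  then show ?case using cell.IH unfolding down_closed_def by blast
qed (simp add: down_closed_def)

lemma built_finite: "built m K \<Longrightarrow> finite (\<Union>K)"
  by (induction rule: built.induct) auto

lemma built_finite_faces: "built m K \<Longrightarrow> finite K"
  by (induction rule: built.induct) auto

text \<open>Free homotopies need no base point. The property also holds vacuously for the empty set,
  where every construction of a complex starts.\<close>

definition null_homotopic_spheres :: "nat \<Rightarrow> 'a::topological_space set \<Rightarrow> bool" where
  "null_homotopic_spheres i T \<longleftrightarrow>
     (\<forall>f. continuous_on (unit_sphere i) f \<longrightarrow> f ` unit_sphere i \<subseteq> T \<longrightarrow>
       (\<exists>c. homotopic_with_canon (\<lambda>_. True) (unit_sphere i) T f (\<lambda>_. c)))"

lemma null_homotopic_spheresD:
  assumes "null_homotopic_spheres i T" "continuous_on (unit_sphere i) f" "f ` unit_sphere i \<subseteq> T"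
  obtains c where "homotopic_with_canon (\<lambda>_. True) (unit_sphere i) T f (\<lambda>_. c)"
  using assms unfolding null_homotopic_spheres_def by blast

text \<open>Serves both kinds of building steps: an expansion pushes every sphere back into the old
  realization, and a cell of high dimension is missed after simplicial approximation.\<close>

lemma null_homotopic_spheres_transfer:
  assumes "null_homotopic_spheres i T" "T \<subseteq> U"
    and "\<And>f. continuous_on (unit_sphere i) f \<Longrightarrow> f ` unit_sphere i \<subseteq> U \<Longrightarrow>
      \<exists>g. homotopic_with_canon (\<lambda>_. True) (unit_sphere i) U f g \<and> g ` unit_sphere i \<subseteq> T"
  shows "null_homotopic_spheres i U"
  unfolding null_homotopic_spheres_def
proof (intro allI impI)
  fix f :: "(nat \<Rightarrow> real) \<Rightarrow> 'a"
  assume f: "continuous_on (unit_sphere i) f" "f ` unit_sphere i \<subseteq> U"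
  obtain g where g: "homotopic_with_canon (\<lambda>_. True) (unit_sphere i) U f g" "g ` unit_sphere i \<subseteq> T"
    using assms(3)[OF f] by blast
  have "continuous_on (unit_sphere i) g" using homotopic_with_imp_continuous[OF g(1)] by blast
  then obtain c where "homotopic_with_canon (\<lambda>_. True) (unit_sphere i) T g (\<lambda>_. c)"
    using null_homotopic_spheresD[OF assms(1) _ g(2)] by blast
  then have "homotopic_with_canon (\<lambda>_. True) (unit_sphere i) U g (\<lambda>_. c)"
    by (rule homotopic_with_subset_right) (rule assms(2))
  then show "\<exists>c. homotopic_with_canon (\<lambda>_. True) (unit_sphere i) U f (\<lambda>_. c)"
    using homotopic_with_trans[OF g(1)] by blast
qed

lemma unit_sphere_nonempty: "unit_sphere i \<noteq> {}"
  using nsphere_base_in_nsphere[of i] by (auto simp: nsphere_unit_sphere)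

text \<open>An elementary expansion is undone by pushing mass from the free face \<open>F\<close> to the vertex
  \<open>x\<close> until one of the coordinates in \<open>F\<close> vanishes.\<close>

lemma null_homotopic_spheres_expand:
  fixes K :: "'a set set"
  assumes down: "down_closed K" and "finite F" "x \<notin> F" "F \<notin> K" "F \<noteq> {}"
    and bd: "\<And>y. y \<in> F \<Longrightarrow> insert x F - {y} \<in> K"
    and null: "null_homotopic_spheres i (realization K)"
    and down': "down_closed (insert F (insert (insert x F) K))"
  shows "null_homotopic_spheres i (realization (insert F (insert (insert x F) K)))"
proof (rule null_homotopic_spheres_transfer[OF null])
  define K' where "K' = insert F (insert (insert x F) K)"
  define mu where "mu y = Min (y ` F)" for y :: "'a \<Rightarrow> real"
  define H where "H t y = (\<lambda>v. if v = x then y x + t * card F * mu y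
    else if v \<in> F then y v - t * mu y else y v)" for t :: real and y :: "'a \<Rightarrow> real"
  show "realization K \<subseteq> realization (insert F (insert (insert x F) K))"
    by (rule realization_mono) auto
  have mu_le: "mu y \<le> y v" if "v \<in> F" for y v
    using that \<open>finite F\<close> by (simp add: mu_def)
  have mu_att: "\<exists>v\<in>F. y v = mu y" for y
  proof -
    have "mu y \<in> y ` F" unfolding mu_def by (rule Min_in) (use assms in auto)
    then show ?thesis by auto
  qed
  have mu0: "0 \<le> mu y" if "y \<in> realization K'" for y
    using mu_att[of y] realization_nonneg[OF that] by metis
  have H0: "H t y = y" if "mu y = 0" for t y
    using that by (auto simp: H_def)
  have inK: "y \<in> realization K" if "y \<in> realization K'" "mu y = 0" for y
  proof -
    obtain v where v: "v \<in> F" "y v = 0" using mu_att[of y] \<open>mu y = 0\<close> by auto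
    then have "{v. y v \<noteq> 0} \<noteq> F" "{v. y v \<noteq> 0} \<noteq> insert x F" by auto
    then have "{v. y v \<noteq> 0} \<in> K" using realization_support[OF that(1)] by (simp add: K'_def)
    then show ?thesis using that(1) by (simp add: realization_def)
  qed
  \<comment> \<open>Where \<open>mu\<close> is positive the support contains \<open>F\<close>, so it
    is \<open>F\<close> or \<open>insert x F\<close>. Elsewhere the point already lies in the
    realization of \<open>K\<close> and \<open>H\<close> does not move it.\<close>
  have supp: "y v = 0" if "y \<in> realization K'" "mu y > 0" "v \<notin> insert x F" for y v
  proof (rule ccontr)
    assume "y v \<noteq> 0"
    have "F \<subseteq> {v. y v \<noteq> 0}" using mu_le[of _ y] that(2) by force
    moreover have "{v. y v \<noteq> 0} \<in> K"
      using realization_support[OF that(1)] that(3) \<open>y v \<noteq> 0\<close> by (auto simp: K'_def)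
    ultimately show False using down_closedD[OF down] \<open>F \<notin> K\<close> by blast
  qed
  have Hsum: "sum (H t y) (insert x F) = 1" if "y \<in> realization K'" "mu y > 0" for t y
  proof -
    have "sum (H t y) F = (\<Sum>v\<in>F. y v - t * mu y)"
      using \<open>x \<notin> F\<close> by (intro sum.cong) (auto simp: H_def)
    also have "\<dots> = sum y F - card F * (t * mu y)" by (simp add: sum_subtractf)
    finally have "sum (H t y) (insert x F) = sum y (insert x F)"
      using \<open>x \<notin> F\<close> \<open>finite F\<close> by (simp add: H_def)
    also have "\<dots> = 1"
      using realization_sum[OF that(1)] supp[OF that] \<open>finite F\<close> by blast
    finally show ?thesis .
  qed
  have Hnn: "0 \<le> H t y v" if "y \<in> realization K'" "0 \<le> t" "t \<le> 1" for t y v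
  proof -
    have "t * mu y \<le> y v" if "v \<in> F"
      using mult_left_le_one_le[of "mu y" t] mu_le[OF that, of y] mu0[OF \<open>y \<in> realization K'\<close>] \<open>0 \<le> t\<close> \<open>t \<le> 1\<close> by linarith
    then show ?thesis
      using that mu0[OF that(1)] realization_nonneg[OF that(1)] by (auto simp: H_def)
  qed
  have HK': "H t y \<in> realization K'" if "y \<in> realization K'" "0 \<le> t" "t \<le> 1" for t y
  proof (cases "mu y = 0")
    case False
    then have pos: "mu y > 0" using mu0[OF that(1)] by simp
    show ?thesis
    proof (rule realizationI[of K' "insert x F"])
      show "H t y v = 0" if "v \<notin> insert x F" for v
        using supp[OF \<open>y \<in> realization K'\<close> pos that] that by (auto simp: H_def)
    qed (use down' Hnn[OF that] Hsum[OF that(1) pos] \<open>finite F\<close> in \<open>auto simp: K'_def\<close>)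
  qed (use H0 that in simp)
  have HK: "H 1 y \<in> realization K" if "y \<in> realization K'" for y
  proof (cases "mu y = 0")
    case False
    then have pos: "mu y > 0" using mu0[OF that(1)] by simp
    obtain w where w: "w \<in> F" "y w = mu y" using mu_att by blast
    then have Hw: "H 1 y w = 0" using \<open>x \<notin> F\<close> by (auto simp: H_def)
    show ?thesis
    proof (rule realizationI[OF down bd[OF w(1)]])
      show "H 1 y v = 0" if "v \<notin> insert x F - {w}" for v
        using supp[OF \<open>y \<in> realization K'\<close> pos, of v] that Hw by (auto simp: H_def)
      have "sum (H 1 y) (insert x F) = sum (H 1 y) (insert x F - {w})"
        using Hw w \<open>finite F\<close> by (intro sum.mono_neutral_right) auto
      then show "sum (H 1 y) (insert x F - {w}) = 1" using Hsum[OF that pos] by simp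
    qed (use Hnn[OF that, of 1] \<open>finite F\<close> in auto)
  qed (use H0 inK that in simp)
  fix f :: "(nat \<Rightarrow> real) \<Rightarrow> 'a \<Rightarrow> real"
  assume f: "continuous_on (unit_sphere i) f"
    "f ` unit_sphere i \<subseteq> realization (insert F (insert (insert x F) K))"
  have c: "continuous_on ({0..1::real} \<times> unit_sphere i) (\<lambda>p. f (snd p) v)" for v
    by (rule continuous_on_compose2[OF continuous_on_coord[OF f(1)]]) (auto intro: continuous_intros)
  have "continuous_on ({0..1} \<times> unit_sphere i) (\<lambda>(t, s). H t (f s))"
    unfolding case_prod_unfold
  proof (rule continuous_on_coordinatewise_then_product)
    fix v
    have m: "continuous_on ({0..1::real} \<times> unit_sphere i) (\<lambda>p. mu (f (snd p)))"
      unfolding mu_def by (intro continuous_on_Min_image c \<open>finite F\<close> \<open>F \<noteq> {}\<close>)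
    consider "v = x" | "v \<noteq> x" "v \<in> F" | "v \<noteq> x" "v \<notin> F" by blast
    then show "continuous_on ({0..1} \<times> unit_sphere i) (\<lambda>p. H (fst p) (f (snd p)) v)"
      by cases (simp_all add: H_def, (intro continuous_intros c m)+)
  qed
  then have "homotopic_with_canon (\<lambda>_. True) (unit_sphere i) (realization K') f (\<lambda>s. H 1 (f s))"
    by (rule homotopic_canonI) (use f(2) HK' in \<open>auto simp: K'_def H_def\<close>)
  moreover have "(\<lambda>s. H 1 (f s)) ` unit_sphere i \<subseteq> realization K"
    using f(2) HK by (auto simp: K'_def)
  ultimately show "\<exists>g. homotopic_with_canon (\<lambda>_. True) (unit_sphere i)
      (realization (insert F (insert (insert x F) K))) f g \<and> g ` unit_sphere i \<subseteq> realization K"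
    unfolding K'_def by blast
qed

text \<open>A face with at least \<open>m\<close> vertices has dimension at least
  \<open>m - 1\<close>, which exceeds \<open>i\<close>, so a map into the \<open>i\<close>-skeleton
  avoids it. Thus \<open>built m\<close> controls spheres up to dimension
  \<open>m - 2\<close>.\<close>

theorem built_null_homotopic_spheres:
  assumes "built m K" "i + 2 \<le> m"
  shows "null_homotopic_spheres i (realization K)"
  using assms
proof (induction rule: built.induct)
  case empty
  then show ?case using unit_sphere_nonempty[of i]
    by (auto simp: null_homotopic_spheres_def realization_def)
next
  case (expand K F x)
  note down = built_down_closed[OF expand(1)]
    and down' = built_down_closed[OF built.expand[OF expand(1-5)]]
  show ?case
  proof (cases "F = {}")
    case False
    show ?thesis
      by (rule null_homotopic_spheres_expand[OF down expand(2-4) False expand(5) expand.IH down'])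
        (use expand.prems in simp_all)
  next
    case True
    \<comment> \<open>A down-closed \<open>K\<close> without the empty face has no faces at all;
      this expansion creates the first vertex, and the realization is one point.\<close>
    then have "K = {}" using down expand(4) by (auto dest: down_closedD)
    have pt: "y = (\<lambda>v. if v = x then 1 else 0)" if "y \<in> realization {{}, {x}}" for y :: "'a \<Rightarrow> real"
    proof
      fix v
      have "y v = 0" if "v \<noteq> x" for v
        using realization_support[OF \<open>y \<in> realization {{}, {x}}\<close>] that by auto
      moreover have "sum y {x} = 1"
        by (rule realization_sum[OF \<open>y \<in> realization {{}, {x}}\<close>]) (use calculation in auto)
      ultimately show "y v = (if v = x then 1 else 0)" by auto
    qed
    show ?thesis unfolding \<open>K = {}\<close> True null_homotopic_spheres_def
    proof (intro allI impI)
      fix f :: "(nat \<Rightarrow> real) \<Rightarrow> 'a \<Rightarrow> real"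
      assume f: "continuous_on (unit_sphere i) f" "f ` unit_sphere i \<subseteq> realization {{}, {x}}"
      have "homotopic_with_canon (\<lambda>_. True) (unit_sphere i) (realization {{}, {x}}) f
          (\<lambda>_ v. if v = x then 1 else 0)"
        using f pt by (intro homotopic_with_equal) (auto simp: image_subset_iff)
      then show "\<exists>c. homotopic_with_canon (\<lambda>_. True) (unit_sphere i) (realization {{}, {x}}) f (\<lambda>_. c)"
        by blast
    qed
  qed
next
  case (cell K F)
  note down' = built_down_closed[OF built.cell[OF cell(1-4)]]
  show ?case
  proof (rule null_homotopic_spheres_transfer[OF cell.IH])
    show "i + 2 \<le> m" by fact
    show "realization K \<subseteq> realization (insert F K)" by (rule realization_mono) auto
    fix f :: "(nat \<Rightarrow> real) \<Rightarrow> 'a \<Rightarrow> real"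
    assume f: "continuous_on (unit_sphere i) f" "f ` unit_sphere i \<subseteq> realization (insert F K)"
    have fin: "finite (\<Union>(insert F K))" using built_finite[OF cell(1)] cell(2) by simp
    obtain g where g: "homotopic_with_canon (\<lambda>_. True) (unit_sphere i) (realization (insert F K)) f g"
      "g ` unit_sphere i \<subseteq> realization {\<sigma> \<in> insert F K. card \<sigma> \<le> Suc i}"
      by (rule simplicial_approximation[OF down' fin f])
    have "realization {\<sigma> \<in> insert F K. card \<sigma> \<le> Suc i} \<subseteq> realization K"
      using cell(3) cell.prems by (intro realization_mono) auto
    then show "\<exists>g. homotopic_with_canon (\<lambda>_. True) (unit_sphere i) (realization (insert F K)) f g
        \<and> g ` unit_sphere i \<subseteq> realization K"
      using g by blast
  qed
qed

section \<open>Homotopy groups\<close>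

lemma L2_set_unit_sphere: "s \<in> unit_sphere i \<Longrightarrow> L2_set s {..i} = 1"
  by (simp add: unit_sphere_def L2_set_def)

lemma normalize_unit_sphere:
  assumes "L2_set y {..i} \<noteq> 0" "\<And>j. j > i \<Longrightarrow> y j = 0"
  shows "(\<lambda>j. y j / L2_set y {..i}) \<in> unit_sphere i"
proof -
  have "(\<Sum>j\<le>i. (y j)\<^sup>2) = (L2_set y {..i})\<^sup>2"
    by (simp add: L2_set_def sum_nonneg)
  then have "(\<Sum>j\<le>i. (y j / L2_set y {..i})\<^sup>2) = 1"
    using assms(1) by (simp add: power_divide flip: sum_divide_distrib)
  then show ?thesis using assms(2) by (simp add: unit_sphere_def)
qed

lemma continuous_on_L2_set:
  fixes f :: "'b::topological_space \<Rightarrow> 'a \<Rightarrow> real"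
  shows "continuous_on S f \<Longrightarrow> continuous_on S (\<lambda>x. L2_set (f x) A)"
  unfolding L2_set_def
  by (rule continuous_on_real_sqrt, rule continuous_on_sum, rule continuous_on_power, rule continuous_on_coord)

lemma nsphere_base_unit_sphere: "nsphere_base \<in> unit_sphere i"
  using nsphere_base_in_nsphere[of i] by (simp add: nsphere_unit_sphere)

lemma based_maps_iff:
  "f \<in> based_maps i (top_of_set T) x \<longleftrightarrow>
    continuous_on (unit_sphere i) f \<and> f ` unit_sphere i \<subseteq> T \<and> f nsphere_base = x"
  by (auto simp: based_maps_def nsphere_unit_sphere)

text \<open>A free null homotopy amounts to an extension over the ball; contracting the ball linearly
  to the base point then gives a based null homotopy.\<close>

lemma based_null_homotopy:
  assumes null: "null_homotopic_spheres i T" and f: "f \<in> based_maps i (top_of_set T) x"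
  shows "homotopic_with (\<lambda>h. h nsphere_base = x) (nsphere i) (top_of_set T) f (\<lambda>_. x)"
proof -
  let ?S = "unit_sphere i"
  have f': "continuous_on ?S f" "f ` ?S \<subseteq> T" "f nsphere_base = x" using f by (auto simp: based_maps_iff)
  obtain c where "homotopic_with_canon (\<lambda>_. True) ?S T f (\<lambda>_. c)"
    using null_homotopic_spheresD[OF null f'(1,2)] .
  then obtain h :: "real \<times> (nat \<Rightarrow> real) \<Rightarrow> 'a" where conth: "continuous_on ({0..1} \<times> ?S) h"
    and h: "h ` ({0..1} \<times> ?S) \<subseteq> T" "\<And>s. h (0, s) = f s" "\<And>s. h (1, s) = c"
    unfolding homotopic_with_def by (auto simp: image_subset_iff Pi_iff)
  have cT: "c \<in> T" using h(1) h(3)[of nsphere_base] nsphere_base_unit_sphere[of i]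
    by (metis (no_types, lifting) atLeastAtMost_iff imageI mem_Sigma_iff order_refl subsetD zero_le_one)
  define nrm where "nrm y = L2_set y {..i}" for y :: "nat \<Rightarrow> real"
  define D where "D = {y. nrm y \<le> 1 \<and> (\<forall>j>i. y j = 0)}"
  \<comment> \<open>Polar coordinates on the shell of radii 1/2 to 1: the time of \<open>h\<close>
    runs from 0 on the sphere to 1 at radius 1/2, and the inner ball is sent to
    \<open>c\<close>.\<close>
  define r where "r y = (2 * (1 - nrm y), \<lambda>j. y j / nrm y)" for y :: "nat \<Rightarrow> real"
  define F where "F y = (if nrm y \<le> 1 / 2 then c else h (r y))" for y :: "nat \<Rightarrow> real"
  have contn: "continuous_on A nrm" for A
    unfolding nrm_def by (intro continuous_on_L2_set continuous_on_id)
  have rD: "r y \<in> {0..1} \<times> ?S" if "y \<in> D" "1 / 2 \<le> nrm y" for y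
  proof -
    have "(\<lambda>j. y j / nrm y) \<in> ?S"
      unfolding nrm_def by (rule normalize_unit_sphere) (use that in \<open>auto simp: D_def nrm_def\<close>)
    then show ?thesis using that by (simp add: r_def D_def)
  qed
  have contr: "continuous_on {y \<in> D. 1 / 2 \<le> nrm y} r"
    unfolding r_def
    by (rule continuous_on_Pair, intro continuous_intros contn,
        rule continuous_on_coordinatewise_then_product, rule continuous_on_divide,
        rule continuous_on_coord[OF continuous_on_id], rule contn) auto
  have contF: "continuous_on D F"
    unfolding F_def
  proof (rule continuous_on_cases_le)
    show "continuous_on {y \<in> D. 1 / 2 \<le> nrm y} (\<lambda>y. h (r y))"
      by (rule continuous_on_compose2[OF conth contr]) (use rD in blast)
    show "c = h (r y)" if "y \<in> D" "nrm y = 1 / 2" for y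
    proof -
      have "2 * (1 - nrm y) = 1" using that by simp
      then show ?thesis using h(3) by (simp only: r_def)
    qed
  qed (auto intro: contn)
  have FT: "F y \<in> T" if "y \<in> D" for y
    using rD[OF that] h(1) cT by (auto simp: F_def)
  have FS: "F s = f s" if "s \<in> ?S" for s
    using L2_set_unit_sphere[OF that] h(2) by (simp add: F_def nrm_def r_def)
  define l where "l t s = (\<lambda>j. (1 - t) * s j + t * nsphere_base j)" for t :: real and s :: "nat \<Rightarrow> real"
  have lD: "l t s \<in> D" if t: "0 \<le> t" "t \<le> 1" and s: "s \<in> ?S" for t s
  proof -
    have "nrm (l t s) \<le> L2_set (\<lambda>j. (1 - t) * s j) {..i} + L2_set (\<lambda>j. t * nsphere_base j) {..i}"
      unfolding nrm_def l_def by (rule L2_set_triangle_ineq)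
    also have "\<dots> = 1"
      using t L2_set_unit_sphere[OF s] L2_set_unit_sphere[OF nsphere_base_unit_sphere[of i]]
      by (simp flip: L2_set_right_distrib)
    finally show ?thesis using s nsphere_base_unit_sphere[of i]
      by (auto simp: D_def l_def unit_sphere_def)
  qed
  have contl: "continuous_on ({0..1} \<times> ?S) (\<lambda>(t, s). l t s)"
    unfolding l_def by (intro continuous_on_line continuous_on_id continuous_on_const)
  have contG: "continuous_on ({0..1} \<times> ?S) (\<lambda>p. F (case p of (t, s) \<Rightarrow> l t s))"
    by (rule continuous_on_compose2[OF contF contl]) (use lD in auto)
  have l0: "l t nsphere_base = nsphere_base" for t by (auto simp: l_def algebra_simps)
  have l1: "l 1 s = nsphere_base" for s by (auto simp: l_def)
  have l2: "l 0 s = s" for s by (auto simp: l_def)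
  have Fb: "F nsphere_base = x" using FS nsphere_base_unit_sphere f'(3) by simp
  define G where "G p = F (case p of (t, s) \<Rightarrow> l t s)" for p
  have G: "continuous_map (prod_topology (top_of_set {0..1}) (top_of_set ?S)) (top_of_set T) G"
    using contG FT lD by (auto simp: G_def)
  have "\<exists>k. continuous_map (prod_topology (top_of_set {0..1::real}) (top_of_set ?S)) (top_of_set T) k \<and>
      (\<forall>s\<in>topspace (top_of_set ?S). k (0, s) = f s) \<and> (\<forall>s\<in>topspace (top_of_set ?S). k (1, s) = x) \<and>
      (\<forall>t\<in>{0..1}. k (t, nsphere_base) = x)"
    using G FS Fb by (intro exI[of _ G] conjI) (auto simp: G_def l0 l1 l2)
  then show ?thesis
    unfolding nsphere_unit_sphere
    by (subst homotopic_with) (use nsphere_base_unit_sphere in auto)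
qed

lemma homotopy_group_set_singleton:
  assumes null: "null_homotopic_spheres i T" and "x \<in> T"
  shows "is_singleton (homotopy_group_set i (top_of_set T) x)"
proof -
  let ?B = "based_maps i (top_of_set T) x"
  let ?R = "{(f, g). f \<in> ?B \<and> g \<in> ?B \<and>
    homotopic_with (\<lambda>h. h nsphere_base = x) (nsphere i) (top_of_set T) f g}"
  have ne: "(\<lambda>_. x) \<in> ?B" using \<open>x \<in> T\<close> by (auto simp: based_maps_iff)
  have "?R `` {f} = ?B" if "f \<in> ?B" for f
  proof -
    have "(f, g) \<in> ?R" if "g \<in> ?B" for g
      using homotopic_with_trans[OF based_null_homotopy[OF null \<open>f \<in> ?B\<close>]
          homotopic_with_symD[OF based_null_homotopy[OF null that]]] \<open>f \<in> ?B\<close> that by simp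
    then show ?thesis by blast
  qed
  then have "?B // ?R = {?B}" using ne unfolding quotient_def by auto
  then show ?thesis unfolding homotopy_group_set_def by simp
qed

lemma homotopy_group_set_singletonD:
  assumes sing: "is_singleton (homotopy_group_set i (top_of_set T) (f nsphere_base))"
    and f: "continuous_on (unit_sphere i) f" "f ` unit_sphere i \<subseteq> T"
  shows "homotopic_with_canon (\<lambda>_. True) (unit_sphere i) T f (\<lambda>_. f nsphere_base)"
proof -
  let ?x = "f nsphere_base"
  let ?B = "based_maps i (top_of_set T) ?x"
  let ?R = "{(f, g). f \<in> ?B \<and> g \<in> ?B \<and>
    homotopic_with (\<lambda>h. h nsphere_base = ?x) (nsphere i) (top_of_set T) f g}"
  have B: "f \<in> ?B" "(\<lambda>_. ?x) \<in> ?B"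
    using f nsphere_base_unit_sphere[of i] by (auto simp: based_maps_iff)
  have in_quot: "?R `` {f} \<in> ?B // ?R" "?R `` {\<lambda>_. ?x} \<in> ?B // ?R" by (rule quotientI, rule B)+
  obtain A where "?B // ?R = {A}"
    using sing unfolding homotopy_group_set_def by (rule is_singletonE)
  then have "?R `` {f} = ?R `` {\<lambda>_. ?x}"
    using in_quot by (simp only: singleton_iff)
  moreover have "(\<lambda>_. ?x) \<in> ?R `` {\<lambda>_. ?x}"
    using B(2) unfolding Image_singleton_iff by (simp add: based_maps_def)
  ultimately have "(\<lambda>_. ?x) \<in> ?R `` {f}" by (simp only:)
  then have "(f, \<lambda>_. ?x) \<in> ?R" by (simp only: Image_singleton_iff)
  then show ?thesis
    by (auto simp: nsphere_unit_sphere elim!: homotopic_with_mono)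
qed

lemma n_connectedI:
  assumes "T \<noteq> {}" "\<And>i. int i \<le> n \<Longrightarrow> null_homotopic_spheres i T"
  shows "n_connected n (top_of_set T)"
  using assms homotopy_group_set_singleton by (auto simp: n_connected_def)

lemma n_connectedD:
  assumes "n_connected n (top_of_set T)" "int i \<le> n"
    and f: "continuous_on (unit_sphere i) f" "f ` unit_sphere i \<subseteq> T"
  shows "homotopic_with_canon (\<lambda>_. True) (unit_sphere i) T f (\<lambda>_. f nsphere_base)"
  using assms nsphere_base_unit_sphere[of i]
  by (intro homotopy_group_set_singletonD) (auto simp: n_connected_def)

section \<open>A facet detected by a map to the sphere\<close>

text \<open>\<open>F\<close> is a \<open>d\<close>-simplex outside \<open>K\<close> whose boundary,
  a sphere of dimension \<open>d - 1\<close>, lies in \<open>K\<close> and can be contracted there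
  by \<open>null\<close>. The numbering \<open>b\<close> identifies \<open>F\<close> with the
  standard simplex in R^(d+1).\<close>

locale null_boundary_facet =
  fixes K :: "'a set set" and F :: "'a set" and d :: nat and b :: "nat \<Rightarrow> 'a"
  assumes down: "down_closed K" and F: "F \<notin> K" and bd: "\<And>y. y \<in> F \<Longrightarrow> F - {y} \<in> K"
    and d: "d \<ge> 1" and bij: "bij_betw b {..d} F"
    and null: "null_homotopic_spheres (d - 1) (realization K)"
begin

definition g :: "'a \<Rightarrow> nat" where "g = inv_into {..d} b"

lemma g: "v \<in> F \<Longrightarrow> g v \<le> d" "v \<in> F \<Longrightarrow> b (g v) = v" "j \<le> d \<Longrightarrow> g (b j) = j" "j \<le> d \<Longrightarrow> b j \<in> F"
  using bij inv_into_into[of v b "{..d}"] by (auto simp: g_def bij_betw_def f_inv_into_f)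

lemma finF: "finite F" using bij bij_betw_finite by auto

lemma cardF: "card F = Suc d" using bij bij_betw_same_card by fastforce

lemma downF: "down_closed (insert F K)"
proof -
  have "\<tau> \<in> insert F K" if "\<tau> \<subseteq> F" for \<tau>
  proof (cases "\<tau> = F")
    case False
    then obtain y where "y \<in> F" "\<tau> \<subseteq> F - {y}" using \<open>\<tau> \<subseteq> F\<close> by blast
    then show ?thesis using down_closedD[OF down] bd by blast
  qed simp
  then show ?thesis using down unfolding down_closed_def by blast
qed

lemma sum_b: "(\<Sum>v\<in>F. f (g v)) = sum f {..d}"
proof -
  have "(\<Sum>v\<in>F. f (g v)) = (\<Sum>j\<le>d. f (g (b j)))"
    by (rule sum.reindex_bij_betw[OF bij, symmetric])
  then show ?thesis using g(3) by simp
qed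

definition emb :: "(nat \<Rightarrow> real) \<Rightarrow> 'a \<Rightarrow> real" where
  "emb y = (\<lambda>v. if v \<in> F then y (g v) else 0)"

lemma emb_realization:
  assumes "\<And>j. j \<le> d \<Longrightarrow> 0 \<le> y j" "sum y {..d} = 1"
  shows "emb y \<in> realization (insert F K)"
proof (rule realizationI[OF downF, of F])
  have "sum (emb y) F = (\<Sum>v\<in>F. y (g v))" by (intro sum.cong) (auto simp: emb_def)
  then show "sum (emb y) F = 1" using assms(2) by (simp add: sum_b)
qed (use assms g finF in \<open>auto simp: emb_def\<close>)

lemma emb_boundary:
  assumes "\<And>j. j \<le> d \<Longrightarrow> 0 \<le> y j" "sum y {..d} = 1" "l \<le> d" "y l = 0"
  shows "emb y \<in> realization K"
proof -
  have e: "emb y \<in> realization (insert F K)" using assms by (intro emb_realization)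
  have "emb y (b l) = 0" "b l \<in> F" using assms g by (auto simp: emb_def)
  then have "{v. emb y v \<noteq> 0} \<noteq> F" by auto
  then show ?thesis using e by (auto simp: realization_def)
qed

lemma continuous_on_emb: "continuous_on A f \<Longrightarrow> continuous_on A (\<lambda>s. emb (f s))"
  unfolding emb_def
proof (rule continuous_on_coordinatewise_then_product)
  fix v assume f: "continuous_on A f"
  show "continuous_on A (\<lambda>s. if v \<in> F then f s (g v) else 0)"
    using continuous_on_coord[OF f] by (cases "v \<in> F") auto
qed

text \<open>The boundary of \<open>F\<close> is parametrized by the sphere of \<open>\<real>\<^sup>d\<close>, the coordinate \<open>d\<close> being
  normalized to \<open>0\<close>: \<open>from_sphere\<close> adds the multiple of \<open>(1,\<dots>,1)\<close> that makes the minimum \<open>0\<close>.\<close>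

definition low :: "(nat \<Rightarrow> real) \<Rightarrow> real" where
  "low w = Min (w ` {..d})"

definition from_sphere :: "(nat \<Rightarrow> real) \<Rightarrow> nat \<Rightarrow> real" where
  "from_sphere w = (\<lambda>j. (w j - low w) / (\<Sum>k\<le>d. w k - low w))"

text \<open>Subtracting \<open>y d\<close> everywhere picks the representative modulo (1,...,1) with
  last coordinate 0. After normalization this inverts \<open>from_sphere\<close> on the boundary of
  the simplex.\<close>

definition diff_last :: "(nat \<Rightarrow> real) \<Rightarrow> nat \<Rightarrow> real" where
  "diff_last y = (\<lambda>j. if j < d then y j - y d else 0)"

definition to_sphere :: "(nat \<Rightarrow> real) \<Rightarrow> nat \<Rightarrow> real" where
  "to_sphere y = (\<lambda>j. diff_last y j / L2_set (diff_last y) {..d - 1})"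

lemma low_le: "j \<le> d \<Longrightarrow> low w \<le> w j" by (simp add: low_def)

lemma low_att: "\<exists>l\<le>d. w l = low w"
proof -
  have "low w \<in> w ` {..d}" unfolding low_def by (rule Min_in) auto
  then show ?thesis by auto
qed

lemma low_sum_pos:
  assumes "w \<in> unit_sphere (d - 1)"
  shows "(\<Sum>k\<le>d. w k - low w) > 0"
proof (rule ccontr)
  assume "\<not> ?thesis"
  then have "(\<Sum>k\<le>d. w k - low w) = 0" using low_le by (smt (verit) atMost_iff sum_nonneg)
  then have eq: "w k = low w" if "k \<le> d" for k
    using that low_le by (subst (asm) sum_nonneg_eq_0_iff) auto
  have "w d = 0" using assms d by (simp add: unit_sphere_def)
  then have "w k = 0" if "k \<le> d" for k using eq that by simp
  then have "(\<Sum>k\<le>d - 1. (w k)\<^sup>2) = 0" by simp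
  then show False using assms by (simp add: unit_sphere_def)
qed

lemma from_sphere:
  assumes "w \<in> unit_sphere (d - 1)"
  shows "emb (from_sphere w) \<in> realization K"
proof -
  obtain l where l: "l \<le> d" "w l = low w" using low_att by blast
  show ?thesis
  proof (rule emb_boundary[OF _ _ l(1)])
    show "from_sphere w l = 0" using l by (simp add: from_sphere_def)
    show "0 \<le> from_sphere w j" if "j \<le> d" for j
      using low_le[OF that, of w] low_sum_pos[OF assms] by (simp add: from_sphere_def)
    show "sum (from_sphere w) {..d} = 1"
      using low_sum_pos[OF assms] unfolding from_sphere_def by (simp flip: sum_divide_distrib)
  qed
qed

lemma continuous_from_sphere: "continuous_on (unit_sphere (d - 1)) (\<lambda>w. emb (from_sphere w))"
proof (rule continuous_on_emb)
  have c: "continuous_on A (\<lambda>w. w j)" for A :: "(nat \<Rightarrow> real) set" and j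
    by (rule continuous_on_coord[OF continuous_on_id])
  have l: "continuous_on A low" for A
    unfolding low_def by (intro continuous_on_Min_image c) auto
  show "continuous_on (unit_sphere (d - 1)) from_sphere"
    unfolding from_sphere_def
    by (intro continuous_on_coordinatewise_then_product continuous_intros c l)
      (use low_sum_pos in force)
qed

lemma to_sphere_nonzero:
  assumes "\<And>j. j \<le> d \<Longrightarrow> 0 \<le> y j" "sum y {..d} = 1" "l \<le> d" "y l = 0"
  shows "L2_set (diff_last y) {..d - 1} > 0"
proof (rule ccontr)
  assume "\<not> ?thesis"
  then have "L2_set (diff_last y) {..d - 1} = 0" using L2_set_nonneg[of "diff_last y" "{..d - 1}"] by linarith
  then have "diff_last y j = 0" if "j < d" for j
    using that by (simp add: L2_set_eq_0_iff)
  then have eq: "y j = y d" if "j \<le> d" for j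
    using that by (cases "j = d") (auto simp: diff_last_def)
  then have "y j = 0" if "j \<le> d" for j using assms(3,4) that by metis
  then show False using assms(2) by simp
qed

lemma to_sphere:
  assumes "\<And>j. j \<le> d \<Longrightarrow> 0 \<le> y j" "sum y {..d} = 1" "l \<le> d" "y l = 0"
  shows "to_sphere y \<in> unit_sphere (d - 1)"
  unfolding to_sphere_def
  by (rule normalize_unit_sphere) (use to_sphere_nonzero[OF assms] in \<open>auto simp: diff_last_def\<close>)

lemma from_to_sphere:
  assumes "\<And>j. j \<le> d \<Longrightarrow> 0 \<le> y j" "sum y {..d} = 1" "l \<le> d" "y l = 0"
  shows "emb (from_sphere (to_sphere y)) = emb y"
proof -
  define N where "N = L2_set (diff_last y) {..d - 1}"
  have N: "N > 0" unfolding N_def by (rule to_sphere_nonzero[OF assms])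
  have t: "to_sphere y j = (y j - y d) / N" if "j \<le> d" for j
    using that by (cases "j = d") (auto simp: to_sphere_def N_def diff_last_def)
  have low: "low (to_sphere y) = - y d / N"
    unfolding low_def
  proof (rule Min_eqI)
    show "- y d / N \<in> to_sphere y ` {..d}" using t[of l] assms(3,4) by force
    show "- y d / N \<le> x" if "x \<in> to_sphere y ` {..d}" for x
      using that t assms(1) N by (auto simp: field_simps)
  qed simp
  have a: "to_sphere y j - low (to_sphere y) = y j / N" if "j \<le> d" for j
    using N t[OF that] low by (simp add: field_simps)
  have "(\<Sum>k\<le>d. to_sphere y k - low (to_sphere y)) = 1 / N"
    using a assms(2) by (simp flip: sum_divide_distrib)
  then have "from_sphere (to_sphere y) j = y j" if "j \<le> d" for j
    using a[OF that] N by (simp add: from_sphere_def)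
  then show ?thesis using g by (auto simp: emb_def)
qed

section \<open>The sphere formed by F and a filling of its boundary\<close>

definition pmass :: "(nat \<Rightarrow> real) \<Rightarrow> real" where
  "pmass s = (\<Sum>j\<le>d. max 0 (s j))"

definition ppart :: "(nat \<Rightarrow> real) \<Rightarrow> nat \<Rightarrow> real" where
  "ppart s = (\<lambda>j. max 0 (s j) / pmass s)"

lemma ppart:
  assumes "pmass s > 0"
  shows "0 \<le> ppart s j" "sum (ppart s) {..d} = 1"
proof -
  show "0 \<le> ppart s j" using assms by (simp add: ppart_def)
  have "sum (ppart s) {..d} = pmass s / pmass s"
    unfolding ppart_def pmass_def by (simp flip: sum_divide_distrib)
  then show "sum (ppart s) {..d} = 1" using assms by simp
qed

lemma abs_le_1_unit_sphere: "s \<in> unit_sphere d \<Longrightarrow> \<bar>s j\<bar> \<le> 1"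
proof (cases "j \<le> d")
  case True
  assume s: "s \<in> unit_sphere d"
  have "(s j)\<^sup>2 \<le> (\<Sum>k\<le>d. (s k)\<^sup>2)" using True by (intro member_le_sum) auto
  then show ?thesis using s by (simp add: unit_sphere_def abs_square_le_1)
qed (auto simp: unit_sphere_def)

lemma pmass_ge_1:
  assumes "s \<in> unit_sphere d" "\<And>j. j \<le> d \<Longrightarrow> 0 \<le> s j"
  shows "1 \<le> pmass s"
proof -
  have "(\<Sum>j\<le>d. (s j)\<^sup>2) \<le> (\<Sum>j\<le>d. max 0 (s j))"
  proof (rule sum_mono)
    fix j assume "j \<in> {..d}"
    then have "0 \<le> s j" "s j \<le> 1" using assms(2) abs_le_1_unit_sphere[OF assms(1), of j] by auto
    then show "(s j)\<^sup>2 \<le> max 0 (s j)" by (simp add: power2_eq_square mult_left_le)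
  qed
  then show ?thesis using assms(1) by (simp add: pmass_def unit_sphere_def)
qed

lemma continuous_pmass: "continuous_on A pmass"
  unfolding pmass_def
  by (rule continuous_on_sum, rule continuous_on_max, rule continuous_on_const,
      rule continuous_on_coord[OF continuous_on_id])

lemma continuous_ppart: "(\<And>s. s \<in> A \<Longrightarrow> pmass s \<noteq> 0) \<Longrightarrow> continuous_on A ppart"
  unfolding ppart_def
  by (rule continuous_on_coordinatewise_then_product, rule continuous_on_divide, rule continuous_on_max,
      rule continuous_on_const, rule continuous_on_coord[OF continuous_on_id],
      rule continuous_pmass) auto

text \<open>The sphere is mapped to the union of \<open>F\<close> (covered by the points with no negative coordinate)
  and a null homotopy in \<open>K\<close> of the boundary of \<open>F\<close>.\<close>

lemma sphere_map:
  obtains \<phi> where "continuous_on (unit_sphere d) \<phi>" "\<phi> ` unit_sphere d \<subseteq> realization (insert F K)"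
    "\<And>s. s \<in> unit_sphere d \<Longrightarrow> 1 / 2 \<le> pmass s \<Longrightarrow> \<phi> s = emb (ppart s)"
    "\<And>s. s \<in> unit_sphere d \<Longrightarrow> pmass s \<le> 1 / 2 \<Longrightarrow> \<phi> s \<in> realization K"
proof -
  let ?S = "unit_sphere d" and ?S' = "unit_sphere (d - 1)"
  obtain c where "homotopic_with_canon (\<lambda>_. True) ?S' (realization K) (\<lambda>w. emb (from_sphere w)) (\<lambda>_. c)"
    using null_homotopic_spheresD[OF null continuous_from_sphere] from_sphere by blast
  then obtain h :: "real \<times> (nat \<Rightarrow> real) \<Rightarrow> 'a \<Rightarrow> real" where conth: "continuous_on ({0..1} \<times> ?S') h"
    and h: "h ` ({0..1} \<times> ?S') \<subseteq> realization K" "\<And>s. h (0, s) = emb (from_sphere s)" "\<And>s. h (1, s) = c"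
    unfolding homotopic_with_def by (auto simp: image_subset_iff Pi_iff)
  have cK: "c \<in> realization K"
  proof -
    have "h (1, nsphere_base) \<in> realization K" using h(1) nsphere_base_unit_sphere[of "d - 1"] by auto
    then show ?thesis using h(3) by simp
  qed
  \<comment> \<open>As \<open>pmass s\<close> falls from 1/2 to 1/4, the time of the null homotopy
    \<open>h\<close> runs from 0 to 1; below 1/4 the map is constant.\<close>
  define r where "r s = (2 - 4 * pmass s, to_sphere (ppart s))" for s
  define \<phi> where "\<phi> s = (if pmass s \<le> 1 / 2 then (if pmass s \<le> 1 / 4 then c else h (r s))
    else emb (ppart s))" for s
  \<comment> \<open>A point of the sphere without negative coordinates has mass at least 1. Here
    some coordinate is therefore negative, and \<open>ppart s\<close> lies on the boundary of the
    simplex, where \<open>to_sphere\<close> is defined.\<close>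
  have zero: "\<exists>l\<le>d. ppart s l = 0" if "s \<in> ?S" "pmass s \<le> 1 / 2" for s
  proof -
    obtain l where "l \<le> d" "s l < 0" using pmass_ge_1[OF \<open>s \<in> ?S\<close>] \<open>pmass s \<le> 1 / 2\<close> by force
    then show ?thesis by (auto simp: ppart_def)
  qed
  define M where "M = {s \<in> ?S. 1 / 4 \<le> pmass s \<and> pmass s \<le> 1 / 2}"
  have rM: "r s \<in> {0..1} \<times> ?S'" if "s \<in> M" for s
  proof -
    have "pmass s > 0" using that by (auto simp: M_def)
    moreover obtain l where "l \<le> d" "ppart s l = 0"
      using zero[of s] \<open>s \<in> M\<close> by (auto simp: M_def)
    ultimately have "to_sphere (ppart s) \<in> ?S'" using ppart by (intro to_sphere)
    then show ?thesis using that by (auto simp: r_def M_def)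
  qed
  have dlast: "continuous_on M (\<lambda>s. diff_last (ppart s))"
    unfolding diff_last_def
  proof (rule continuous_on_coordinatewise_then_product)
    fix j
    have "continuous_on M ppart" by (rule continuous_ppart) (auto simp: M_def)
    then show "continuous_on M (\<lambda>s. if j < d then ppart s j - ppart s d else 0)"
      by (cases "j < d") (simp_all add: continuous_on_diff continuous_on_coord)
  qed
  have "continuous_on M (\<lambda>s. to_sphere (ppart s))"
    unfolding to_sphere_def
  proof (rule continuous_on_coordinatewise_then_product, rule continuous_on_divide)
    show "\<forall>s\<in>M. L2_set (diff_last (ppart s)) {..d - 1} \<noteq> 0"
    proof
      fix s assume s: "s \<in> M"
      then have "pmass s > 0" by (auto simp: M_def)
      moreover obtain l where "l \<le> d" "ppart s l = 0" using zero[of s] s by (auto simp: M_def)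
      ultimately show "L2_set (diff_last (ppart s)) {..d - 1} \<noteq> 0"
        using to_sphere_nonzero[of "ppart s" l] ppart by auto
    qed
  qed (intro continuous_on_L2_set continuous_on_coord dlast)+
  then have contr: "continuous_on M r"
    unfolding r_def by (intro continuous_on_Pair continuous_on_diff continuous_on_mult continuous_on_const
        continuous_pmass)
  have conthr: "continuous_on M (\<lambda>s. h (r s))"
    by (rule continuous_on_compose2[OF conth contr]) (use rM in blast)
  have inner: "continuous_on {s \<in> ?S. pmass s \<le> 1 / 2} (\<lambda>s. if pmass s \<le> 1 / 4 then c else h (r s))"
  proof (rule continuous_on_cases_le)
    show "continuous_on {t \<in> {s \<in> ?S. pmass s \<le> 1 / 2}. 1 / 4 \<le> pmass t} (\<lambda>s. h (r s))"
      by (rule continuous_on_subset[OF conthr]) (auto simp: M_def)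
    show "c = h (r s)" if "s \<in> {s \<in> ?S. pmass s \<le> 1 / 2}" "pmass s = 1 / 4" for s
    proof -
      have "2 - 4 * pmass s = 1" using that by simp
      then show ?thesis using h(3) by (simp only: r_def)
    qed
  qed (auto intro: continuous_pmass)
  have half: "h (r s) = emb (ppart s)" if "s \<in> ?S" "pmass s = 1 / 2" for s
  proof -
    obtain l where "l \<le> d" "ppart s l = 0" using zero[of s] \<open>s \<in> ?S\<close> \<open>pmass s = 1 / 2\<close> by auto
    then have "emb (from_sphere (to_sphere (ppart s))) = emb (ppart s)"
      using ppart[of s] that by (intro from_to_sphere) auto
    moreover have "2 - 4 * pmass s = 0" using that by simp
    ultimately show ?thesis using h(2) by (simp only: r_def)
  qed
  have contphi: "continuous_on ?S \<phi>"
    unfolding \<phi>_def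
  proof (rule continuous_on_cases_le[OF inner])
    show "continuous_on {s \<in> ?S. 1 / 2 \<le> pmass s} (\<lambda>s. emb (ppart s))"
      by (intro continuous_on_emb continuous_ppart) auto
  qed (auto intro: continuous_pmass simp: half)
  have 3: "\<phi> s = emb (ppart s)" if "s \<in> ?S" "1 / 2 \<le> pmass s" for s
    using half[OF that(1)] that(2) by (auto simp: \<phi>_def)
  have 4: "\<phi> s \<in> realization K" if "s \<in> ?S" "pmass s \<le> 1 / 2" for s
  proof -
    have "h (r s) \<in> realization K" if "\<not> pmass s \<le> 1 / 4"
    proof -
      have "s \<in> M" using \<open>s \<in> ?S\<close> \<open>pmass s \<le> 1 / 2\<close> that by (simp add: M_def)
      then show ?thesis using rM h(1) by blast
    qed
    then show ?thesis using that cK by (simp add: \<phi>_def)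
  qed
  have "\<phi> s \<in> realization (insert F K)" if "s \<in> ?S" for s
  proof (cases "pmass s \<le> 1 / 2")
    case True
    then show ?thesis using 4[OF that] realization_mono[of K "insert F K"] by blast
  next
    case False
    then have "pmass s > 0" by simp
    then show ?thesis using 3[OF that] ppart[of s] False by (simp add: emb_realization)
  qed
  then show ?thesis using that[OF contphi _ 3 4] by blast
qed

section \<open>The map to punctured Euclidean space\<close>

definition eps :: real where "eps = 1 / (2 * Suc d)"

text \<open>Replaces the collapse to a sphere: it reads off the coordinates on \<open>F\<close> and
  puts the origin at the point where all of them equal \<open>eps\<close>, half of the barycentric
  value 1/(d+1). A point over \<open>K\<close> misses a vertex of \<open>F\<close> and so gets a
  coordinate \<open>- eps\<close>; all of \<open>K\<close> thus goes to the complement of the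
  nonnegative orthant, which is contractible.\<close>

definition q :: "('a \<Rightarrow> real) \<Rightarrow> nat \<Rightarrow> real" where
  "q x = (\<lambda>j. if j \<le> d then x (b j) - eps else 0)"

definition punctured :: "(nat \<Rightarrow> real) set" where
  "punctured = {z. (\<forall>j>d. z j = 0) \<and> (\<exists>j\<le>d. z j \<noteq> 0)}"

lemma continuous_q: "continuous_on A q"
  unfolding q_def
proof (rule continuous_on_coordinatewise_then_product)
  fix j
  show "continuous_on A (\<lambda>x. if j \<le> d then x (b j) - eps else 0)"
    by (cases "j \<le> d")
      (auto intro!: continuous_on_diff continuous_on_coord[OF continuous_on_id])
qed

text \<open>No face of \<open>K\<close> contains \<open>F\<close>, so a support containing
  \<open>F\<close> is \<open>F\<close> itself; equal coordinates then make the point the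
  barycenter.\<close>

lemma constant_on_facet:
  assumes x: "x \<in> realization (insert F K)" and e: "e > 0" "\<And>j. j \<le> d \<Longrightarrow> x (b j) = e"
  shows "x \<notin> realization K" "e = 1 / Suc d"
proof -
  have xF: "x v = e" if "v \<in> F" for v using e(2)[of "g v"] g(1)[of v] g(2)[of v] that by simp
  have "F \<subseteq> {v. x v \<noteq> 0}" using xF e(1) by auto
  then have nK: "{v. x v \<noteq> 0} \<notin> K" using down_closedD[OF down] F by blast
  then show "x \<notin> realization K" by (auto simp: realization_def)
  have "{v. x v \<noteq> 0} = F" using nK realization_support[OF x] by simp
  then have "sum x F = 1" using x by (simp add: realization_def)
  moreover have "sum x F = Suc d * e" using xF by (simp add: cardF)
  ultimately show "e = 1 / Suc d" by (simp add: field_simps)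
qed

lemma eps: "0 < eps" "eps < 1 / Suc d" by (simp_all add: eps_def field_simps)

lemma q_punctured:
  assumes x: "x \<in> realization (insert F K)"
  shows "q x \<in> punctured"
proof (rule ccontr)
  assume "\<not> ?thesis"
  then have "x (b j) = eps" if "j \<le> d" for j using that by (force simp: punctured_def q_def)
  then show False using constant_on_facet(2)[OF x eps(1)] eps by simp
qed

text \<open>It is 1 where the sphere map may run through \<open>K\<close> (mass at most 1/2) and 0
  where the mass is at least 1, in particular at points without negative coordinates.\<close>

definition chi :: "(nat \<Rightarrow> real) \<Rightarrow> real" where
  "chi s = min 1 (max 0 (2 * (1 - pmass s)))"

lemma continuous_chi: "continuous_on A chi"
  unfolding chi_def by (intro continuous_intros continuous_pmass)

text \<open>The map \<open>q \<circ> \<phi>\<close> cannot be compared with the inclusion by a straight line on the region with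
  negative coordinates; there it is first moved by \<open>chi\<close> towards \<open>(-1,\<dots>,-1)\<close>.\<close>

lemma q_sphere_map_homotopic:
  assumes cont: "continuous_on (unit_sphere d) \<phi>" and in_poly: "\<phi> ` unit_sphere d \<subseteq> realization (insert F K)"
    and upper: "\<And>s. s \<in> unit_sphere d \<Longrightarrow> 1 / 2 \<le> pmass s \<Longrightarrow> \<phi> s = emb (ppart s)"
    and lower: "\<And>s. s \<in> unit_sphere d \<Longrightarrow> pmass s \<le> 1 / 2 \<Longrightarrow> \<phi> s \<in> realization K"
  shows "homotopic_with_canon (\<lambda>_. True) (unit_sphere d) punctured (\<lambda>s. s) (\<lambda>s. q (\<phi> s))"
proof -
  let ?S = "unit_sphere d"
  define B where "B s = q (\<phi> s)" for s
  \<comment> \<open>Each \<open>B s j\<close> is at most 1, so subtracting 2 makes all coordinates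
    negative where \<open>chi\<close> is 1.\<close>
  define C where "C s = (\<lambda>j. if j \<le> d then B s j - 2 * chi s else 0)" for s
  have contB: "continuous_on ?S B" unfolding B_def
    by (rule continuous_on_compose2[OF continuous_q cont]) auto
  have contC: "continuous_on ?S C" unfolding C_def
  proof (rule continuous_on_coordinatewise_then_product)
    fix j
    show "continuous_on ?S (\<lambda>s. if j \<le> d then B s j - 2 * chi s else 0)"
      by (cases "j \<le> d") (auto intro!: continuous_on_diff continuous_on_coord[OF contB]
          continuous_on_mult continuous_chi)
  qed
  have poly: "\<phi> s \<in> realization (insert F K)" if "s \<in> ?S" for s using in_poly that by blast
  have chi0: "chi s = 0" if "s \<in> ?S" "\<And>j. j \<le> d \<Longrightarrow> 0 \<le> s j" for s
    using pmass_ge_1[OF that] by (simp add: chi_def)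
  have B_up: "B s j = max 0 (s j) / pmass s - eps" if "s \<in> ?S" "1 / 2 \<le> pmass s" "j \<le> d" for s j
    using that g by (simp add: B_def q_def upper emb_def ppart_def)
  have B_le: "B s j \<le> 1" if "s \<in> ?S" "j \<le> d" for s j
  proof -
    have "\<phi> s (b j) \<le> 1"
    proof (cases "\<phi> s (b j) = 0")
      case False
      have fin: "finite {v. \<phi> s v \<noteq> 0}"
        using poly[OF that(1)] unfolding realization_def by (auto intro: ccontr)
      have "\<phi> s (b j) \<le> sum (\<phi> s) {v. \<phi> s v \<noteq> 0}"
        using fin False realization_nonneg[OF poly[OF that(1)]] by (intro member_le_sum) auto
      then show ?thesis using poly[OF that(1)] by (simp add: realization_def)
    qed simp
    then show ?thesis using eps that by (simp add: B_def q_def)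
  qed
  have S0: "s j = 0" if "s \<in> ?S" "j > d" for s j using that by (simp add: unit_sphere_def)
  have BC0: "B s j = 0" "C s j = 0" if "j > d" for s j using that by (simp_all add: B_def q_def C_def)
  have "homotopic_with_canon (\<lambda>_. True) ?S punctured (\<lambda>s. s) C"
  proof (rule homotopic_canonI[where h = "\<lambda>t s j. (1 - t) * s j + t * C s j"])
    show "continuous_on ({0..1} \<times> ?S) (\<lambda>(t, s) j. (1 - t) * s j + t * C s j)"
      by (intro continuous_on_line continuous_on_id contC)
    fix t :: real and s assume t: "0 \<le> t" "t \<le> 1" and s: "s \<in> ?S"
    have "\<exists>j\<le>d. (1 - t) * s j + t * C s j \<noteq> 0"
    proof (rule ccontr)
      assume "\<not> ?thesis"
      then have z: "(1 - t) * s j + t * C s j = 0" if "j \<le> d" for j using that by blast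
      show False
      \<comment> \<open>If \<open>s j\<close> is negative, so is \<open>C s j\<close>, and the
        segment has a negative coordinate throughout. Otherwise the coordinates are added up: the
        sums at the two ends are \<open>pmass s\<close> and \<open>1 - Suc d * eps = 1 / 2\<close>,
        both positive.\<close>
      proof (cases "\<exists>j\<le>d. s j < 0")
        case True
        then obtain j where j: "j \<le> d" "s j < 0" by blast
        have "C s j < 0"
        proof (cases "1 / 2 \<le> pmass s")
          case True
          then have "B s j = - eps" using B_up[OF s True j(1)] j by simp
          moreover have "0 \<le> chi s" by (simp add: chi_def)
          ultimately show ?thesis using eps j by (simp add: C_def)
        next
          case False
          then have "chi s = 1" by (simp add: chi_def)
          then show ?thesis using B_le[OF s j(1)] j by (simp add: C_def)
        qed
        then have "(1 - t) * s j + t * C s j < 0"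
        proof (cases "t = 0")
          case False
          then have "t * C s j < 0" using t \<open>C s j < 0\<close> by (simp add: mult_pos_neg)
          moreover have "(1 - t) * s j \<le> 0" using t j by (simp add: mult_nonneg_nonpos)
          ultimately show ?thesis by linarith
        qed (use j in simp)
        then show False using z[OF j(1)] by simp
      next
        case False
        then have nn: "\<And>j. j \<le> d \<Longrightarrow> 0 \<le> s j" by force
        have p: "1 \<le> pmass s" by (rule pmass_ge_1[OF s nn])
        have "C s j = s j / pmass s - eps" if "j \<le> d" for j
          using B_up[OF s _ that] p chi0[OF s nn] nn[OF that] that by (simp add: C_def)
        then have "(1 - t) * s j + t * (s j / pmass s - eps) = 0" if "j \<le> d" for j
          using z[OF that] that by simp
        then have "(\<Sum>j\<le>d. (1 - t) * s j + t * (s j / pmass s - eps)) = 0" by simp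
        moreover have "(\<Sum>j\<le>d. (1 - t) * s j + t * (s j / pmass s - eps))
            = (1 - t) * (\<Sum>j\<le>d. s j) + t * ((\<Sum>j\<le>d. s j) / pmass s - Suc d * eps)"
          by (simp add: sum.distrib sum_subtractf sum_divide_distrib flip: sum_distrib_left)
        moreover have "(\<Sum>j\<le>d. s j) = pmass s"
          unfolding pmass_def using nn by (intro sum.cong) auto
        ultimately have "(1 - t) * pmass s + t * (1 - Suc d * eps) = 0" using p by simp
        moreover have "1 - Suc d * eps = 1 / 2" by (simp add: eps_def field_simps)
        ultimately have "(1 - t) * pmass s + t * (1 / 2) = 0" by (simp only:)
        moreover have "0 < (1 - t) * pmass s + t * (1 / 2)"
        proof (cases "t = 0")
          case False
          then show ?thesis using t p by (intro add_nonneg_pos) auto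
        qed (use p in simp)
        ultimately show False by simp
      qed
    qed
    then show "(\<lambda>j. (1 - t) * s j + t * C s j) \<in> punctured"
      using S0[OF s] BC0 by (auto simp: punctured_def)
  qed auto
  moreover have "homotopic_with_canon (\<lambda>_. True) ?S punctured C B"
  proof (rule homotopic_canonI[where h = "\<lambda>t s j. (1 - t) * C s j + t * B s j"])
    show "continuous_on ({0..1} \<times> ?S) (\<lambda>(t, s) j. (1 - t) * C s j + t * B s j)"
      by (intro continuous_on_line contC contB)
    fix t :: real and s assume t: "0 \<le> t" "t \<le> 1" and s: "s \<in> ?S"
    \<comment> \<open>A zero on this segment forces all coordinates of \<open>\<phi> s\<close> on
      \<open>F\<close> to equal \<open>e\<close>. The point is then the barycenter, which only
      arises from an \<open>s\<close> with positive coordinates. There \<open>chi\<close> vanishes,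
      so \<open>e = eps\<close>, which is not the barycentric value.\<close>
    define e where "e = eps + (1 - t) * (2 * chi s)"
    have "0 \<le> (1 - t) * (2 * chi s)" using t by (simp add: chi_def)
    then have e: "e > 0" using eps by (simp add: e_def)
    have "\<exists>j\<le>d. (1 - t) * C s j + t * B s j \<noteq> 0"
    proof (rule ccontr)
      assume "\<not> ?thesis"
      then have "(1 - t) * C s j + t * B s j = 0" if "j \<le> d" for j using that by blast
      then have xe: "\<phi> s (b j) = e" if "j \<le> d" for j
        using that by (fastforce simp: C_def B_def q_def e_def algebra_simps)
      note cF = constant_on_facet[OF poly[OF s] e xe]
      have up: "1 / 2 \<le> pmass s" using cF(1) lower[OF s] by force
      have "0 < s j" if "j \<le> d" for j
      proof -
        have "max 0 (s j) / pmass s = e" using xe[OF that] g that by (simp add: upper[OF s up] emb_def ppart_def)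
        then show ?thesis using e by (cases "s j \<le> 0") auto
      qed
      then have "chi s = 0" using chi0[OF s] by force
      then show False using cF(2) eps by (simp add: e_def)
    qed
    then show "(\<lambda>j. (1 - t) * C s j + t * B s j) \<in> punctured"
      using BC0 by (auto simp: punctured_def)
  qed auto
  ultimately show ?thesis unfolding B_def by (rule homotopic_with_trans)
qed

text \<open>A null homotopy of the sphere map would make \<open>q \<circ> \<phi>\<close>, and with
  it the inclusion into the punctured space, null homotopic; normalizing vectors would then contract
  the sphere in itself.\<close>

theorem not_n_connected: "\<not> n_connected (int d) (top_of_set (realization (insert F K)))"
proof
  assume conn: "n_connected (int d) (top_of_set (realization (insert F K)))"
  let ?S = "unit_sphere d"
  obtain \<phi> where \<phi>: "continuous_on ?S \<phi>" "\<phi> ` ?S \<subseteq> realization (insert F K)"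
    "\<And>s. s \<in> ?S \<Longrightarrow> 1 / 2 \<le> pmass s \<Longrightarrow> \<phi> s = emb (ppart s)"
    "\<And>s. s \<in> ?S \<Longrightarrow> pmass s \<le> 1 / 2 \<Longrightarrow> \<phi> s \<in> realization K"
    by (rule sphere_map) blast
  define x where "x = \<phi> nsphere_base"
  have "homotopic_with_canon (\<lambda>_. True) ?S (realization (insert F K)) \<phi> (\<lambda>_. x)"
    unfolding x_def by (rule n_connectedD[OF conn _ \<phi>(1,2)]) simp
  then have "homotopic_with_canon (\<lambda>_. True) ?S punctured (q \<circ> \<phi>) (q \<circ> (\<lambda>_. x))"
    by (rule homotopic_with_compose_continuous_map_left) (use continuous_q q_punctured in auto)
  with q_sphere_map_homotopic[OF \<phi>]
  have "homotopic_with_canon (\<lambda>_. True) ?S punctured (\<lambda>s. s) (\<lambda>_. q x)"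
    by (auto simp: o_def elim: homotopic_with_trans)
  moreover define \<nu> where "\<nu> z = (\<lambda>j. z j / L2_set z {..d})" for z :: "nat \<Rightarrow> real"
  have pos: "L2_set z {..d} \<noteq> 0" if "z \<in> punctured" for z
    using that by (auto simp: punctured_def L2_set_eq_0_iff)
  have "continuous_on punctured \<nu>"
    unfolding \<nu>_def
    by (rule continuous_on_coordinatewise_then_product, rule continuous_on_divide,
        rule continuous_on_coord[OF continuous_on_id],
        rule continuous_on_L2_set[OF continuous_on_id]) (use pos in auto)
  moreover have "\<nu> z \<in> ?S" if "z \<in> punctured" for z
    unfolding \<nu>_def by (rule normalize_unit_sphere[OF pos[OF that]]) (use that in \<open>auto simp: punctured_def\<close>)
  ultimately have "homotopic_with_canon (\<lambda>_. True) ?S ?S (\<nu> \<circ> (\<lambda>s. s)) (\<nu> \<circ> (\<lambda>_. q x))"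
    by (intro homotopic_with_compose_continuous_map_left) auto
  then have "homotopic_with_canon (\<lambda>_. True) ?S ?S id (\<lambda>_. \<nu> (q x))"
    by (rule homotopic_with_eq) (auto simp: \<nu>_def L2_set_unit_sphere)
  then have "contractible_space (nsphere d)"
    unfolding contractible_space_def nsphere_unit_sphere by (auto simp: id_def)
  then show False using non_contractible_space_nsphere by blast
qed

end

theorem facet_not_n_connected:
  assumes "down_closed K" "F \<notin> K" "\<And>y. y \<in> F \<Longrightarrow> F - {y} \<in> K" "finite F" "card F = Suc d" "d \<ge> 1"
    and "null_homotopic_spheres (d - 1) (realization K)"
  shows "\<not> n_connected (int d) (top_of_set (realization (insert F K)))"
proof -
  obtain b where "bij_betw b {..<Suc d} F"
    using ex_bij_betw_nat_finite[OF assms(4)] assms(5) by (auto simp: atLeast0LessThan)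
  then interpret null_boundary_facet K F d b
    using assms by unfold_locales (auto simp: lessThan_Suc_atMost)
  show ?thesis by (rule not_n_connected)
qed

section \<open>Combinatorics of built complexes\<close>

lemma built_image:
  assumes "built m K" "inj f"
  shows "built m ((`) f ` K)"
  using assms(1)
proof (induction rule: built.induct)
  case (expand K F x)
  have "built m (insert (f ` F) (insert (insert (f x) (f ` F)) ((`) f ` K)))"
  proof (rule built.expand)
    fix y assume "y \<in> f ` F"
    then obtain z where z: "z \<in> F" "y = f z" by blast
    have "insert (f x) (f ` F) - {y} = f ` (insert x F - {z})"
      using \<open>inj f\<close> z(2) by (simp add: image_set_diff)
    then show "insert (f x) (f ` F) - {y} \<in> (`) f ` K" using expand(5)[OF z(1)] by auto
  qed (use expand \<open>inj f\<close> in \<open>auto simp: inj_image_eq_iff inj_image_mem_iff\<close>)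
  then show ?case by simp
next
  case (cell K F)
  have "built m (insert (f ` F) ((`) f ` K))"
  proof (rule built.cell)
    fix y assume "y \<in> f ` F"
    then obtain z where z: "z \<in> F" "y = f z" by blast
    have "f ` F - {y} = f ` (F - {z})" using \<open>inj f\<close> z(2) by (simp add: image_set_diff)
    then show "f ` F - {y} \<in> (`) f ` K" using cell(4)[OF z(1)] by auto
  qed (use cell \<open>inj f\<close> in \<open>auto simp: card_image inj_on_subset\<close>)
  then show ?case by simp
qed (simp add: built.empty)

text \<open>Each step in the construction of \<open>N\<close> is repeated with \<open>s\<close>
  added to its faces. Dropping an element of \<open>s\<close> leads into \<open>K\<close>, dropping
  another one is covered by the step for \<open>N\<close>, and attached faces gain
  \<open>card s\<close> vertices.\<close>

lemma built_attach:
  assumes "built n N" "built m K" "finite s" "m \<le> n + card s"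
    and "\<And>\<tau>. \<tau> \<in> N \<Longrightarrow> s \<inter> \<tau> = {}" "\<And>\<tau>. \<tau> \<in> N \<Longrightarrow> s \<union> \<tau> \<notin> K"
    and "\<And>\<tau> y. \<tau> \<in> N \<Longrightarrow> y \<in> s \<Longrightarrow> (s - {y}) \<union> \<tau> \<in> K"
  shows "built m (K \<union> (\<union>) s ` N)"
  using assms
proof (induction rule: built.induct)
  case (expand N F x)
  let ?K = "K \<union> (\<union>) s ` N"
  have K: "built m ?K" using expand by simp
  have sx: "x \<notin> s" "s \<inter> F = {}" using expand.prems(4)[of F] expand.prems(4)[of "insert x F"] by auto
  have "built m (insert (s \<union> F) (insert (insert x (s \<union> F)) ?K))"
  proof (rule built.expand[OF K])
    have "s \<union> F \<noteq> s \<union> \<tau>" if "\<tau> \<in> N" for \<tau>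
    proof -
      have "s \<inter> \<tau> = {}" "\<tau> \<noteq> F" using expand.prems(4)[of \<tau>] expand.hyps that by auto
      then show ?thesis using sx(2) by blast
    qed
    then show "s \<union> F \<notin> ?K" using expand.prems(5)[of F] by auto
    fix y assume "y \<in> s \<union> F"
    then show "insert x (s \<union> F) - {y} \<in> ?K"
    proof
      assume y: "y \<in> s"
      then have "insert x (s \<union> F) - {y} = (s - {y}) \<union> insert x F" using sx by auto
      then show ?thesis using expand.prems(6)[of "insert x F" y] y by simp
    next
      assume y: "y \<in> F"
      then have "insert x (s \<union> F) - {y} = s \<union> (insert x F - {y})" using sx by auto
      then show ?thesis using expand.hyps(5)[OF y] by auto
    qed
  qed (use expand sx in auto)
  then show ?case by (simp add: Un_insert_right)
next
  case (cell N F)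
  let ?K = "K \<union> (\<union>) s ` N"
  have K: "built m ?K" using cell by simp
  have sF: "s \<inter> F = {}" using cell.prems(4)[of F] by simp
  have "built m (insert (s \<union> F) ?K)"
  proof (rule built.cell[OF K])
    show "m \<le> card (s \<union> F)" using cell sF by (simp add: card_Un_disjoint)
    fix y assume "y \<in> s \<union> F"
    then show "s \<union> F - {y} \<in> ?K"
    proof
      assume y: "y \<in> s"
      then have "s \<union> F - {y} = (s - {y}) \<union> F" using sF by auto
      then show ?thesis using cell.prems(6)[of F y] y by simp
    next
      assume y: "y \<in> F"
      then have "s \<union> F - {y} = s \<union> (F - {y})" using sF by auto
      then show ?thesis using cell.hyps(4)[OF y] by auto
    qed
  qed (use cell in auto)
  then show ?case by simp
qed simp

text \<open>The fibres do not interact: dropping an element of \<open>s\<close> leads into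
  \<open>K\<close>, and the union determines \<open>s\<close>. So they can be attached one after
  another in any order.\<close>

lemma built_fibres:
  assumes "finite S" "built m K" "\<And>s. s \<in> S \<Longrightarrow> finite s"
    and N: "\<And>s. s \<in> S \<Longrightarrow> built (n s) (N s)" "\<And>s. s \<in> S \<Longrightarrow> m \<le> n s + card s"
    and disj: "\<And>s \<tau>. s \<in> S \<Longrightarrow> \<tau> \<in> N s \<Longrightarrow> s \<inter> \<tau> = {}"
    and bd: "\<And>s \<tau> y. s \<in> S \<Longrightarrow> \<tau> \<in> N s \<Longrightarrow> y \<in> s \<Longrightarrow> (s - {y}) \<union> \<tau> \<in> K"
    and new: "\<And>s \<tau>. s \<in> S \<Longrightarrow> \<tau> \<in> N s \<Longrightarrow> s \<union> \<tau> \<notin> K"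
    and inj: "\<And>s \<tau> s' \<tau>'. s \<in> S \<Longrightarrow> s' \<in> S \<Longrightarrow> \<tau> \<in> N s \<Longrightarrow> \<tau>' \<in> N s' \<Longrightarrow> s \<union> \<tau> = s' \<union> \<tau>' \<Longrightarrow> s = s'"
  shows "built m (K \<union> (\<Union>s\<in>S. (\<union>) s ` N s))"
  using assms
proof (induction S rule: finite_induct)
  case (insert s S)
  have IH: "built m (K \<union> (\<Union>s\<in>S. (\<union>) s ` N s))"
    by (rule insert.IH, rule insert.prems(1), (rule insert.prems(2-5)[OF insertI2]; assumption)+,
        (rule insert.prems(6-7)[OF insertI2]; assumption)+, rule insert.prems(8)[OF insertI2 insertI2])
  have "built m ((K \<union> (\<Union>s\<in>S. (\<union>) s ` N s)) \<union> (\<union>) s ` N s)"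
  proof (rule built_attach[OF _ IH])
    show "s \<union> \<tau> \<notin> K \<union> (\<Union>s\<in>S. (\<union>) s ` N s)" if "\<tau> \<in> N s" for \<tau>
      using insert.prems(7)[of s \<tau>] insert.prems(8)[of s _ \<tau>] insert.hyps(2) that by blast
  qed (use insert.prems in auto)
  then show ?case by (simp add: ac_simps)
qed simp

text \<open>Each face is paired with its join with \<open>x\<close>; the pair of a largest face
  comes last. Only expansions occur, so \<open>m\<close> is arbitrary.\<close>

lemma built_cone:
  assumes "finite L" "down_closed L" "\<And>F. F \<in> L \<Longrightarrow> finite F \<and> x \<notin> F"
  shows "built m (L \<union> insert x ` L)"
  using assms
proof (induction "card L" arbitrary: L)
  case 0
  then show ?case by (simp add: built.empty)
next
  case (Suc n)
  then have "L \<noteq> {}" by auto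
  then obtain F where F: "F \<in> L" "\<And>G. G \<in> L \<Longrightarrow> card G \<le> card F"
  proof -
    have "Max (card ` L) \<in> card ` L" using \<open>L \<noteq> {}\<close> Suc.prems(1) by simp
    then obtain F where "F \<in> L" "card F = Max (card ` L)" by auto
    then show ?thesis using that Suc.prems(1) by simp
  qed
  have dc: "down_closed (L - {F})"
    unfolding down_closed_def
  proof (intro ballI allI impI)
    fix \<sigma> \<tau> assume "\<sigma> \<in> L - {F}" "\<tau> \<subseteq> \<sigma>"
    moreover have "card F < card \<sigma>" if "F \<subset> \<sigma>" using that \<open>\<sigma> \<in> L - {F}\<close> Suc.prems(3) by (intro psubset_card_mono) auto
    ultimately show "\<tau> \<in> L - {F}" using F(2)[of \<sigma>] down_closedD[OF Suc.prems(2), of \<sigma> \<tau>] by force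
  qed
  have IH: "built m ((L - {F}) \<union> insert x ` (L - {F}))"
    by (rule Suc.hyps(1)) (use Suc F dc in auto)
  have "built m (insert F (insert (insert x F) ((L - {F}) \<union> insert x ` (L - {F}))))"
  proof (rule built.expand[OF IH])
    fix y assume y: "y \<in> F"
    have "F - {y} \<in> L - {F}" using down_closedD[OF Suc.prems(2) F(1), of "F - {y}"] y by auto
    moreover have "insert x F - {y} = insert x (F - {y})" using y Suc.prems(3)[OF F(1)] by auto
    ultimately show "insert x F - {y} \<in> (L - {F}) \<union> insert x ` (L - {F})" by auto
  qed (use Suc.prems F in auto)
  moreover have "insert F (insert (insert x F) ((L - {F}) \<union> insert x ` (L - {F}))) = L \<union> insert x ` L"
    using F by auto
  ultimately show ?case by simp
qed

text \<open>Adding and removing \<open>x\<close> matches the faces of the star of \<open>x\<close>. The remaining faces are attached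
  fibrewise over their parts in \<open>L\<close>.\<close>

lemma built_star:
  assumes down: "down_closed K" and fin: "finite (\<Union>K)"
    and star: "\<And>\<sigma>. \<sigma> \<in> K \<Longrightarrow> insert x (\<sigma> \<inter> L) \<in> K \<Longrightarrow> insert x \<sigma> \<in> K"
    and minimal: "\<And>s y. s \<in> K \<Longrightarrow> s \<subseteq> L \<Longrightarrow> insert x s \<notin> K \<Longrightarrow> y \<in> s \<Longrightarrow> insert x (s - {y}) \<in> K"
    and fibre: "\<And>s. s \<in> K \<Longrightarrow> s \<subseteq> L \<Longrightarrow> insert x s \<notin> K \<Longrightarrow>
      built (n s) {\<tau>. \<tau> \<inter> L = {} \<and> s \<union> \<tau> \<in> K} \<and> m \<le> n s + card s"
  shows "built m K"
proof -
  have finK: "finite K" using fin by (meson finite_UnionD)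
  have finF: "finite \<sigma>" if "\<sigma> \<in> K" for \<sigma> using that fin by (meson Sup_upper finite_subset)
  define C where "C = {\<sigma> \<in> K. x \<notin> \<sigma> \<and> insert x \<sigma> \<in> K}"
  define S where "S = {s \<in> K. s \<subseteq> L \<and> insert x s \<notin> K}"
  define N where "N s = {\<tau>. \<tau> \<inter> L = {} \<and> s \<union> \<tau> \<in> K}" for s
  have K0: "C \<union> insert x ` C = {\<sigma> \<in> K. insert x \<sigma> \<in> K}"
  proof -
    have "\<sigma> \<in> C \<union> insert x ` C" if "\<sigma> \<in> K" "insert x \<sigma> \<in> K" for \<sigma>
    proof (cases "x \<in> \<sigma>")
      case True
      then have "\<sigma> - {x} \<in> C" "\<sigma> = insert x (\<sigma> - {x})"
        using down_closedD[OF down that(1), of "\<sigma> - {x}"] that by (auto simp: C_def insert_absorb)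
      then show ?thesis by blast
    qed (use that in \<open>auto simp: C_def\<close>)
    then show ?thesis by (auto simp: C_def)
  qed
  have "built m (C \<union> insert x ` C)"
  proof (rule built_cone)
    show "down_closed C"
      using down unfolding down_closed_def C_def by (smt (verit) insert_mono mem_Collect_eq subsetD)
  qed (use finK finF in \<open>auto simp: C_def\<close>)
  then have "built m ({\<sigma> \<in> K. insert x \<sigma> \<in> K} \<union> (\<Union>s\<in>S. (\<union>) s ` N s))"
    unfolding K0
  proof (rule built_fibres[rotated, where n = n])
    show "finite S" using finK by (simp add: S_def)
    show "finite s" if "s \<in> S" for s using that finF by (simp add: S_def)
    show "built (n s) (N s)" "m \<le> n s + card s" if "s \<in> S" for s
      using fibre[of s] that by (auto simp: S_def N_def)
    show "s \<inter> \<tau> = {}" if "s \<in> S" "\<tau> \<in> N s" for s \<tau> using that by (auto simp: S_def N_def)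
    show "s \<union> \<tau> \<notin> {\<sigma> \<in> K. insert x \<sigma> \<in> K}" if "s \<in> S" "\<tau> \<in> N s" for s \<tau>
      using that down_closedD[OF down, of "insert x (s \<union> \<tau>)" "insert x s"] by (auto simp: S_def)
    show "s - {y} \<union> \<tau> \<in> {\<sigma> \<in> K. insert x \<sigma> \<in> K}" if "s \<in> S" "\<tau> \<in> N s" "y \<in> s" for s \<tau> y
    proof -
      have K: "s - {y} \<union> \<tau> \<in> K"
        by (rule down_closedD[OF down, of "s \<union> \<tau>"]) (use that in \<open>auto simp: N_def\<close>)
      have "(s - {y} \<union> \<tau>) \<inter> L = s - {y}" using that by (auto simp: S_def N_def)
      then have "insert x ((s - {y} \<union> \<tau>) \<inter> L) \<in> K" using minimal[of s y] that by (simp add: S_def)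
      then show ?thesis using star[OF K] K by simp
    qed
    show "s = s'" if "s \<in> S" "s' \<in> S" "\<tau> \<in> N s" "\<tau>' \<in> N s'" "s \<union> \<tau> = s' \<union> \<tau>'" for s s' \<tau> \<tau>'
    proof -
      have "s = (s \<union> \<tau>) \<inter> L" "s' = (s' \<union> \<tau>') \<inter> L" using that by (auto simp: S_def N_def)
      then show ?thesis using that(5) by simp
    qed
  qed
  moreover have "{\<sigma> \<in> K. insert x \<sigma> \<in> K} \<union> (\<Union>s\<in>S. (\<union>) s ` N s) = K"
  proof -
    have "\<sigma> \<in> (\<Union>s\<in>S. (\<union>) s ` N s)" if "\<sigma> \<in> K" "insert x \<sigma> \<notin> K" for \<sigma>
    proof -
      have "\<sigma> \<inter> L \<in> S" using that star down_closedD[OF down that(1), of "\<sigma> \<inter> L"] by (auto simp: S_def)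
      moreover have "\<sigma> \<inter> L \<union> (\<sigma> - L) = \<sigma>" by blast
      moreover have "\<sigma> - L \<in> N (\<sigma> \<inter> L)" using that(1) calculation(2) by (auto simp: N_def)
      ultimately show ?thesis by blast
    qed
    then show ?thesis by (auto simp: N_def)
  qed
  ultimately show ?thesis by simp
qed

text \<open>By \<open>excl\<close> every face contains at most one vertex of \<open>T\<close>, so
  these vertices can be put back separately. Each brings its link with one vertex added, hence the
  bound \<open>m - 1\<close> for links.\<close>

lemma built_delete:
  assumes down: "down_closed K" and "finite T"
    and excl: "\<And>\<sigma> x y. \<sigma> \<in> K \<Longrightarrow> x \<in> \<sigma> \<inter> T \<Longrightarrow> y \<in> \<sigma> \<inter> T \<Longrightarrow> x = y"
    and del: "built m {\<sigma> \<in> K. \<sigma> \<inter> T = {}}"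
    and link: "\<And>x. x \<in> T \<Longrightarrow> built (m - 1) {\<tau>. x \<notin> \<tau> \<and> insert x \<tau> \<in> K}"
  shows "built m K"
proof -
  define N where "N s = {\<tau>. s \<inter> \<tau> = {} \<and> s \<union> \<tau> \<in> K}" for s
  have N1: "N {x} = {\<tau>. x \<notin> \<tau> \<and> insert x \<tau> \<in> K}" for x by (auto simp: N_def)
  define S where "S = (\<lambda>x. {x}) ` T"
  have avoid: "\<tau> \<inter> T = {}" if "x \<in> T" "\<tau> \<in> N {x}" for x \<tau>
    using excl[of "insert x \<tau>" x] that by (auto simp: N1)
  have "built m ({\<sigma> \<in> K. \<sigma> \<inter> T = {}} \<union> (\<Union>s\<in>S. (\<union>) s ` N s))"
  proof (rule built_fibres[where n = "\<lambda>_. m - 1"])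
    show "finite S" using \<open>finite T\<close> by (simp add: S_def)
    show "s - {y} \<union> \<tau> \<in> {\<sigma> \<in> K. \<sigma> \<inter> T = {}}" if "s \<in> S" "\<tau> \<in> N s" "y \<in> s" for s \<tau> y
    proof -
      obtain x where x: "s = {x}" "x \<in> T" using \<open>s \<in> S\<close> by (auto simp: S_def)
      then have "s - {y} \<union> \<tau> = \<tau>" using that(3) by auto
      moreover have "\<tau> \<in> K"
        using that(2) down_closedD[OF down, of "s \<union> \<tau>" \<tau>] by (auto simp: N_def)
      ultimately show ?thesis using avoid[of x \<tau>] x that(2) by simp
    qed
    show "s = s'" if "s \<in> S" "s' \<in> S" "\<tau> \<in> N s" "\<tau>' \<in> N s'" "s \<union> \<tau> = s' \<union> \<tau>'" for s s' \<tau> \<tau>'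
    proof -
      obtain x x' where "s = {x}" "x \<in> T" "s' = {x'}" "x' \<in> T"
        using \<open>s \<in> S\<close> \<open>s' \<in> S\<close> by (auto simp: S_def)
      then show ?thesis using avoid[of x \<tau>] avoid[of x' \<tau>'] that(3-5) by auto
    qed
  qed (use del link N1 in \<open>auto simp: S_def\<close>)
  moreover have "{\<sigma> \<in> K. \<sigma> \<inter> T = {}} \<union> (\<Union>s\<in>S. (\<union>) s ` N s) = K"
  proof -
    have "\<sigma> \<in> (\<Union>s\<in>S. (\<union>) s ` N s)" if \<sigma>: "\<sigma> \<in> K" "x \<in> \<sigma>" "x \<in> T" for \<sigma> x
    proof -
      have "\<sigma> = {x} \<union> (\<sigma> - {x})" using \<sigma>(2) by auto
      moreover have "\<sigma> - {x} \<in> N {x}" using \<sigma>(1,2) by (auto simp: N1 insert_absorb)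
      ultimately show ?thesis using \<sigma>(3) unfolding S_def by blast
    qed
    moreover have "(\<Union>s\<in>S. (\<union>) s ` N s) \<subseteq> K" by (auto simp: N_def)
    ultimately show ?thesis by blast
  qed
  ultimately show ?thesis by simp
qed

section \<open>Matroid complexes by deletion and contraction\<close>

lemma matroid_down_closed: "matroid E M \<Longrightarrow> down_closed M"
  by (auto simp: matroid_def simplicial_complex_def down_closed_def)

lemma matroid_finite:
  assumes "matroid E M"
  shows "finite (\<Union>M)" "finite M" "I \<in> M \<Longrightarrow> finite I"
proof -
  have E: "finite E" "M \<subseteq> Pow E" using assms by (auto simp: matroid_def simplicial_complex_def)
  show "finite (\<Union>M)" by (rule finite_subset[OF _ E(1)]) (use E in auto)
  show "finite M" by (rule finite_subset[OF E(2)]) (use E in simp)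
  show "finite I" if "I \<in> M" by (rule finite_subset[OF _ E(1)]) (use E that in auto)
qed

lemma matroid_extend:
  assumes "matroid E M" "I \<in> M" "B \<in> M" "card I \<le> card B"
  shows "\<exists>J\<in>M. I \<subseteq> J \<and> card J = card B"
  using assms(2,4)
proof (induction "card B - card I" arbitrary: I)
  case (Suc n)
  then have "card I < card B" by simp
  then obtain e where e: "e \<in> B - I" "insert e I \<in> M"
    using assms(1,3) Suc.prems(1) unfolding matroid_def by blast
  then have c: "card (insert e I) = Suc (card I)"
    using matroid_finite(3)[OF assms(1) Suc.prems(1)] by simp
  have "\<exists>J\<in>M. insert e I \<subseteq> J \<and> card J = card B"
    by (rule Suc.hyps(1)) (use c e Suc.hyps(2) \<open>card I < card B\<close> in auto)
  then show ?case by auto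
qed auto

lemma matroid_restrict:
  assumes "matroid E M"
  shows "matroid (E - X) {I \<in> M. I \<inter> X = {}}"
  unfolding matroid_def simplicial_complex_def
proof (intro conjI ballI allI impI)
  show "finite (E - X)" "{I \<in> M. I \<inter> X = {}} \<subseteq> Pow (E - X)" "{} \<in> {I \<in> M. I \<inter> X = {}}"
    using assms unfolding matroid_def simplicial_complex_def by auto
  show "\<tau> \<in> {I \<in> M. I \<inter> X = {}}" if "\<sigma> \<in> {I \<in> M. I \<inter> X = {}}" "\<tau> \<subseteq> \<sigma>" for \<sigma> \<tau>
    using that down_closedD[OF matroid_down_closed[OF assms], of \<sigma> \<tau>] by auto
  fix I J assume IJ: "I \<in> {I \<in> M. I \<inter> X = {}}" "J \<in> {I \<in> M. I \<inter> X = {}}" "card I < card J"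
  then obtain e where "e \<in> J - I" "insert e I \<in> M"
    using assms unfolding matroid_def by blast
  then show "\<exists>e\<in>J - I. insert e I \<in> {I \<in> M. I \<inter> X = {}}" using IJ by auto
qed

text \<open>For an element \<open>e\<close> that is not a loop, the deletion \<open>D\<close> and
  the link \<open>N\<close> are matroids on a smaller ground set. If some independent set of size
  \<open>card B\<close> avoids \<open>e\<close>, then \<open>N\<close> is attached to
  \<open>D\<close> along \<open>e\<close>. Otherwise \<open>e\<close> can be added to every
  independent set and \<open>M\<close> is a cone over \<open>D\<close>.\<close>

theorem matroid_built:
  assumes "matroid E M" "B \<in> M"
  shows "built (card B) M"
  using assms
proof (induction "card E" arbitrary: E M B rule: less_induct)
  case less
  have finE: "finite E" and ME: "M \<subseteq> Pow E" and M0: "{} \<in> M"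
    and ex: "\<And>I J. I \<in> M \<Longrightarrow> J \<in> M \<Longrightarrow> card I < card J \<Longrightarrow> \<exists>e\<in>J - I. insert e I \<in> M"
    using less.prems unfolding matroid_def simplicial_complex_def by blast+
  note down = matroid_down_closed[OF less.prems(1)] and fin = matroid_finite[OF less.prems(1)]
  show ?case
  proof (cases "M = {{}}")
    case True
    then show ?thesis using less.prems(2) built.cell[OF built.empty, of "{}" 0] by simp
  next
    case False
    then obtain e where e: "{e} \<in> M"
    proof -
      obtain I x where "I \<in> M" "x \<in> I" using False M0 by blast
      then show ?thesis using down_closedD[OF down, of I "{x}"] that by blast
    qed
    have "e \<in> E" using e ME by blast
    then have small: "card (E - {e}) < card E" using finE by (intro psubset_card_mono) auto
    define D where "D = {I \<in> M. I \<inter> {e} = {}}"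
    have D: "matroid (E - {e}) D" unfolding D_def by (rule matroid_restrict[OF less.prems(1)])
    define N where "N = {I. e \<notin> I \<and> insert e I \<in> M}"
    have N: "matroid (E - {e}) N"
      unfolding matroid_def simplicial_complex_def
    proof (intro conjI ballI allI impI)
      show "N \<subseteq> Pow (E - {e})" using ME by (auto simp: N_def)
      show "\<tau> \<in> N" if "\<sigma> \<in> N" "\<tau> \<subseteq> \<sigma>" for \<sigma> \<tau>
        using that down_closedD[OF down, of "insert e \<sigma>" "insert e \<tau>"] by (auto simp: N_def)
      fix I J assume IJ: "I \<in> N" "J \<in> N" "card I < card J"
      have "finite I" "finite J" using IJ fin(3)[of "insert e I"] fin(3)[of "insert e J"] by (auto simp: N_def)
      then obtain f where "f \<in> insert e J - insert e I" "insert f (insert e I) \<in> M"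
        using ex[of "insert e I" "insert e J"] IJ by (auto simp: N_def)
      then show "\<exists>f\<in>J - I. insert f I \<in> N" using IJ by (auto simp: N_def insert_commute)
    qed (use finE e in \<open>auto simp: N_def\<close>)
    have MDN: "M = D \<union> insert e ` N"
    proof -
      have "I \<in> D \<union> insert e ` N" if "I \<in> M" for I
      proof (cases "e \<in> I")
        case True
        then have "I - {e} \<in> N" "I = insert e (I - {e})" using that by (auto simp: N_def insert_absorb)
        then show ?thesis by blast
      qed (use that in \<open>auto simp: D_def\<close>)
      then show ?thesis by (auto simp: D_def N_def)
    qed
    show ?thesis
    proof (cases "\<exists>B'\<in>M. card B' = card B \<and> e \<notin> B'")
      case True
      then obtain B' where B': "B' \<in> D" "card B' = card B" by (auto simp: D_def)
      have 1: "built (card B) D" using less.hyps[OF small D B'(1)] B'(2) by simp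
      have "\<exists>I\<in>N. card I = card B - 1"
      \<comment> \<open>Subtraction is truncated: for empty \<open>B\<close> the size wanted in
        \<open>N\<close> is 0, attained by the empty set.\<close>
      proof (cases "card B = 0")
        case True
        then show ?thesis using e by (auto simp: N_def intro!: bexI[of _ "{}"])
      next
        case False
        then obtain J where J: "J \<in> M" "{e} \<subseteq> J" "card J = card B"
          using matroid_extend[OF less.prems(1) e less.prems(2)] by (auto simp: Suc_le_eq)
        then have "J - {e} \<in> N" by (auto simp: N_def insert_absorb)
        then show ?thesis using J by (intro bexI[of _ "J - {e}"]) auto
      qed
      then have 2: "built (card B - 1) N" using less.hyps[OF small N] by metis
      have "built (card B) (D \<union> (\<union>) {e} ` N)"
      proof (rule built_attach[OF 2 1])
        show "{e} - {y} \<union> \<tau> \<in> D" if "\<tau> \<in> N" "y \<in> {e}" for \<tau> y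
          using that down_closedD[OF down, of "insert e \<tau>" \<tau>] by (auto simp: D_def N_def)
      qed (auto simp: D_def N_def)
      moreover have "(\<union>) {e} ` N = insert e ` N" by auto
      ultimately show ?thesis using MDN by simp
    next
      case False
      have "insert e I \<in> M" if "I \<in> M" for I
      proof (cases "card I \<le> card B")
        case True
        then obtain J where "J \<in> M" "I \<subseteq> J" "card J = card B"
          using matroid_extend[OF less.prems(1) \<open>I \<in> M\<close> less.prems(2)] by blast
        then show ?thesis using False down_closedD[OF down, of J "insert e I"] by blast
      next
        case False': False
        obtain J where "J \<subseteq> I" "card J = card B"
          by (rule obtain_subset_with_card_n[of "card B" I]) (use False' in auto)
        then have "J \<in> M" using down_closedD[OF down that] by blast
        then have "e \<in> I" using False \<open>J \<subseteq> I\<close> \<open>card J = card B\<close> by blast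
        then show ?thesis using that by (simp add: insert_absorb)
      qed
      then have "N = D" using down_closedD[OF down] by (auto simp: D_def N_def)
      moreover have "built (card B) (D \<union> insert e ` D)"
        by (rule built_cone[OF matroid_finite(2)[OF D] matroid_down_closed[OF D]])
          (use matroid_finite(3)[OF D] in \<open>auto simp: D_def\<close>)
      ultimately show ?thesis using MDN by simp
    qed
  qed
qed

section \<open>Twofold deleted joins\<close>

definition pair_face :: "'a set \<Rightarrow> 'a set \<Rightarrow> ('a \<times> nat) set" where
  "pair_face s t = s \<times> {1} \<union> t \<times> {2}"

text \<open>Two factors are allowed to differ because a deletion or a link in one copy changes the
  other copy in a different way.\<close>

definition pair_join :: "'a set set \<Rightarrow> 'a set set \<Rightarrow> ('a \<times> nat) set set" where
  "pair_join P Q = {pair_face s t | s t. s \<in> P \<and> t \<in> Q \<and> s \<inter> t = {}}"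

lemma deleted_join_2: "deleted_join 2 K = pair_join K K"
proof -
  have 12: "{1..2} = {1, 2::nat}" by auto
  have dis: "disjoint_family_on \<sigma> {1, 2::nat} \<longleftrightarrow> \<sigma> 1 \<inter> \<sigma> 2 = {}" for \<sigma> :: "nat \<Rightarrow> 'a set"
    by (auto simp: disjoint_family_on_def)
  have "pair_face s t \<in> deleted_join 2 K" if "s \<in> K" "t \<in> K" "s \<inter> t = {}" for s t
    unfolding deleted_join_def 12 dis pair_face_def using that
    by (intro CollectI exI[of _ "\<lambda>i. if i = 1 then s else t"]) auto
  moreover have "\<sigma> \<in> pair_join K K" if "\<sigma> \<in> deleted_join 2 K" for \<sigma>
  proof -
    obtain f where f: "\<sigma> = (\<Union>i\<in>{1, 2}. f i \<times> {i})" "\<forall>i\<in>{1, 2}. f i \<in> K" "f 1 \<inter> f 2 = {}"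
      using \<open>\<sigma> \<in> deleted_join 2 K\<close> unfolding deleted_join_def 12 dis by blast
    then have "\<sigma> = pair_face (f 1) (f 2)" by (simp add: pair_face_def)
    then show ?thesis using f(2,3) unfolding pair_join_def by blast
  qed
  ultimately show ?thesis unfolding pair_join_def by blast
qed

lemma mem_pair_face: "(x, l) \<in> pair_face s t \<longleftrightarrow> l = 1 \<and> x \<in> s \<or> l = 2 \<and> x \<in> t"
  unfolding pair_face_def by blast

lemma pair_face_subset_iff [simp]: "pair_face s t \<subseteq> pair_face s' t' \<longleftrightarrow> s \<subseteq> s' \<and> t \<subseteq> t'"
proof
  assume *: "pair_face s t \<subseteq> pair_face s' t'"
  have "x \<in> s'" if "x \<in> s" for x
    using subsetD[OF *, of "(x, 1)"] that by (simp add: mem_pair_face)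
  moreover have "x \<in> t'" if "x \<in> t" for x
    using subsetD[OF *, of "(x, 2)"] that by (simp add: mem_pair_face)
  ultimately show "s \<subseteq> s' \<and> t \<subseteq> t'" by blast
next
  show "s \<subseteq> s' \<and> t \<subseteq> t' \<Longrightarrow> pair_face s t \<subseteq> pair_face s' t'" unfolding pair_face_def by blast
qed

lemma pair_face_eq_iff [simp]: "pair_face s t = pair_face s' t' \<longleftrightarrow> s = s' \<and> t = t'"
  by (simp add: set_eq_subset) blast

lemma insert_pair_face: "insert (x, 1) (pair_face s t) = pair_face (insert x s) t"
  "insert (x, Suc 0) (pair_face s t) = pair_face (insert x s) t"
  by (auto simp: pair_face_def)

lemma subset_pair_face:
  assumes "\<sigma> \<subseteq> pair_face s t"
  obtains s' t' where "\<sigma> = pair_face s' t'" "s' \<subseteq> s" "t' \<subseteq> t"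
proof
  show "\<sigma> = pair_face {x. (x, 1) \<in> \<sigma>} {x. (x, 2) \<in> \<sigma>}" using assms unfolding pair_face_def by blast
  show "{x. (x, 1) \<in> \<sigma>} \<subseteq> s" using assms by (auto simp: pair_face_def)
  show "{x. (x, 2) \<in> \<sigma>} \<subseteq> t" using assms by (auto simp: pair_face_def)
qed

lemma card_pair_face:
  assumes "finite s" "finite t"
  shows "card (pair_face s t) = card s + card t"
proof -
  have "(s \<times> {1}) \<inter> (t \<times> {2::nat}) = {}" by (simp add: Times_Int_Times)
  then show ?thesis
    unfolding pair_face_def using assms by (simp add: card_Un_disjoint card_cartesian_product)
qed

lemma pair_face_in_join [simp]: "pair_face s t \<in> pair_join P Q \<longleftrightarrow> s \<in> P \<and> t \<in> Q \<and> s \<inter> t = {}"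
  by (auto simp: pair_join_def)

lemma pair_joinE:
  assumes "\<sigma> \<in> pair_join P Q"
  obtains s t where "\<sigma> = pair_face s t" "s \<in> P" "t \<in> Q" "s \<inter> t = {}"
  using assms by (auto simp: pair_join_def)

lemma down_closed_pair_join:
  assumes "down_closed P" "down_closed Q"
  shows "down_closed (pair_join P Q)"
  unfolding down_closed_def
proof (intro ballI allI impI)
  fix \<sigma> \<tau> assume "\<sigma> \<in> pair_join P Q" "\<tau> \<subseteq> \<sigma>"
  then obtain s t where "\<sigma> = pair_face s t" and st: "s \<in> P" "t \<in> Q" "s \<inter> t = {}" by (blast elim: pair_joinE)
  with \<open>\<tau> \<subseteq> \<sigma>\<close> obtain s' t' where "\<tau> = pair_face s' t'" and st': "s' \<subseteq> s" "t' \<subseteq> t"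
    by (metis subset_pair_face)
  moreover have "s' \<in> P" "t' \<in> Q" using st st' assms down_closedD by blast+
  ultimately show "\<tau> \<in> pair_join P Q" using st(3) by auto
qed

lemma finite_pair_join:
  assumes "finite (\<Union>P)" "finite (\<Union>Q)"
  shows "finite (\<Union>(pair_join P Q))"
proof (rule finite_subset)
  show "\<Union>(pair_join P Q) \<subseteq> (\<Union>P) \<times> {1} \<union> (\<Union>Q) \<times> {2}"
    by (auto simp: pair_join_def pair_face_def)
qed (use assms in auto)

text \<open>Exchanging the labels 1 and 2 lets the other lemmas treat the first copy only.
  \<open>Z\<close> collects pairs so that removed faces can be exchanged as well.\<close>

lemma built_pair_join_swap:
  assumes "built m (pair_join Q P - (\<lambda>(s, t). pair_face t s) ` Z)"
  shows "built m (pair_join P Q - (\<lambda>(s, t). pair_face s t) ` Z)"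
proof -
  define sw where "sw = (\<lambda>(x::'a, l::nat). (x, if l = 1 then 2 else if l = 2 then 1 else l))"
  have "inj sw" by (auto simp: sw_def inj_def split: if_splits)
  have sw: "sw ` pair_face s t = pair_face t s" for s t
    by (force simp: sw_def pair_face_def image_Un image_def)
  have "(`) sw ` (pair_join Q P - (\<lambda>(s, t). pair_face t s) ` Z) = pair_join P Q - (\<lambda>(s, t). pair_face s t) ` Z"
    (is "?A = ?B")
  proof
    show "?A \<subseteq> ?B" by (auto elim!: pair_joinE simp: sw)
    show "?B \<subseteq> ?A"
    proof
      fix \<sigma> assume \<sigma>: "\<sigma> \<in> ?B"
      then obtain s t where st: "\<sigma> = pair_face s t" "s \<in> P" "t \<in> Q" "s \<inter> t = {}" by (auto elim: pair_joinE)
      then have "pair_face t s \<in> pair_join Q P - (\<lambda>(s, t). pair_face t s) ` Z" using \<sigma> by (force simp: image_def)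
      then show "\<sigma> \<in> ?A" using sw[of t s] st(1) by (metis imageI)
    qed
  qed
  then show ?thesis using built_image[OF assms \<open>inj sw\<close>] by simp
qed

lemma built_pair_join_swap': "built m (pair_join Q P) \<Longrightarrow> built m (pair_join P Q)"
  using built_pair_join_swap[where Z = "{}"] by auto

text \<open>\<open>built_delete\<close> for vertices of the first copy. In the link of
  \<open>(x, 1)\<close> the second factor loses \<open>x\<close>, because the two parts of a face
  are disjoint.\<close>

lemma built_pair_join_delete:
  assumes down: "down_closed (pair_join P Q - Z)" and T: "finite T"
    and excl: "\<And>s x y. s \<in> P \<Longrightarrow> x \<in> s \<inter> T \<Longrightarrow> y \<in> s \<inter> T \<Longrightarrow> x = y"
    and del: "built m (pair_join {s \<in> P. s \<inter> T = {}} Q - Z)"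
    and link: "\<And>x. x \<in> T \<Longrightarrow> built (m - 1) (pair_join {s. x \<notin> s \<and> insert x s \<in> P} {t \<in> Q. x \<notin> t}
      - {\<tau>. insert (x, 1) \<tau> \<in> Z})"
  shows "built m (pair_join P Q - Z)"
proof (rule built_delete[OF down])
  show "finite (T \<times> {1::nat})" using T by simp
  show "x = y" if "\<sigma> \<in> pair_join P Q - Z" "x \<in> \<sigma> \<inter> T \<times> {1}" "y \<in> \<sigma> \<inter> T \<times> {1}" for \<sigma> x y
    using that excl by (auto elim!: pair_joinE simp: pair_face_def)
  have "{\<sigma> \<in> pair_join P Q - Z. \<sigma> \<inter> T \<times> {1} = {}} = pair_join {s \<in> P. s \<inter> T = {}} Q - Z"
    by (auto simp: pair_join_def pair_face_def)
  then show "built m {\<sigma> \<in> pair_join P Q - Z. \<sigma> \<inter> T \<times> {1} = {}}" using del by simp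
  fix x' assume "x' \<in> T \<times> {1::nat}"
  then obtain x where x: "x' = (x, 1)" "x \<in> T" by auto
  have "{\<tau>. (x, 1) \<notin> \<tau> \<and> insert (x, 1) \<tau> \<in> pair_join P Q - Z} =
      pair_join {s. x \<notin> s \<and> insert x s \<in> P} {t \<in> Q. x \<notin> t} - {\<tau>. insert (x, 1) \<tau> \<in> Z}" (is "?A = ?B")
  proof
    show "?B \<subseteq> ?A" by (auto elim!: pair_joinE simp: insert_pair_face mem_pair_face)
    show "?A \<subseteq> ?B"
    proof
      fix \<tau> assume \<tau>: "\<tau> \<in> ?A"
      then obtain s t where st: "insert (x, 1) \<tau> = pair_face s t" "s \<in> P" "t \<in> Q" "s \<inter> t = {}"
        by (auto elim: pair_joinE)
      have xs: "x \<in> s" using st(1) using mem_pair_face[of x 1 s t] by auto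
      have "\<tau> = insert (x, 1) \<tau> - {(x, 1)}" using \<tau> by auto
      also have "\<dots> = pair_face (s - {x}) t" unfolding st(1) by (auto simp: pair_face_def)
      finally show "\<tau> \<in> ?B" using st xs \<tau> by (auto simp: insert_absorb)
    qed
  qed
  then show "built (m - 1) {\<tau>. x' \<notin> \<tau> \<and> insert x' \<tau> \<in> pair_join P Q - Z}"
    using link[OF x(2)] x(1) by simp
qed

text \<open>Since \<open>a\<close> occurs neither in \<open>Q\<close> nor, with label 1, in
  \<open>Z\<close>, the first part of a face decides whether \<open>(a, 1)\<close> can be added.
  Hence \<open>built_star\<close> applies with the first copy as \<open>L\<close>, and the fibre
  over \<open>s\<close> lives in the second copy.\<close>

lemma built_pair_join_star:
  assumes down: "down_closed (pair_join P Q - Z)" and downP: "down_closed P" and downQ: "{} \<in> Q"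
    and fin: "finite (\<Union>P)" "finite (\<Union>Q)"
    and aQ: "\<And>t. t \<in> Q \<Longrightarrow> a \<notin> t" and aZ: "\<And>z. z \<in> Z \<Longrightarrow> (a, 1) \<notin> z"
    and minimal: "\<And>s y. s \<in> P \<Longrightarrow> insert a s \<notin> P \<Longrightarrow> y \<in> s \<Longrightarrow> insert a (s - {y}) \<in> P"
    and fibre: "\<And>s. s \<in> P \<Longrightarrow> insert a s \<notin> P \<Longrightarrow>
      built (n s) {t \<in> Q. s \<inter> t = {} \<and> pair_face s t \<notin> Z} \<and> m \<le> n s + card s"
  shows "built m (pair_join P Q - Z)"
proof (rule built_star[OF down, where x = "(a, 1)" and L = "UNIV \<times> {1}" and n = "\<lambda>\<sigma>. n {x. (x, 1) \<in> \<sigma>}"])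
  show "finite (\<Union>(pair_join P Q - Z))"
    by (rule finite_subset[OF _ finite_pair_join[OF fin]]) auto
  have L: "pair_face s t \<inter> UNIV \<times> {1} = pair_face s {}" for s t :: "'a set" by (auto simp: pair_face_def)
  show "insert (a, 1) \<sigma> \<in> pair_join P Q - Z"
    if "\<sigma> \<in> pair_join P Q - Z" "insert (a, 1) (\<sigma> \<inter> UNIV \<times> {1}) \<in> pair_join P Q - Z" for \<sigma>
  proof -
    obtain s t where st: "\<sigma> = pair_face s t" "s \<in> P" "t \<in> Q" "s \<inter> t = {}"
      using \<open>\<sigma> \<in> pair_join P Q - Z\<close> by (blast elim: pair_joinE)
    have "pair_face (insert a s) {} \<in> pair_join P Q"
      using that(2) unfolding st(1) L insert_pair_face by simp
    then have "pair_face (insert a s) t \<in> pair_join P Q" using st aQ[of t] by simp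
    then have "insert (a, 1) \<sigma> \<in> pair_join P Q" unfolding st(1) insert_pair_face .
    then show ?thesis using aZ by blast
  qed
  fix \<sigma> assume \<sigma>: "\<sigma> \<in> pair_join P Q - Z" "\<sigma> \<subseteq> UNIV \<times> {1}" "insert (a, 1) \<sigma> \<notin> pair_join P Q - Z"
  then obtain s t where st: "\<sigma> = pair_face s t" "s \<in> P" "t \<in> Q" by (auto elim: pair_joinE)
  have "t = {}" using \<sigma>(2) st(1) by (auto simp: pair_face_def)
  then have s: "\<sigma> = pair_face s {}" using st by simp
  have as: "insert a s \<notin> P"
  proof
    assume "insert a s \<in> P"
    then have "insert (a, 1) \<sigma> \<in> pair_join P Q" using downQ unfolding s insert_pair_face by simp
    then show False using \<sigma>(3) aZ by blast
  qed
  {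
    fix y assume "y \<in> \<sigma>"
    then obtain x where x: "y = (x, 1)" "x \<in> s" unfolding s by (auto simp: pair_face_def)
    then have "insert (a, 1) (\<sigma> - {y}) = pair_face (insert a (s - {x})) {}"
      unfolding s by (auto simp: pair_face_def)
    then show "insert (a, 1) (\<sigma> - {y}) \<in> pair_join P Q - Z"
      using minimal[OF st(2) as x(2)] aZ[of "insert (a, 1) (\<sigma> - {y})"] downQ by auto
  }
  have sec: "{x. (x, 1) \<in> \<sigma>} = s" unfolding s by (auto simp: pair_face_def)
  have "finite s" using st(2) fin(1) by (meson Sup_upper finite_subset)
  then have "card \<sigma> = card s" unfolding s by (simp add: card_pair_face)
  moreover have "{\<tau>. \<tau> \<inter> UNIV \<times> {1} = {} \<and> \<sigma> \<union> \<tau> \<in> pair_join P Q - Z} =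
      (`) (\<lambda>x. (x, 2)) ` {t \<in> Q. s \<inter> t = {} \<and> pair_face s t \<notin> Z}" (is "?A = ?B")
  proof
    have un: "\<sigma> \<union> (\<lambda>x. (x, 2)) ` t = pair_face s t" for t unfolding s by (auto simp: pair_face_def)
    show "?B \<subseteq> ?A" using un st(2) by auto
    show "?A \<subseteq> ?B"
    proof
      fix \<tau> assume \<tau>: "\<tau> \<in> ?A"
      then obtain s' t' where st': "\<sigma> \<union> \<tau> = pair_face s' t'" "t' \<in> Q" "s' \<inter> t' = {}"
        by (auto elim: pair_joinE)
      have "\<tau> = (\<sigma> \<union> \<tau>) - UNIV \<times> {1}" using \<tau> \<sigma>(2) by blast
      also have "\<dots> = (\<lambda>x. (x, 2)) ` t'" unfolding st'(1) by (auto simp: pair_face_def)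
      finally have tt: "\<tau> = (\<lambda>x. (x, 2)) ` t'" .
      have "\<sigma> = (\<sigma> \<union> \<tau>) \<inter> UNIV \<times> {1}" using \<tau> \<sigma>(2) by blast
      then have "s' = s" unfolding st'(1) L using s by simp
      have "t' \<in> {t \<in> Q. s \<inter> t = {} \<and> pair_face s t \<notin> Z}"
        using \<tau> st' \<open>s' = s\<close> by (simp add: Int_commute)
      then show "\<tau> \<in> ?B" unfolding tt by (rule imageI)
    qed
  qed
  moreover have "built (n s) ((`) (\<lambda>x. (x, 2::nat)) ` {t \<in> Q. s \<inter> t = {} \<and> pair_face s t \<notin> Z})"
    using fibre[OF st(2) as] by (intro built_image) (auto simp: inj_def)
  ultimately show "built (n {x. (x, 1) \<in> \<sigma>})
      {\<tau>. \<tau> \<inter> UNIV \<times> {1} = {} \<and> \<sigma> \<union> \<tau> \<in> pair_join P Q - Z} \<and> m \<le> n {x. (x, 1) \<in> \<sigma>} + card \<sigma>"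
    using fibre[OF st(2) as] sec by simp
qed

lemma built_pair_join_empty:
  assumes "built m Q"
  shows "built m (pair_join {{}} Q)"
proof -
  have "pair_join {{}} Q = (`) (\<lambda>x. (x, 2)) ` Q"
    by (auto simp: pair_join_def pair_face_def)
  then show ?thesis using built_image[OF assms, of "\<lambda>x. (x, 2::nat)"] by (simp add: inj_def)
qed

section \<open>Block matroids\<close>

lemma down_closed_remove_maximal:
  assumes "down_closed K" "\<And>\<sigma>. \<sigma> \<in> K \<Longrightarrow> z \<subseteq> \<sigma> \<Longrightarrow> \<sigma> = z"
  shows "down_closed (K - {z})"
  using assms unfolding down_closed_def by blast

locale block_family =
  fixes A :: "'i \<Rightarrow> 'a set" and U :: "'i set" and W :: "'a set"
  assumes finU: "finite U" and finW: "finite W" and finA: "\<And>i. i \<in> U \<Longrightarrow> finite (A i)"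
    and cardA: "\<And>i. i \<in> U \<Longrightarrow> 2 \<le> card (A i)"
    and disjA: "\<And>i j. i \<in> U \<Longrightarrow> j \<in> U \<Longrightarrow> i \<noteq> j \<Longrightarrow> A i \<inter> A j = {}"
    and disjW: "\<And>i. i \<in> U \<Longrightarrow> A i \<inter> W = {}"
begin

text \<open>The matroid of the theorem is \<open>M U r {}\<close>; the parameters make the family closed under links
  and restrictions.\<close>

definition M :: "'i set \<Rightarrow> nat \<Rightarrow> 'a set \<Rightarrow> 'a set set" where
  "M I c X = {\<sigma>. \<sigma> \<subseteq> (\<Union>i\<in>I. A i) \<union> W - X \<and> card \<sigma> \<le> c \<and> (\<forall>i\<in>I. card (\<sigma> \<inter> A i) \<le> 1)}"

lemma finite_ground: "I \<subseteq> U \<Longrightarrow> finite ((\<Union>i\<in>I. A i) \<union> W)"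
  using finU finA finW by (auto intro: finite_subset)

lemma M_subset: "\<sigma> \<in> M I c X \<Longrightarrow> \<sigma> \<subseteq> (\<Union>i\<in>I. A i) \<union> W"
  by (auto simp: M_def)

lemma finite_face: "I \<subseteq> U \<Longrightarrow> \<sigma> \<in> M I c X \<Longrightarrow> finite \<sigma>"
  by (rule finite_subset[OF M_subset finite_ground])

lemma finite_Union_M: "I \<subseteq> U \<Longrightarrow> finite (\<Union>(M I c X))"
  by (rule finite_subset[OF _ finite_ground]) (auto simp: M_def)

lemma card_split:
  assumes "I \<subseteq> U" "\<sigma> \<subseteq> (\<Union>i\<in>I. A i) \<union> W"
  shows "card \<sigma> = card (\<sigma> \<inter> W) + (\<Sum>i\<in>I. card (\<sigma> \<inter> A i))"
proof -
  have fin: "finite \<sigma>" by (rule finite_subset[OF assms(2) finite_ground[OF assms(1)]])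
  have "\<sigma> = (\<sigma> \<inter> W) \<union> (\<Union>i\<in>I. \<sigma> \<inter> A i)" using assms(2) by auto
  then have "card \<sigma> = card ((\<sigma> \<inter> W) \<union> (\<Union>i\<in>I. \<sigma> \<inter> A i))" by simp
  also have "\<dots> = card (\<sigma> \<inter> W) + card (\<Union>i\<in>I. \<sigma> \<inter> A i)"
    using fin disjW assms(1) finU by (intro card_Un_disjoint) (auto intro: finite_subset)
  also have "card (\<Union>i\<in>I. \<sigma> \<inter> A i) = (\<Sum>i\<in>I. card (\<sigma> \<inter> A i))"
    using fin finite_subset[OF assms(1) finU] disjA assms(1) by (intro card_UN_disjoint) auto
  finally show ?thesis .
qed

lemma M_down: "I \<subseteq> U \<Longrightarrow> \<sigma> \<in> M I c X \<Longrightarrow> \<tau> \<subseteq> \<sigma> \<Longrightarrow> \<tau> \<in> M I c X"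
proof -
  assume I: "I \<subseteq> U" and \<sigma>: "\<sigma> \<in> M I c X" and \<tau>: "\<tau> \<subseteq> \<sigma>"
  have fin: "finite \<sigma>" by (rule finite_face[OF I \<sigma>])
  then have "card \<tau> \<le> card \<sigma>" using \<tau> by (rule card_mono)
  moreover have "card (\<tau> \<inter> A i) \<le> card (\<sigma> \<inter> A i)" for i using fin \<tau> by (intro card_mono) auto
  ultimately show "\<tau> \<in> M I c X"
    using \<sigma> \<tau> unfolding M_def by (fastforce elim: order_trans[rotated])
qed

text \<open>By \<open>card_split\<close> the larger face is larger on \<open>W\<close> or on some
  block. On \<open>W\<close> any element it has in excess can be exchanged; on a block the sizes are
  1 and 0, so its element is free to be added.\<close>

lemma M_matroid:
  assumes I: "I \<subseteq> U"
  shows "matroid ((\<Union>i\<in>I. A i) \<union> W - X) (M I c X)"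
  unfolding matroid_def simplicial_complex_def
proof (intro conjI ballI allI impI)
  show "finite ((\<Union>i\<in>I. A i) \<union> W - X)" using finite_ground[OF I] by simp
  show "M I c X \<subseteq> Pow ((\<Union>i\<in>I. A i) \<union> W - X)" "{} \<in> M I c X" by (auto simp: M_def)
  show "\<tau> \<in> M I c X" if "\<sigma> \<in> M I c X" "\<tau> \<subseteq> \<sigma>" for \<sigma> \<tau> using M_down[OF I] that .
  fix S T assume ST: "S \<in> M I c X" "T \<in> M I c X" "card S < card T"
  have fin: "finite S" "finite T" using finite_face[OF I] ST by auto
  have "card (S \<inter> W) + (\<Sum>i\<in>I. card (S \<inter> A i)) < card (T \<inter> W) + (\<Sum>i\<in>I. card (T \<inter> A i))"
    using card_split[OF I M_subset[OF ST(1)]] card_split[OF I M_subset[OF ST(2)]] ST(3) by simp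
  then have "\<not> (card (T \<inter> W) \<le> card (S \<inter> W) \<and> (\<forall>i\<in>I. card (T \<inter> A i) \<le> card (S \<inter> A i)))"
    using sum_mono[of I "\<lambda>i. card (T \<inter> A i)" "\<lambda>i. card (S \<inter> A i)"] by (metis add_mono not_less)
  then consider "card (S \<inter> W) < card (T \<inter> W)" | i where "i \<in> I" "card (S \<inter> A i) < card (T \<inter> A i)"
    by (auto simp: not_le)
  then show "\<exists>e\<in>T - S. insert e S \<in> M I c X"
  proof cases
    case 1
    then obtain e where e: "e \<in> T \<inter> W" "e \<notin> S \<inter> W"
      using card_mono[of "S \<inter> W" "T \<inter> W"] fin by (meson finite_Int not_less subsetI)
    have "insert e S \<inter> A i = S \<inter> A i" if "i \<in> I" for i using e disjW that I by blast
    then have "insert e S \<in> M I c X"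
      using ST e fin by (auto simp: M_def card_insert_if)
    then show ?thesis using e by blast
  next
    case (2 i)
    have "card (T \<inter> A i) \<le> 1" using ST(2) 2(1) by (simp add: M_def)
    then have "card (S \<inter> A i) = 0" using 2(2) by linarith
    then have S0: "S \<inter> A i = {}" using fin by simp
    have "T \<inter> A i \<noteq> {}" using 2(2) by (intro notI) simp
    then obtain e where e: "e \<in> T \<inter> A i" by blast
    have "card (insert e S \<inter> A j) \<le> 1" if "j \<in> I" for j
    proof (cases "j = i")
      case True
      then have "insert e S \<inter> A j = {e}" using S0 e by auto
      then show ?thesis by simp
    next
      case False
      then have "insert e S \<inter> A j = S \<inter> A j" using disjA[of i j] e I 2(1) that by blast
      then show ?thesis using ST(1) that by (simp add: M_def)
    qed
    then have "insert e S \<in> M I c X"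
      using ST e fin 2(1) by (auto simp: M_def card_insert_if)
    then show ?thesis using e S0 by blast
  qed
qed

lemmas down_closed_M = matroid_down_closed[OF M_matroid]

lemma M_empty: "{} \<in> M I c X" by (simp add: M_def)

lemma M_delete: "{s \<in> M I c X. s \<inter> T = {}} = M I c (X \<union> T)"
  by (auto simp: M_def)

lemma M_delete_elem: "{s \<in> M I c X. x \<notin> s} = M I c (insert x X)"
  by (auto simp: M_def)

lemma M_block_disjoint:
  assumes "J \<subseteq> U" "i \<in> U" "i \<notin> J" "s \<in> M J c X"
  shows "s \<inter> A i = {}"
proof -
  have "(\<Union>j\<in>J. A j) \<inter> A i = {}" using disjA[of _ i] assms by blast
  then show ?thesis using M_subset[OF assms(4)] disjW[OF assms(2)] by blast
qed

text \<open>Choosing \<open>x\<close> uses up block \<open>i\<close> and one unit of rank, so links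
  stay within the family.\<close>

lemma M_link:
  assumes I: "I \<subseteq> U" "i \<in> I" and x: "x \<in> A i - X"
  shows "{s. x \<notin> s \<and> insert x s \<in> M I (Suc c) X} = M (I - {i}) c X"
proof (rule Set.set_eqI, rule iffI)
  fix s assume s: "s \<in> {s. x \<notin> s \<and> insert x s \<in> M I (Suc c) X}"
  have fin: "finite s" using finite_face[OF I(1), of "insert x s"] s by auto
  have "card (insert x s \<inter> A i) \<le> 1" using s I by (simp add: M_def)
  moreover have "insert x s \<inter> A i = insert x (s \<inter> A i)" using x by auto
  ultimately have "s \<inter> A i = {}" using s fin x by (auto simp: card_insert_if)
  moreover have "card (s \<inter> A j) \<le> 1" if "j \<in> I" for j
  proof -
    have "card (s \<inter> A j) \<le> card (insert x s \<inter> A j)" using fin by (intro card_mono) auto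
    also have "\<dots> \<le> 1" using s that by (simp add: M_def)
    finally show ?thesis .
  qed
  moreover have "s \<subseteq> (\<Union>j\<in>I - {i}. A j) \<union> W - X"
  proof -
    have "s \<subseteq> (\<Union>j\<in>I. A j) \<union> W - X" using s by (auto simp: M_def)
    then show ?thesis using \<open>s \<inter> A i = {}\<close> by blast
  qed
  moreover have "card s \<le> c" using s fin by (auto simp: M_def)
  ultimately show "s \<in> M (I - {i}) c X" by (simp add: M_def)
next
  fix s assume s: "s \<in> M (I - {i}) c X"
  have fin: "finite s" using finite_face[OF _ s] I by blast
  have s0: "s \<inter> A i = {}" by (rule M_block_disjoint[OF _ _ _ s]) (use I in auto)
  have "card (insert x s \<inter> A j) \<le> 1" if "j \<in> I" for j
  proof (cases "j = i")
    case True
    then have "insert x s \<inter> A j = {x}" using s0 x by auto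
    then show ?thesis by simp
  next
    case False
    then have "insert x s \<inter> A j = s \<inter> A j" using disjA[of i j] x I that by blast
    then show ?thesis using s that False by (simp add: M_def)
  qed
  then show "s \<in> {s. x \<notin> s \<and> insert x s \<in> M I (Suc c) X}"
    using s s0 x fin I by (auto simp: M_def card_insert_if)
qed

lemma M_avoid_outside:
  assumes "I \<subseteq> U" "i \<in> U" "i \<notin> I" "X \<subseteq> A i"
  shows "M I c X = M I c {}"
proof -
  have "(\<Union>i\<in>I. A i) \<union> W - X = (\<Union>i\<in>I. A i) \<union> W"
    using disjA[of i] disjW[of i] assms by blast
  then show ?thesis by (simp add: M_def)
qed

lemma M_avoid_block:
  assumes "I \<subseteq> U" "i \<in> I"
  shows "M I c (A i) = M (I - {i}) c {}"
proof -
  have "(\<Union>i\<in>I. A i) \<union> W - A i = (\<Union>i\<in>I - {i}. A i) \<union> W"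
    using disjA[of i] disjW[of i] assms by blast
  moreover have "card (\<sigma> \<inter> A i) \<le> 1" if "\<sigma> \<subseteq> (\<Union>i\<in>I. A i) \<union> W - A i" for \<sigma>
  proof -
    have "\<sigma> \<inter> A i = {}" using that by auto
    then show ?thesis by simp
  qed
  ultimately show ?thesis by (auto simp: M_def)
qed

section \<open>Transversals of the blocks\<close>

lemma transversal_inter:
  assumes "J \<subseteq> U" "\<And>j. j \<in> J \<Longrightarrow> f j \<in> A j" "j \<in> J"
  shows "f ` J \<inter> A j = {f j}"
  using disjA assms by blast

lemma card_transversal:
  assumes "J \<subseteq> U" "\<And>j. j \<in> J \<Longrightarrow> f j \<in> A j"
  shows "card (f ` J) = card J"
proof (rule card_image, rule inj_onI)
  fix x y assume "x \<in> J" "y \<in> J" "f x = f y"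
  then show "x = y" using disjA[of x y] assms by (metis disjoint_iff subsetD)
qed

lemma transversal_in_M:
  assumes J: "J \<subseteq> U" and f: "\<And>j. j \<in> J \<Longrightarrow> f j \<in> A j - X" and w: "w \<subseteq> W - X"
    and c: "card J + card w \<le> c"
  shows "f ` J \<union> w \<in> M J c X" "card (f ` J \<union> w) = card J + card w"
proof -
  have fA: "\<And>j. j \<in> J \<Longrightarrow> f j \<in> A j" using f by blast
  have "f ` J \<inter> w = {}" using f w disjW J by blast
  then show card: "card (f ` J \<union> w) = card J + card w"
    using finite_subset[OF J finU] finite_subset[OF w] finW card_transversal[OF J fA]
    by (simp add: card_Un_disjoint)
  have "(f ` J \<union> w) \<inter> A j = {f j}" if "j \<in> J" for j
    using transversal_inter[OF J fA that] disjW[of j] w J that by blast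
  then show "f ` J \<union> w \<in> M J c X" using f w card c by (auto simp: M_def)
qed

lemma transversal_maximal:
  assumes J: "J \<subseteq> U" and f: "\<And>j. j \<in> J \<Longrightarrow> f j \<in> A j"
    and t: "t \<in> M J c X" "t \<inter> W = {}" "f ` J \<subseteq> t"
  shows "t = f ` J"
proof -
  have "card t = (\<Sum>i\<in>J. card (t \<inter> A i))" using card_split[OF J M_subset[OF t(1)]] t(2) by simp
  also have "\<dots> \<le> (\<Sum>i\<in>J. 1)" using t(1) by (intro sum_mono) (auto simp: M_def)
  finally have "card t \<le> card (f ` J)" using card_transversal[OF J f] by simp
  then show ?thesis using card_seteq[OF finite_face[OF J t(1)] t(3)] by simp
qed

lemma W_maximal:
  assumes "I \<subseteq> U" "s \<in> M I (card W) X" "W \<subseteq> s"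
  shows "s = W"
  using card_seteq[OF finite_face[OF assms(1,2)] assms(3)] assms(2) by (simp add: M_def)

lemma block_minus_nonempty:
  assumes "j \<in> U" "card (s \<inter> A j) \<le> 1"
  shows "\<exists>x. x \<in> A j - s"
proof (rule ccontr)
  assume "\<not> ?thesis"
  then have "s \<inter> A j = A j" by auto
  then show False using cardA[OF assms(1)] assms(2) by simp
qed

lemma matroid_M_built: "I \<subseteq> U \<Longrightarrow> B \<in> M I c X \<Longrightarrow> built (card B) (M I c X)"
  by (rule matroid_built[OF M_matroid])

text \<open>Without \<open>W\<close>, and with \<open>card J \<le> c\<close>, this is the join of
  the discrete sets \<open>A j\<close>. A point \<open>y\<close> of a block other than
  \<open>f j\<close> is a cone point except over the other points \<open>z\<close> of that block.
  The fibre over \<open>f j\<close> is a smaller instance with a facet removed, the other fibres are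
  full joins.\<close>

lemma transversal_removed_built:
  assumes "J \<subseteq> U" "\<And>j. j \<in> J \<Longrightarrow> f j \<in> A j" "card J \<le> c"
  shows "built (card J) (M J c W - {f ` J})"
proof -
  have "finite J" using assms(1) finU finite_subset by blast
  then show ?thesis using assms
  proof (induction J arbitrary: c rule: finite_induct)
    case empty
    \<comment> \<open>With no blocks the removed face is the empty face, the only one; the complex
      without any face is \<open>built\<close> for every bound.\<close>
    have "M {} c W - {{}} = {}" by (auto simp: M_def)
    then show ?case using built.empty[of 0] by (simp only: image_empty card.empty)
  next
    case (insert j J)
    have jU: "j \<in> U" and JU: "J \<subseteq> U" and fj: "f j \<in> A j" using insert.prems by auto
    obtain d where c: "c = Suc d" "card J \<le> d" using insert.prems(3) insert.hyps by (cases c) auto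
    define I where "I = insert j J"
    have I: "I \<subseteq> U" "j \<in> I" "I - {j} = J" using insert.prems insert.hyps by (auto simp: I_def)
    define K where "K = M I c W - {f ` I}"
    have fI: "\<And>k. k \<in> I \<Longrightarrow> f k \<in> A k" using insert.prems by (simp add: I_def)
    have max: "\<sigma> = f ` I" if "\<sigma> \<in> M I c W" "f ` I \<subseteq> \<sigma>" for \<sigma>
      by (rule transversal_maximal[OF I(1) fI that(1)]) (use that in \<open>auto simp: M_def\<close>)
    have down: "down_closed K" unfolding K_def
      by (rule down_closed_remove_maximal[OF down_closed_M[OF I(1)] max])
    obtain y where y: "y \<in> A j" "y \<noteq> f j"
      using block_minus_nonempty[OF jU, of "{f j}"] card_mono[of "{f j}" "{f j} \<inter> A j"] by auto
    have yf: "y \<notin> f ` I"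
      using transversal_inter[OF I(1) fI I(2)] y by auto
    have yW: "y \<notin> W" using y disjW[OF jU] by auto
    have link: "{s. x \<notin> s \<and> insert x s \<in> M I c W} = M J d W" if "x \<in> A j" for x
      using M_link[OF I(1,2), of x W d] that disjW[OF jU] c(1) I(3) by auto
    have yK: "insert y \<sigma> \<in> K" if "\<sigma> \<in> M I c W" "\<sigma> \<inter> A j \<subseteq> {y}" for \<sigma>
    proof -
      have "insert y \<sigma> \<in> M I c W"
      proof (cases "y \<in> \<sigma>")
        case False
        then have "\<sigma> \<inter> A j = {}" using that(2) by auto
        moreover have "card \<sigma> = card (\<sigma> \<inter> W) + (\<Sum>i\<in>I. card (\<sigma> \<inter> A i))"
          using card_split[OF I(1) M_subset[OF that(1)]] .
        moreover have "\<sigma> \<inter> W = {}" using that(1) by (auto simp: M_def)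
        moreover have "(\<Sum>i\<in>J. card (\<sigma> \<inter> A i)) \<le> (\<Sum>i\<in>J. 1)"
          using that(1) by (intro sum_mono) (auto simp: M_def I_def)
        ultimately have "card \<sigma> \<le> d" using c(2) insert.hyps by (simp add: I_def)
        then have "\<sigma> \<in> M J d W" using that(1) \<open>\<sigma> \<inter> A j = {}\<close> by (auto simp: M_def I_def)
        then show ?thesis using link[OF y(1)] by blast
      qed (use that in \<open>simp add: insert_absorb\<close>)
      then show ?thesis using yf by (auto simp: K_def)
    qed
    have "built (card I) K"
    proof (rule built_star[OF down, where x = y and L = "A j" and n = "\<lambda>_. card J"])
      show "finite (\<Union>K)" by (rule finite_subset[OF _ finite_Union_M[OF I(1)]]) (auto simp: K_def)
      show "insert y \<sigma> \<in> K" if "\<sigma> \<in> K" "insert y (\<sigma> \<inter> A j) \<in> K" for \<sigma>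
      proof (rule yK)
        have "card (insert y (\<sigma> \<inter> A j) \<inter> A j) \<le> 1" using that(2) I(2) by (auto simp: K_def M_def)
        moreover have "insert y (\<sigma> \<inter> A j) \<inter> A j = insert y (\<sigma> \<inter> A j)" using y(1) by auto
        moreover have "finite (\<sigma> \<inter> A j)" using finA[OF jU] by simp
        ultimately have "\<forall>x\<in>insert y (\<sigma> \<inter> A j). \<forall>z\<in>insert y (\<sigma> \<inter> A j). x = z"
          by (simp only: One_nat_def card_le_Suc0_iff_eq finite_insert)
        then show "\<sigma> \<inter> A j \<subseteq> {y}" by blast
      qed (use that in \<open>simp add: K_def\<close>)
      fix s assume s: "s \<in> K" "s \<subseteq> A j" "insert y s \<notin> K"
      have "card s \<le> 1" using s(1,2) I(2) by (auto simp: K_def M_def inf.absorb1)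
      moreover have "s \<noteq> {}" using s(3) yK[of "{}"] M_empty by auto
      moreover have "finite s" using s(2) finA[OF jU] finite_subset by blast
      ultimately obtain z where z: "s = {z}" by (metis card_1_singletonE card_gt_0_iff One_nat_def Suc_leI le_antisym)
      have zA: "z \<in> A j" using z s(2) by simp
      have zy: "z \<noteq> y" using s z by auto
      show "insert y (s - {x}) \<in> K" if "x \<in> s" for x
        using that z yK[of "{}"] M_empty by simp
      have eq: "{\<tau>. \<tau> \<inter> A j = {} \<and> s \<union> \<tau> \<in> K} = M J d W - {\<tau>. insert z \<tau> = f ` I}"
      proof -
        have "\<tau> \<inter> A j = {}" if "z \<notin> \<tau>" "insert z \<tau> \<in> M I c W" for \<tau>
        proof -
          have "\<tau> \<in> M J d W" using link[OF zA] that by blast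
          then show ?thesis by (rule M_block_disjoint[OF JU jU insert.hyps(2)])
        qed
        moreover have "\<tau> \<in> M J d W \<longleftrightarrow> z \<notin> \<tau> \<and> insert z \<tau> \<in> M I c W" for \<tau> using link[OF zA] by blast
        ultimately show ?thesis using zA by (auto simp: K_def z)
      qed
      have "built (card J) (M J d W - {\<tau>. insert z \<tau> = f ` I})"
      proof (cases "z = f j")
        case True
        have "f j \<notin> f ` J" using transversal_inter[OF I(1) fI I(2)] card_transversal[OF I(1) fI]
            insert.hyps card_image_le[of J f] by (auto simp: I_def insert_absorb)
        moreover have "f j \<notin> \<tau>" if "\<tau> \<in> M J d W" for \<tau> using link[OF fj] that by blast
        ultimately have "M J d W - {\<tau>. insert z \<tau> = f ` I} = M J d W - {f ` J}"
          unfolding True I_def image_insert by (auto simp: insert_ident)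
        then show ?thesis using insert.IH[OF JU _ c(2)] insert.prems(2) by simp
      next
        case False
        then have "z \<notin> f ` I" using transversal_inter[OF I(1) fI I(2)] zA by auto
        then have "M J d W - {\<tau>. insert z \<tau> = f ` I} = M J d W" by auto
        moreover have "f ` J \<union> {} \<in> M J d W" "card (f ` J \<union> {}) = card J"
          using transversal_in_M[OF JU, of f W "{}" d] insert.prems(2) disjW JU c(2) by fastforce+
        ultimately show ?thesis using matroid_M_built[OF JU] by metis
      qed
      then show "built (card J) {\<tau>. \<tau> \<inter> A j = {} \<and> s \<union> \<tau> \<in> K} \<and> card I \<le> card J + card s"
        using eq z insert.hyps by (simp add: I_def)
    qed
    then show ?case by (simp add: K_def I_def)
  qed
qed

end

section \<open>Deleted joins of block matroids, by induction on the blocks\<close>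

context block_family
begin

lemma avoid_except_disjoint: "s \<in> M I c (A i - {a}) \<Longrightarrow> a \<notin> s \<Longrightarrow> s \<inter> A i = {}"
  by (auto simp: M_def)

lemma M_insert_apex:
  assumes I: "I \<subseteq> U" "i \<in> I" and a: "a \<in> A i" and s: "s \<in> M I c (A i - {a})" "card s < c"
  shows "insert a s \<in> M I c (A i - {a})"
proof -
  have fin: "finite s" by (rule finite_face[OF I(1) s(1)])
  have "card (insert a s \<inter> A j) \<le> 1" if "j \<in> I" for j
  proof (cases "j = i")
    case True
    then have "insert a s \<inter> A j = {a}" using s(1) a by (auto simp: M_def)
    then show ?thesis by simp
  next
    case False
    then have "insert a s \<inter> A j = s \<inter> A j" using disjA[of i j] a I that by blast
    then show ?thesis using s(1) that by (simp add: M_def)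
  qed
  then show ?thesis using s a I fin by (auto simp: M_def card_insert_if)
qed

text \<open>With only \<open>a\<close> left of block \<open>i\<close>, \<open>M_insert_apex\<close>
  adds \<open>a\<close> to every face with fewer than \<open>c\<close> elements. So fibres occur
  only over faces of full size \<open>c\<close> without \<open>a\<close>, which then miss the whole
  block.\<close>

lemma pair_join_star_built:
  assumes I: "I \<subseteq> U" "i \<in> I" and a: "a \<in> A i"
    and Q: "down_closed Q" "{} \<in> Q" "finite (\<Union>Q)" "\<And>t. t \<in> Q \<Longrightarrow> a \<notin> t"
    and down: "down_closed (pair_join (M I c (A i - {a})) Q - Z)" and Z: "\<And>z. z \<in> Z \<Longrightarrow> (a, 1) \<notin> z"
    and fibre: "\<And>s. s \<in> M I c (A i - {a}) \<Longrightarrow> card s = c \<Longrightarrow> s \<inter> A i = {} \<Longrightarrow>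
      built n {t \<in> Q. s \<inter> t = {} \<and> pair_face s t \<notin> Z}"
    and m: "m \<le> n + c"
  shows "built m (pair_join (M I c (A i - {a})) Q - Z)"
proof (rule built_pair_join_star[OF down down_closed_M[OF I(1)] Q(2) finite_Union_M[OF I(1)] Q(3),
      where a = a and n = "\<lambda>_. n"])
  have top: "a \<notin> s \<and> card s = c" if "s \<in> M I c (A i - {a})" "insert a s \<notin> M I c (A i - {a})" for s
  proof -
    have "card s \<le> c" using that(1) by (simp add: M_def)
    moreover have "a \<notin> s" using that by (auto simp: insert_absorb)
    ultimately show ?thesis using M_insert_apex[OF I a that(1)] that(2) by force
  qed
  show "insert a (s - {y}) \<in> M I c (A i - {a})"
    if "s \<in> M I c (A i - {a})" "insert a s \<notin> M I c (A i - {a})" "y \<in> s" for s y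
  proof (rule M_insert_apex[OF I a])
    show "s - {y} \<in> M I c (A i - {a})" by (rule M_down[OF I(1) that(1)]) auto
    show "card (s - {y}) < c"
      using top[OF that(1,2)] that(3) finite_face[OF I(1) that(1)] card_Diff1_less by metis
  qed
  show "built n {t \<in> Q. s \<inter> t = {} \<and> pair_face s t \<notin> Z} \<and> m \<le> n + card s"
    if "s \<in> M I c (A i - {a})" "insert a s \<notin> M I c (A i - {a})" for s
    using fibre[OF that(1)] top[OF that] avoid_except_disjoint[OF that(1)] m by simp
qed (use Q Z in auto)

lemma one_per_block:
  assumes "I \<subseteq> U" "i \<in> I" "T \<subseteq> A i" "s \<in> M I c X" "x \<in> s \<inter> T" "y \<in> s \<inter> T"
  shows "x = y"
proof -
  have fin: "finite (s \<inter> A i)" using finite_face[OF assms(1,4)] by simp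
  have "card (s \<inter> A i) \<le> Suc 0" using assms by (simp add: M_def)
  then show ?thesis using card_le_Suc0_iff_eq[OF fin] assms by blast
qed

lemma down_closed_pair_join_M:
  "I \<subseteq> U \<Longrightarrow> J \<subseteq> U \<Longrightarrow> down_closed (pair_join (M I c X) (M J c' Y))"
  by (intro down_closed_pair_join down_closed_M)

lemma down_closed_remove_top:
  assumes I: "I \<subseteq> U" "J \<subseteq> U" and f: "\<And>j. j \<in> J \<Longrightarrow> f j \<in> A j"
  shows "down_closed (pair_join (M I (card W) X) (M J c Y) - {pair_face W (f ` J)})"
    and "down_closed (pair_join (M J c Y) (M I (card W) X) - {pair_face (f ` J) W})"
proof -
  have max: "s = W \<and> t = f ` J"
    if "s \<in> M I (card W) X" "t \<in> M J c Y" "s \<inter> t = {}" "W \<subseteq> s" "f ` J \<subseteq> t" for s t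
  proof -
    have "s = W" by (rule W_maximal[OF I(1) that(1,4)])
    moreover have "t = f ` J"
      by (rule transversal_maximal[OF I(2) f that(2) _ that(5)]) (use that in auto)
    ultimately show ?thesis ..
  qed
  show "down_closed (pair_join (M I (card W) X) (M J c Y) - {pair_face W (f ` J)})"
  proof (rule down_closed_remove_maximal[OF down_closed_pair_join_M[OF I]])
    fix \<sigma> assume "\<sigma> \<in> pair_join (M I (card W) X) (M J c Y)" "pair_face W (f ` J) \<subseteq> \<sigma>"
    then show "\<sigma> = pair_face W (f ` J)"
      by (elim pair_joinE) (simp add: max)
  qed
  show "down_closed (pair_join (M J c Y) (M I (card W) X) - {pair_face (f ` J) W})"
  proof (rule down_closed_remove_maximal[OF down_closed_pair_join_M[OF I(2,1)]])
    fix \<sigma> assume "\<sigma> \<in> pair_join (M J c Y) (M I (card W) X)" "pair_face (f ` J) W \<subseteq> \<sigma>"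
    then show "\<sigma> = pair_face (f ` J) W"
      by (elim pair_joinE) (simp add: max Int_commute)
  qed
qed

lemma M_restrict_fibre: "{t \<in> M J c X. s \<inter> t = {}} = M J c (X \<union> s)"
  using M_delete[of J c X s] by (simp add: Int_commute)

text \<open>The set \<open>Z\<close> of removed faces is empty, or contains one maximal face; the latter is needed to
  see that this face is critical.\<close>

lemma half_block_built:
  assumes I: "I \<subseteq> U" "i \<in> I" and v: "v \<in> A i" and p: "card I < p" "p \<le> card W"
    and IH: "built (p + card I - 2) (pair_join (M (I - {i}) (p - 1) {}) (M (I - {i}) (card I) {}))"
    and Z: "Z = {} \<or> p = card W \<and> p = Suc (card I) \<and> (\<forall>j\<in>I - {i}. f j \<in> A j) \<and>
      Z = {pair_face W (f ` (I - {i}))}"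
  shows "built (p + card I - 1) (pair_join (M I (Suc (card I)) {v}) (M (I - {i}) (p - 1) {}) - Z)"
proof -
  define J where "J = I - {i}"
  have iU: "i \<in> U" and J: "J \<subseteq> U" "i \<notin> J" using I by (auto simp: J_def)
  have finI: "finite I" using I(1) finU finite_subset by blast
  have cJ: "card I = Suc (card J)" unfolding J_def using finI I(2) by (metis card.remove)
  \<comment> \<open>\<open>b\<close> becomes the cone point. Block \<open>i\<close> is present in
    the first factor only, so \<open>b\<close> cannot collide with the second part of a
    face.\<close>
  obtain b where b: "b \<in> A i" "b \<noteq> v"
  proof -
    have "card ({v} \<inter> A i) \<le> 1" using card_mono[of "{v}" "{v} \<inter> A i"] by simp
    then show ?thesis using block_minus_nonempty[OF iU, of "{v}"] that by blast
  qed
  have down: "down_closed (pair_join (M I (Suc (card I)) X) (M J (p - 1) {}) - Z)" for X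
    using Z down_closed_pair_join_M[OF I(1) J(1)] down_closed_remove_top(1)[OF I(1) J(1), of f]
    by (auto simp: J_def)
  have notZ: "(x, 1) \<notin> z" if "z \<in> Z" "x \<in> A i" for x z
    using Z that disjW[OF iU] by (auto simp: mem_pair_face)
  have star: "built (p + card I - 1) (pair_join (M I (Suc (card I)) (A i - {b})) (M J (p - 1) {}) - Z)"
  proof (rule pair_join_star_built[OF I b(1) down_closed_M[OF J(1)] M_empty finite_Union_M[OF J(1)] _ down,
        where n = "p - 2"])
    show "b \<notin> t" if "t \<in> M J (p - 1) {}" for t
      using M_block_disjoint[OF J(1) iU J(2) that] b by auto
    show "(b, 1) \<notin> z" if "z \<in> Z" for z using notZ[OF that b(1)] .
    show "p + card I - 1 \<le> p - 2 + Suc (card I)" using cJ p by simp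
    fix s assume s: "s \<in> M I (Suc (card I)) (A i - {b})" "card s = Suc (card I)" "s \<inter> A i = {}"
    show "built (p - 2) {t \<in> M J (p - 1) {}. s \<inter> t = {} \<and> pair_face s t \<notin> Z}"
    proof (cases "Z \<noteq> {} \<and> s = W")
      case True
      \<comment> \<open>Only the fibre over \<open>W\<close> notices the removed face. Here
        \<open>p - 2 = card J\<close>, exactly the bound of
        \<open>transversal_removed_built\<close>.\<close>
      then have Z': "p = Suc (card I)" "\<And>j. j \<in> J \<Longrightarrow> f j \<in> A j" "Z = {pair_face W (f ` J)}"
        using Z by (auto simp: J_def)
      have "{t \<in> M J (p - 1) {}. s \<inter> t = {} \<and> pair_face s t \<notin> Z} = M J (p - 1) W - {f ` J}"
        using M_restrict_fibre[of J "p - 1" "{}" W] True Z'(3) by auto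
      moreover have "built (card J) (M J (p - 1) W - {f ` J})"
        by (rule transversal_removed_built[OF J(1) Z'(2)]) (use Z'(1) cJ in auto)
      ultimately show ?thesis using Z'(1) cJ by simp
    next
      case False
      then have "{t \<in> M J (p - 1) {}. s \<inter> t = {} \<and> pair_face s t \<notin> Z} = M J (p - 1) s"
        using M_restrict_fibre[of J "p - 1" "{}" s] Z by auto
      moreover have "\<exists>x. x \<in> A j - s" if "j \<in> J" for j
        by (rule block_minus_nonempty) (use that s(1) J in \<open>auto simp: M_def J_def\<close>)
      then obtain g where g: "\<And>j. j \<in> J \<Longrightarrow> g j \<in> A j - s" by metis
      \<comment> \<open>A transversal of \<open>J\<close> outside \<open>s\<close> has
        \<open>card I - 1\<close> elements; filling up with \<open>p - Suc (card I)\<close> elements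
        of \<open>W - s\<close> gives an independent set of size \<open>p - 2\<close> in the
        fibre.\<close>
      have "p - Suc (card I) \<le> card (W - s)"
        using diff_card_le_card_Diff[of s W] finite_face[OF I(1) s(1)] s(2) p(2) by simp
      then obtain w where w: "w \<subseteq> W - s" "card w = p - Suc (card I)"
        by (rule obtain_subset_with_card_n)
      have "g ` J \<union> w \<in> M J (p - 1) s" "card (g ` J \<union> w) = p - 2"
        using transversal_in_M[OF J(1) g w(1), of "p - 1"] w(2) cJ p(1) by auto
      ultimately show ?thesis using matroid_M_built[OF J(1)] by metis
    qed
  qed
  show ?thesis unfolding J_def[symmetric]
  proof (rule built_pair_join_delete[OF down, where T = "A i - {v, b}"])
    show "finite (A i - {v, b})" using finA[OF iU] by simp
    show "x = y" if "s \<in> M I (Suc (card I)) {v}" "x \<in> s \<inter> (A i - {v, b})" "y \<in> s \<inter> (A i - {v, b})" for s x y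
      by (rule one_per_block[OF I _ that]) auto
    have "{v} \<union> (A i - {v, b}) = A i - {b}" using v b by auto
    then show "built (p + card I - 1)
        (pair_join {s \<in> M I (Suc (card I)) {v}. s \<inter> (A i - {v, b}) = {}} (M J (p - 1) {}) - Z)"
      using star by (simp add: M_delete)
    fix x assume x: "x \<in> A i - {v, b}"
    have "{s. x \<notin> s \<and> insert x s \<in> M I (Suc (card I)) {v}} = M J (card I) {}"
      using M_link[OF I, of x "{v}" "card I"] M_avoid_outside[OF J(1) iU J(2), of "{v}"] x v by (simp add: J_def)
    moreover have "{t \<in> M J (p - 1) {}. x \<notin> t} = M J (p - 1) {}"
      using M_avoid_outside[OF J(1) iU J(2), of "{x}"] x by (simp add: M_delete_elem)
    moreover have "{\<tau>. insert (x, 1) \<tau> \<in> Z} = {}" using notZ x by blast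
    moreover have "built (p + card I - 1 - 1) (pair_join (M J (card I) {}) (M J (p - 1) {}))"
      using built_pair_join_swap'[OF IH] by (simp add: J_def numeral_2_eq_2)
    ultimately show "built (p + card I - 1 - 1)
        (pair_join {s. x \<notin> s \<and> insert x s \<in> M I (Suc (card I)) {v}} {t \<in> M J (p - 1) {}. x \<notin> t}
          - {\<tau>. insert (x, 1) \<tau> \<in> Z})"
      by simp
  qed
qed

text \<open>Keep only \<open>a\<close> of block \<open>i\<close> in the first copy and delete
  \<open>a\<close> from the second: then \<open>a\<close> is a cone point except over the faces of
  size \<open>p\<close>. Afterwards \<open>a\<close> returns to the second copy, with the link in
  \<open>smaller\<close>, and the rest of the block to the first copy, with the links in
  \<open>half\<close>.\<close>

lemma block_step:
  assumes I: "I \<subseteq> U" "i \<in> I" and a: "a \<in> A i" and p: "1 \<le> p"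
    and down: "down_closed (pair_join (M I p {}) (M I (Suc (card I)) {}) - Z)"
    and Z: "\<And>z. z \<in> Z \<Longrightarrow> \<exists>v\<in>A i - {a}. (v, 1) \<in> z"
    and smaller: "built (p + card I - 1) (pair_join (M (I - {i}) p {}) (M (I - {i}) (card I) {}))"
    and half: "\<And>v. v \<in> A i - {a} \<Longrightarrow> built (p + card I - 1)
      (pair_join (M (I - {i}) (p - 1) {}) (M I (Suc (card I)) {v}) - {\<tau>. insert (v, 1) \<tau> \<in> Z})"
  shows "built (p + card I) (pair_join (M I p {}) (M I (Suc (card I)) {}) - Z)"
proof -
  define J where "J = I - {i}"
  define T where "T = A i - {a}"
  let ?q = "Suc (card I)"
  have iU: "i \<in> U" and J: "J \<subseteq> U" "i \<notin> J" using I by (auto simp: J_def)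
  have star: "built (p + card I) (pair_join (M I p T) (M I ?q {a}) - {})"
    unfolding T_def
  proof (rule pair_join_star_built[OF I a down_closed_M[OF I(1)] M_empty finite_Union_M[OF I(1)], where n = "card I"])
    show "down_closed (pair_join (M I p (A i - {a})) (M I ?q {a}) - {})"
      using down_closed_pair_join_M[OF I(1) I(1)] by simp
    fix s assume s: "s \<in> M I p (A i - {a})" "card s = p" "s \<inter> A i = {}"
    have "{t \<in> M I ?q {a}. s \<inter> t = {} \<and> pair_face s t \<notin> {}} = M I ?q ({a} \<union> s)"
      by (simp add: M_restrict_fibre)
    \<comment> \<open>In block \<open>i\<close> only \<open>a\<close> is taken, in any other block
      at most one element of \<open>s\<close>. So a full transversal of \<open>I\<close> survives,
      which accounts for the summand \<open>card I\<close>.\<close>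
    moreover have "\<exists>x. x \<in> A j - ({a} \<union> s)" if "j \<in> I" for j
    proof (rule block_minus_nonempty)
      show "card (({a} \<union> s) \<inter> A j) \<le> 1"
      proof (cases "j = i")
        case True
        then have "({a} \<union> s) \<inter> A j = {a}" using s(3) a by auto
        then show ?thesis by simp
      next
        case False
        then have "({a} \<union> s) \<inter> A j = s \<inter> A j" using disjA[of i j] a I that by blast
        then show ?thesis using s(1) that by (simp add: M_def)
      qed
    qed (use that I in auto)
    then obtain g where g: "\<And>j. j \<in> I \<Longrightarrow> g j \<in> A j - ({a} \<union> s)" by metis
    have "g ` I \<union> {} \<in> M I ?q ({a} \<union> s)" "card (g ` I \<union> {}) = card I"
      using transversal_in_M[OF I(1) g, of "{}" ?q] by auto
    ultimately show "built (card I) {t \<in> M I ?q {a}. s \<inter> t = {} \<and> pair_face s t \<notin> {}}"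
      using matroid_M_built[OF I(1)] by metis
  qed (auto simp: M_def)
  have "built (p + card I) (pair_join (M I ?q {}) (M I p T) - {})"
  proof (rule built_pair_join_delete[where T = "{a}"])
    show "down_closed (pair_join (M I ?q {}) (M I p T) - {})"
      using down_closed_pair_join_M[OF I(1) I(1)] by simp
    show "built (p + card I) (pair_join {s \<in> M I ?q {}. s \<inter> {a} = {}} (M I p T) - {})"
      using star built_pair_join_swap'[of _ "M I p T"] by (simp only: M_delete Diff_empty sup_bot_left)
    fix x assume "x \<in> {a}"
    then have x: "x = a" by simp
    have "{s. a \<notin> s \<and> insert a s \<in> M I ?q {}} = M J (card I) {}"
      using M_link[OF I, of a "{}"] a by (simp add: J_def)
    moreover have "{t \<in> M I p T. a \<notin> t} = M J p {}"
    proof -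
      have "insert a T = A i" using a by (auto simp: T_def)
      then show ?thesis using M_avoid_block[OF I, of p] by (simp add: M_delete_elem J_def)
    qed
    ultimately show "built (p + card I - 1) (pair_join {s. x \<notin> s \<and> insert x s \<in> M I ?q {}}
        {t \<in> M I p T. x \<notin> t} - {\<tau>. insert (x, 1) \<tau> \<in> {}})"
      using built_pair_join_swap'[OF smaller] by (simp add: x J_def)
  qed auto
  then have restricted: "built (p + card I) (pair_join (M I p T) (M I ?q {}))"
    using built_pair_join_swap'[of _ "M I ?q {}"] by simp
  show ?thesis
  proof (rule built_pair_join_delete[OF down, where T = T])
    show "finite T" using finA[OF iU] by (simp add: T_def)
    show "x = y" if "s \<in> M I p {}" "x \<in> s \<inter> T" "y \<in> s \<inter> T" for s x y
      by (rule one_per_block[OF I _ that]) (auto simp: T_def)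
    have "z \<notin> pair_join (M I p T) (M I ?q {})" if "z \<in> Z" for z
    proof
      assume "z \<in> pair_join (M I p T) (M I ?q {})"
      then obtain s t where "z = pair_face s t" "s \<in> M I p T" by (blast elim: pair_joinE)
      moreover obtain v where "v \<in> T" "(v, 1) \<in> z" using Z[OF \<open>z \<in> Z\<close>] by (auto simp: T_def)
      ultimately show False by (auto simp: mem_pair_face M_def)
    qed
    then have "pair_join (M I p T) (M I ?q {}) - Z = pair_join (M I p T) (M I ?q {})" by blast
    then show "built (p + card I) (pair_join {s \<in> M I p {}. s \<inter> T = {}} (M I ?q {}) - Z)"
      using restricted by (simp only: M_delete sup_bot_left)
    fix x assume x: "x \<in> T"
    have "{s. x \<notin> s \<and> insert x s \<in> M I p {}} = M J (p - 1) {}"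
      using M_link[OF I, of x "{}" "p - 1"] x p by (simp add: J_def T_def)
    then show "built (p + card I - 1) (pair_join {s. x \<notin> s \<and> insert x s \<in> M I p {}}
        {t \<in> M I ?q {}. x \<notin> t} - {\<tau>. insert (x, 1) \<tau> \<in> Z})"
      using half[of x] x by (simp add: M_delete_elem J_def T_def)
  qed
qed

text \<open>The rank bound of the second factor stays tied to the number of blocks, while
  \<open>p\<close> is kept in \<open>smaller\<close> and drops by one in \<open>half\<close>;
  \<open>card I < p\<close> survives both. \<open>p \<le> card W\<close> supplies the elements of
  \<open>W\<close> for the fibres in \<open>half_block_built\<close>.\<close>

lemma blocks_built:
  assumes "I \<subseteq> U" "card I < p" "p \<le> card W"
  shows "built (p + card I) (pair_join (M I p {}) (M I (Suc (card I)) {}))"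
  using assms
proof (induction "card I" arbitrary: I p)
  case 0
  then have I: "I = {}" using finite_subset[OF _ finU] by simp
  have E: "{} \<subseteq> U" by simp
  have uniform: "built n (M {} p X)" if n: "n \<le> p" "n \<le> card (W - X)" for n X
  proof -
    obtain B where B: "B \<subseteq> W - X" "card B = n" using n(2) by (rule obtain_subset_with_card_n)
    then have "B \<in> M {} p X" using n(1) by (auto simp: M_def)
    then show ?thesis using matroid_M_built[OF E] B(2) by blast
  qed
  \<comment> \<open>One factor has at most a single point of \<open>W\<close>. Without that point
    the other is a uniform matroid of rank \<open>p\<close>; over a point \<open>x\<close> it lives
    on \<open>W - {x}\<close>, which still has at least \<open>p - 1\<close> elements.\<close>
  have "built p (pair_join (M {} 1 {}) (M {} p {}) - {})"
  proof (rule built_pair_join_delete[where T = W])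
    show "down_closed (pair_join (M {} 1 {}) (M {} p {}) - {})"
      using down_closed_pair_join_M[OF E E] by simp
    show "x = y" if "s \<in> M {} 1 {}" "x \<in> s \<inter> W" "y \<in> s \<inter> W" for s x y
      using that card_le_Suc0_iff_eq[OF finite_face[OF E that(1)]] by (simp add: M_def)
    have "{s \<in> M {} 1 {}. s \<inter> W = {}} = {{}}" by (auto simp: M_def)
    then show "built p (pair_join {s \<in> M {} 1 {}. s \<inter> W = {}} (M {} p {}) - {})"
      using built_pair_join_empty[OF uniform[of p "{}"]] 0 by simp
    fix x assume x: "x \<in> W"
    have "{s. x \<notin> s \<and> insert x s \<in> M {} 1 {}} = {{}}"
    proof -
      have "s = {}" if "x \<notin> s" "insert x s \<in> M {} 1 {}" for s
        using that finite_face[OF E that(2)] by (auto simp: M_def)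
      then show ?thesis using x by (auto simp: M_def)
    qed
    moreover have "built (p - 1) (M {} p {x})"
      by (rule uniform) (use 0 x finW in auto)
    ultimately show "built (p - 1) (pair_join {s. x \<notin> s \<and> insert x s \<in> M {} 1 {}}
        {t \<in> M {} p {}. x \<notin> t} - {\<tau>. insert (x, 1) \<tau> \<in> {}})"
      using built_pair_join_empty by (simp add: M_delete_elem)
  qed (use finW in auto)
  then show ?case using built_pair_join_swap'[of p "M {} 1 {}"] by (simp add: I)
next
  case (Suc k)
  have finI: "finite I" using Suc.prems(1) finU finite_subset by blast
  obtain i where i: "i \<in> I" using Suc.hyps(2) by force
  then have iU: "i \<in> U" using Suc.prems by blast
  obtain a where a: "a \<in> A i" using block_minus_nonempty[OF iU, of "{}"] by auto
  have J: "I - {i} \<subseteq> U" "card (I - {i}) = k" using Suc.prems(1) Suc.hyps(2) i finI by auto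
  have "built (p + card I) (pair_join (M I p {}) (M I (Suc (card I)) {}) - {})"
  proof (rule block_step[OF Suc.prems(1) i a])
    show "down_closed (pair_join (M I p {}) (M I (Suc (card I)) {}) - {})"
      using down_closed_pair_join_M Suc.prems(1) by simp
    show "built (p + card I - 1) (pair_join (M (I - {i}) p {}) (M (I - {i}) (card I) {}))"
      using Suc.hyps(1)[OF J(2)[symmetric] J(1), of p] J(2) Suc.prems Suc.hyps(2)[symmetric] by simp
    fix v assume v: "v \<in> A i - {a}"
    have "built (p + card I - 1) (pair_join (M I (Suc (card I)) {v}) (M (I - {i}) (p - 1) {}) - {})"
    proof (rule half_block_built[OF Suc.prems(1) i _ Suc.prems(2,3)])
      show "built (p + card I - 2) (pair_join (M (I - {i}) (p - 1) {}) (M (I - {i}) (card I) {}))"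
        using Suc.hyps(1)[OF J(2)[symmetric] J(1), of "p - 1"] J(2) Suc.prems Suc.hyps(2)[symmetric] by simp
    qed (use v in auto)
    then show "built (p + card I - 1) (pair_join (M (I - {i}) (p - 1) {}) (M I (Suc (card I)) {v})
        - {\<tau>. insert (v, 1) \<tau> \<in> {}})"
      using built_pair_join_swap'[of _ "M I (Suc (card I)) {v}"] by simp
  qed (use Suc.prems in auto)
  then show ?case by simp
qed

lemma blocks_built_minus_facet:
  assumes I: "I \<subseteq> U" "I \<noteq> {}" and r: "card W = Suc (card I)" and f: "\<And>j. j \<in> I \<Longrightarrow> f j \<in> A j"
  shows "built (card W + card I) (pair_join (M I (card W) {}) (M I (card W) {}) - {pair_face (f ` I) W})"
proof -
  obtain i where i: "i \<in> I" using I(2) by blast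
  define J where "J = I - {i}"
  define Z where "Z = {pair_face (f ` I) W}"
  have iU: "i \<in> U" and J: "J \<subseteq> U" using I i by (auto simp: J_def)
  have finI: "finite I" using I(1) finU finite_subset by blast
  have cJ: "card I = Suc (card J)" unfolding J_def using finI i by (metis card.remove)
  have fi: "f ` I \<inter> A i = {f i}" using transversal_inter[OF I(1) f i] .
  obtain a where a: "a \<in> A i" "a \<noteq> f i"
  proof -
    have "card ({f i} \<inter> A i) \<le> 1" using card_mono[of "{f i}" "{f i} \<inter> A i"] by simp
    then show ?thesis using block_minus_nonempty[OF iU, of "{f i}"] that by blast
  qed
  have "built (card W + card I) (pair_join (M I (card W) {}) (M I (Suc (card I)) {}) - Z)"
  proof (rule block_step[OF I(1) i a(1)])
    show "down_closed (pair_join (M I (card W) {}) (M I (Suc (card I)) {}) - Z)"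
      unfolding Z_def r[symmetric] by (rule down_closed_remove_top(2)[OF I(1) I(1) f])
    show "\<exists>v\<in>A i - {a}. (v, 1) \<in> z" if "z \<in> Z" for z
      using that f[OF i] a(2) i by (auto simp: Z_def mem_pair_face)
    show "built (card W + card I - 1) (pair_join (M (I - {i}) (card W) {}) (M (I - {i}) (card I) {}))"
      using blocks_built[OF J, of "card W"] cJ r unfolding J_def by simp
    fix v assume v: "v \<in> A i - {a}"
    have IH: "built (card W + card I - 2) (pair_join (M (I - {i}) (card W - 1) {}) (M (I - {i}) (card I) {}))"
      using blocks_built[OF J, of "card W - 1"] cJ r unfolding J_def by simp
    note half = half_block_built[OF I(1) i _ _ _ IH, of v]
    show "built (card W + card I - 1) (pair_join (M (I - {i}) (card W - 1) {}) (M I (Suc (card I)) {v})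
        - {\<tau>. insert (v, 1) \<tau> \<in> Z})"
    proof (cases "v = f i")
      case True
      have "insert (f i, 1) \<sigma> \<in> Z \<longleftrightarrow> \<sigma> = pair_face (f ` J) W"
        if "\<sigma> \<in> pair_join (M J (card W - 1) {}) (M I (Suc (card I)) {v})" for \<sigma>
      proof -
        obtain s t where st: "\<sigma> = pair_face s t" "s \<in> M J (card W - 1) {}"
          using \<open>\<sigma> \<in> _\<close> by (blast elim: pair_joinE)
        have "f i \<notin> s" using M_block_disjoint[OF J iU _ st(2)] f[OF i] by (auto simp: J_def)
        moreover have "f i \<notin> f ` J" using card_transversal[OF I(1) f] card_image_le[of J f] cJ finI i
          by (metis J_def Suc_n_not_le_n finite_Diff image_insert insert_Diff insert_absorb)
        moreover have "f ` I = insert (f i) (f ` J)" using i by (auto simp: J_def)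
        ultimately show ?thesis by (simp add: st(1) Z_def insert_pair_face insert_ident)
      qed
      then have eq: "pair_join (M J (card W - 1) {}) (M I (Suc (card I)) {v}) - {\<tau>. insert (v, 1) \<tau> \<in> Z} =
          pair_join (M J (card W - 1) {}) (M I (Suc (card I)) {v}) - {pair_face (f ` J) W}"
        unfolding True by blast
      have "built (card W + card I - 1) (pair_join (M I (Suc (card I)) {v}) (M J (card W - 1) {})
          - {pair_face W (f ` J)})"
        unfolding J_def by (rule half) (use v r f in auto)
      then show ?thesis
        using built_pair_join_swap[of _ "M I (Suc (card I)) {v}" _ "{(f ` J, W)}"] eq by (simp add: J_def)
    next
      case False
      then have "{\<tau>. insert (v, 1) \<tau> \<in> Z} = {}"
      proof -
        have "v \<notin> f ` I" using fi v False by auto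
        then show ?thesis by (auto simp: Z_def mem_pair_face dest!: equalityD1)
      qed
      moreover have "built (card W + card I - 1) (pair_join (M I (Suc (card I)) {v}) (M (I - {i}) (card W - 1) {}) - {})"
        by (rule half) (use v r in auto)
      ultimately show ?thesis using built_pair_join_swap'[of _ "M I (Suc (card I)) {v}"] by simp
    qed
  qed (use r in simp)
  then show ?thesis by (simp add: Z_def r)
qed

end

section \<open>The matroid of the theorem\<close>

text \<open>\<open>matroid_extend\<close> embeds each independent set into one of size
  \<open>card B\<close>, so the bases are those of this size. As \<open>B\<close> is one of them,
  the description in \<open>matroid_rank\<close> determines a unique number.\<close>

lemma matroid_rankI:
  assumes "matroid E M" "B \<in> M" "\<And>I. I \<in> M \<Longrightarrow> card I \<le> card B"
  shows "matroid_rank M = card B" "\<And>C. matroid_basis M C \<longleftrightarrow> C \<in> M \<and> card C = card B"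
proof -
  show basis: "matroid_basis M C \<longleftrightarrow> C \<in> M \<and> card C = card B" for C
  proof
    assume C: "matroid_basis M C"
    then have "C \<in> M" by (simp add: matroid_basis_def)
    then obtain J where "J \<in> M" "C \<subseteq> J" "card J = card B"
      using matroid_extend[OF assms(1) _ assms(2) assms(3)] by blast
    moreover then have "J = C" using C by (simp add: matroid_basis_def)
    ultimately show "C \<in> M \<and> card C = card B" by simp
  next
    assume C: "C \<in> M \<and> card C = card B"
    have "I = C" if "I \<in> M" "C \<subseteq> I" for I
      using card_seteq[OF matroid_finite(3)[OF assms(1) that(1)] that(2)] assms(3)[OF that(1)] C by simp
    then show "matroid_basis M C" using C unfolding matroid_basis_def by blast
  qed
  show "matroid_rank M = card B"
    unfolding matroid_rank_def using basis assms(2) by (intro the_equality) auto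
qed

lemma realization_nonempty:
  assumes "{v} \<in> K"
  shows "realization K \<noteq> {}"
proof -
  have "{w. (if w = v then 1 else 0::real) \<noteq> 0} = {v}" by auto
  then have "(\<lambda>w. if w = v then 1 else 0) \<in> realization K" using assms by (simp add: realization_def)
  then show ?thesis by blast
qed

lemma block_family_block:
  assumes "r \<ge> 2"
  shows "block_family (block r) {1..r - 1} (block r r)"
proof
  fix i assume i: "i \<in> {1..r - 1}"
  have ne: "k \<noteq> r" if "k \<in> {1..r - 1}" for k
  proof -
    have "k \<le> r - 1" using that by simp
    then show ?thesis using assms by linarith
  qed
  have b: "block r i = Vel i ` {1..r}" using ne[OF i] by (simp add: block_def)
  show "finite (block r i)" by (simp add: b)
  show "2 \<le> card (block r i)" using assms by (simp add: b card_image inj_on_def)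
  show "block r i \<inter> block r r = {}" using ne[OF i] by (auto simp: block_def)
  show "block r i \<inter> block r j = {}" if "j \<in> {1..r - 1}" "i \<noteq> j" for j
  proof -
    show ?thesis using that(2) ne[OF i] ne[OF that(1)] by (auto simp: block_def)
  qed
qed (auto simp: block_def)

lemma ground_eq: "r \<ge> 2 \<Longrightarrow> ground r = (\<Union>i\<in>{1..r - 1}. block r i) \<union> block r r"
proof -
  assume "r \<ge> 2"
  then have "{1..r} = insert r {1..r - 1}" by auto
  then show ?thesis unfolding ground_def by auto
qed

lemma matroid_M_properties:
  assumes r: "r \<ge> 2"
  shows "matroid (ground r) (matroid_M r) \<and>
      matroid_rank (matroid_M r) = r \<and>
      (\<exists>\<B>. card \<B> = r \<and> (\<forall>B\<in>\<B>. matroid_basis (matroid_M r) B) \<and> pairwise disjnt \<B>) \<and>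
      complex_dim (deleted_join 2 (matroid_M r)) = 2 * int r - 1 \<and>
      n_connected (2 * int r - 3) (geometric_realization (deleted_join 2 (matroid_M r))) \<and>
      \<not> n_connected (2 * int r - 2) (geometric_realization (deleted_join 2 (matroid_M r)))"
proof -
  define U where "U = {1..r - 1}"
  define W where "W = block r r"
  interpret block_family "block r" U W
    unfolding U_def W_def by (rule block_family_block[OF r])
  have M: "matroid_M r = M U r {}"
    unfolding matroid_M_def M_def ground_eq[OF r] by (simp add: U_def W_def)
  have cU: "card U = r - 1" and cW: "card W = r"
    by (simp_all add: U_def W_def block_def card_image inj_on_def)
  have sU: "Suc (card U) = r" using cU r by simp
  have mat: "matroid (ground r) (matroid_M r)"
    using M_matroid[of U "{}" r] unfolding M ground_eq[OF r] U_def W_def by simp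
  define f where "f j i = Vel i j" for i j
  \<comment> \<open>Column \<open>j\<close> of the blocks together with \<open>Wel j\<close>;
    different columns are disjoint, which gives both the disjoint bases and a face of the join with
    \<open>2 * r\<close> vertices.\<close>
  define B where "B j = f j ` U \<union> {Wel j}" for j
  have f: "f j i \<in> block r i" if "i \<in> U" "j \<in> {1..r}" for i j
    using that by (auto simp: f_def block_def U_def)
  have B: "B j \<in> matroid_M r" "card (B j) = r" if "j \<in> {1..r}" for j
    using transversal_in_M[of U "f j" "{}" "{Wel j}" r] f that sU
    unfolding M B_def by (auto simp: W_def block_def)
  have disj: "B j \<inter> B k = {}" if "j \<noteq> k" for j k using that by (auto simp: B_def f_def)
  have le: "card I \<le> r" if "I \<in> matroid_M r" for I using that by (simp add: matroid_M_def)
  have 1: "1 \<in> {1..r}" "2 \<in> {1..r}" using r by auto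
  note rank = matroid_rankI[OF mat B(1)[OF 1(1)], unfolded B(2)[OF 1(1)], OF le]
  have bases: "\<exists>\<B>. card \<B> = r \<and> (\<forall>B\<in>\<B>. matroid_basis (matroid_M r) B) \<and> pairwise disjnt \<B>"
  proof (intro exI conjI ballI)
    have "inj_on B {1..r}"
    proof (rule inj_onI)
      fix j k assume "j \<in> {1..r}" "B j = B k"
      moreover have "Wel j \<in> B j" by (simp add: B_def)
      ultimately show "j = k" using disj[of j k] by auto
    qed
    then show "card (B ` {1..r}) = r" by (simp add: card_image)
    show "matroid_basis (matroid_M r) C" if "C \<in> B ` {1..r}" for C
      using that B by (auto simp: rank(2))
    show "pairwise disjnt (B ` {1..r})"
    proof (rule pairwiseI)
      fix C D assume "C \<in> B ` {1..r}" "D \<in> B ` {1..r}" "C \<noteq> D"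
      then obtain j k where "C = B j" "D = B k" "j \<noteq> k" by blast
      then show "disjnt C D" using disj by (simp add: disjnt_def)
    qed
  qed
  define X where "X = pair_join (matroid_M r) (matroid_M r)"
  have dj: "deleted_join 2 (matroid_M r) = X" by (simp add: X_def deleted_join_2)
  have finM: "finite I" if "I \<in> matroid_M r" for I using matroid_finite(3)[OF mat that] .
  have builtX: "built (2 * r - 1) X"
    using blocks_built[of U r] sU cW r by (simp add: X_def M cU mult_2)
  have dim: "complex_dim X = 2 * int r - 1"
    unfolding complex_dim_def
  proof (rule Max_eqI)
    show "finite ((\<lambda>\<sigma>. int (card \<sigma>) - 1) ` X)" using built_finite_faces[OF builtX] by simp
    have "pair_face (B 1) (B 2) \<in> X" using B 1 disj[of 1 2] by (simp add: X_def)
    moreover have "card (pair_face (B 1) (B 2)) = 2 * r"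
      using B 1 finM by (simp add: card_pair_face)
    ultimately show "2 * int r - 1 \<in> (\<lambda>\<sigma>. int (card \<sigma>) - 1) ` X" by force
    fix y assume "y \<in> (\<lambda>\<sigma>. int (card \<sigma>) - 1) ` X"
    then obtain s t where "y = int (card (pair_face s t)) - 1" "s \<in> matroid_M r" "t \<in> matroid_M r"
      by (auto simp: X_def elim: pair_joinE)
    then show "y \<le> 2 * int r - 1" using le[of s] le[of t] finM by (simp add: card_pair_face)
  qed
  have conn: "n_connected (2 * int r - 3) (top_of_set (realization X))"
  proof (rule n_connectedI)
    have "pair_face (B 1) {} \<in> X" using B(1)[OF 1(1)] by (simp add: X_def M M_empty)
    then have "{(Wel 1, 1)} \<in> X"
      by (rule down_closedD[OF built_down_closed[OF builtX]]) (simp add: B_def mem_pair_face)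
    then show "realization X \<noteq> {}" by (rule realization_nonempty)
    show "null_homotopic_spheres i (realization X)" if "int i \<le> 2 * int r - 3" for i
      by (rule built_null_homotopic_spheres[OF builtX]) (use that in linarith)
  qed
  \<comment> \<open>\<open>F\<close> has r - 1 vertices in the first copy and r in the second, so
    its dimension is \<open>d = 2 * r - 2\<close>, and its boundary sphere has dimension 2r - 3, the
    last one controlled by \<open>built (2 * r - 1)\<close>.\<close>
  define F where "F = pair_face (f 1 ` U) W"
  have "f 1 ` U \<union> {} \<in> M U r {}"
    by (rule transversal_in_M) (use f 1 sU in auto)
  moreover have "W \<in> M U r {}"
    using disjW cW by (auto simp: M_def Int_commute)
  moreover have "f 1 ` U \<inter> W = {}" using f[of _ 1] disjW 1 by blast
  ultimately have FX: "F \<in> X" by (simp add: F_def X_def M)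
  have built': "built (2 * r - 1) (X - {F})"
    using blocks_built_minus_facet[of U "f 1"] f 1 sU cW r
    by (simp add: X_def F_def M cU U_def mult_2)
  have "\<not> n_connected (int (2 * r - 2)) (top_of_set (realization (insert F (X - {F}))))"
  proof (rule facet_not_n_connected[OF built_down_closed[OF built']])
    show "F - {y} \<in> X - {F}" if "y \<in> F" for y
      using down_closedD[OF built_down_closed[OF builtX] FX, of "F - {y}"] that by auto
    have finF: "finite (f 1 ` U)" "finite W" using finW by (auto simp: U_def)
    then show "finite F" by (simp add: F_def pair_face_def)
    have "card (f 1 ` U) = card U" by (rule card_transversal) (use f 1 in auto)
    then show "card F = Suc (2 * r - 2)" using finF cU cW r by (simp add: F_def card_pair_face)
    show "null_homotopic_spheres (2 * r - 2 - 1) (realization (X - {F}))"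
      by (rule built_null_homotopic_spheres[OF built']) (use r in simp)
  qed (use r in auto)
  moreover have "insert F (X - {F}) = X" using FX by auto
  moreover have "int (2 * r - 2) = 2 * int r - 2" using r by simp
  ultimately have "\<not> n_connected (2 * int r - 2) (top_of_set (realization X))" by simp
  then show ?thesis
    using mat rank(1) bases dim conn by (simp add: dj geometric_realization_eq)
qed

theorem theorem1p2:
  "(\<forall>r::nat. r \<ge> 2 \<longrightarrow>
      matroid (ground r) (matroid_M r) \<and>
      matroid_rank (matroid_M r) = r \<and>
      (\<exists>\<B>. card \<B> = r \<and> (\<forall>B\<in>\<B>. matroid_basis (matroid_M r) B) \<and> pairwise disjnt \<B>) \<and>
      complex_dim (deleted_join 2 (matroid_M r)) = 2 * int r - 1 \<and>
      n_connected (2 * int r - 3) (geometric_realization (deleted_join 2 (matroid_M r))) \<and>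
      \<not> n_connected (2 * int r - 2) (geometric_realization (deleted_join 2 (matroid_M r)))) \<and>
   (\<exists>(E :: nat \<Rightarrow> elt set) (N :: nat \<Rightarrow> elt set set). \<forall>r\<ge>2.
      matroid (E r) (N r) \<and>
      matroid_rank (N r) = r \<and>
      (\<exists>\<B>. card \<B> = r \<and> (\<forall>B\<in>\<B>. matroid_basis (N r) B) \<and> pairwise disjnt \<B>) \<and>
      complex_dim (deleted_join 2 (N r)) = 2 * int r - 1 \<and>
      n_connected (2 * int r - 3) (geometric_realization (deleted_join 2 (N r))) \<and>
      \<not> n_connected (2 * int r - 2) (geometric_realization (deleted_join 2 (N r))))"
  using matroid_M_properties by (intro conjI exI[of _ ground] exI[of _ matroid_M]) blast+

end
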